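(* Let $\mathcal{B}$ be a complete Boolean algebra, let $Q$ be the Stone space of $\mathcal{B}$, let $X$ be an ideal in $C(Q)$ and let $Y$ be a solid space in $L^0(\mathcal{B})$. The following conditions are equivalent: (i) There exists a non-zero band preserving derivation from $X$ into $Y$. (ii) There exists a non-zero idempotent $e\in\mathcal{B}$ with $e\leqslant s(X)s(Y)$ such that $eY=eL^0(\mathcal{B})$ (i.e. $Y$ is $e$-extended) and the Boolean algebra $\mathcal{B}_e$ is not $\sigma$-distributive.
   Context: $L^0(\mathcal{B}):=C_\infty(Q)$ denotes the set of all continuous functions $x:Q\to[-\infty,+\infty]$ taking the values $\pm\infty$ at most on a nowhere dense set; with the usual operations (pointwise on a dense open set, extended by continuity) and pointwise order it is a commutative real algebra and a universally complete vector lattice. $C(Q)\subset L^0(\mathcal{B})$ is the subalgebra of continuous real-valued functions. $\mathcal{B}$ is identified with the Boolean algebra of idempotents of $L^0(\mathcal{B})$ (characteristic functions of clopen sets); $\mathbf{1}$ is the constant function one, and for $p,q\in\mathcal B$ the product $pq$ is the meet. For $e\in\mathcal{B}$, $\mathcal{B}_e=\{q\in\mathcal{B}:q\leqslant e\}$, a Boolean algebra with unit $e$. A $\sigma$-complete Boolean algebra is $\sigma$-distributive if $\bigvee_{n}\bigwedge_{m}e_{n,m}=\bigwedge_{\varphi\in\mathbb{N}^{\mathbb{N}}}\bigvee_{n}e_{n,\varphi(n)}$ for every double sequence $\{e_{n,m}\}_{n,m\in\mathbb{N}}$ in it. Support: for $x\in L^0(\mathcal{B})$, $s(x)=\mathbf{1}-\sup\{e\in\mathcal{B}:ex=0\}\in\mathcal{B}$;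 for non-empty $E\subset L^0(\mathcal{B})$, $s(E)=\sup\{s(x):x\in E\}$. For $e\in\mathcal B$, $eE=\{ex:x\in E\}$. A solid space in $L^0(\mathcal{B})$ is a non-zero linear subspace $Y$ such that $x\in Y$, $y\in L^0(\mathcal{B})$, $|y|\leqslant|x|$ imply $y\in Y$ (then $ay\in Y$ for $a\in C(Q)$, $y\in Y$). An ideal in $C(Q)$ is a subalgebra $X\subset C(Q)$ with $xa\in X$ for all $x\in C(Q)$, $a\in X$. A derivation $\delta:X\to Y$ is a linear map with $\delta(xy)=\delta(x)y+x\delta(y)$ for all $x,y\in X$; it is band preserving if $s(\delta(x))\leqslant s(x)$ for all $x\in X$. *)

theory Defs
  imports "HOL-Analysis.Analysis"
begin

section \<open>Complete Boolean algebras and their Stone spaces\<close>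

text \<open>
  The library class \<^class>\<open>complete_boolean_algebra\<close> includes complete distributivity of infinite
  infima over suprema, so that all its instances are \<open>\<sigma>\<close>-distributive. A complete Boolean
  algebra in the usual sense is a Boolean algebra in which all suprema and infima exist.
\<close>

class complete_ba = boolean_algebra + complete_lattice

definition ultrafilter :: "'b::boolean_algebra set \<Rightarrow> bool" where
  "ultrafilter u \<longleftrightarrow> bot \<notin> u \<and> top \<in> u \<and> (\<forall>a\<in>u. \<forall>b\<in>u. inf a b \<in> u) \<and>
     (\<forall>a\<in>u. \<forall>b. a \<le> b \<longrightarrow> b \<in> u) \<and> (\<forall>a. a \<in> u \<or> - a \<in> u)"

definition clopen :: "'b::boolean_algebra \<Rightarrow> 'b set set" where
  "clopen b = {u. ultrafilter u \<and> b \<in> u}"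

definition stone_space :: "'b::boolean_algebra set topology" where
  "stone_space = topology_generated_by (range clopen)"

definition dense_open :: "'b::boolean_algebra set set \<Rightarrow> bool" where
  "dense_open U \<longleftrightarrow> openin stone_space U \<and> stone_space closure_of U = topspace stone_space"

definition nowhere_dense :: "'b::boolean_algebra set set \<Rightarrow> bool" where
  "nowhere_dense N \<longleftrightarrow> stone_space interior_of (stone_space closure_of N) = {}"

lemma clopen_top: "clopen top = {u. ultrafilter u}"
  by (auto simp: clopen_def ultrafilter_def)

lemma clopen_bot: "clopen bot = {}"
  by (auto simp: clopen_def ultrafilter_def)

lemma clopen_inf: "clopen (inf a b) = clopen a \<inter> clopen b"
  unfolding clopen_def ultrafilter_def by (auto intro: inf_le1 inf_le2)

lemma ultrafilter_compl: "ultrafilter u \<Longrightarrow> - a \<in> u \<longleftrightarrow> a \<notin> u"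
  unfolding ultrafilter_def by (metis inf_compl_bot)

lemma clopen_compl: "clopen (- a) = {u. ultrafilter u} - clopen a"
  unfolding clopen_def using ultrafilter_compl by auto

lemma clopen_mono: "a \<le> b \<Longrightarrow> clopen a \<subseteq> clopen b"
  unfolding clopen_def ultrafilter_def by auto

lemma topspace_stone: "topspace stone_space = {u. ultrafilter u}"
proof -
  have "\<Union>(range clopen) = {u. ultrafilter u}"
    using clopen_top by (auto simp: clopen_def)
  then show ?thesis by (simp add: stone_space_def)
qed

lemma openin_clopen: "openin stone_space (clopen b)"
  unfolding stone_space_def by (rule topology_generated_by_Basis) simp

lemma openin_stone:
  "openin stone_space S \<longleftrightarrow> S \<subseteq> {u. ultrafilter u} \<and> (\<forall>u\<in>S. \<exists>b\<in>u. clopen b \<subseteq> S)" (is "?L = ?R")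
proof
  assume ?L
  then have "generate_topology_on (range clopen) S"
    by (simp add: stone_space_def openin_topology_generated_by_iff)
  then have "\<forall>u\<in>S. \<exists>b\<in>u. clopen b \<subseteq> S"
  proof induction
    case Empty then show ?case by simp
  next
    case (Int A B)
    show ?case
    proof
      fix u assume u: "u \<in> A \<inter> B"
      obtain a b where ab: "a \<in> u" "clopen a \<subseteq> A" "b \<in> u" "clopen b \<subseteq> B"
        using Int.IH u by blast
      have "openin stone_space A"
        using Int.hyps(1) by (simp add: stone_space_def openin_topology_generated_by_iff)
      from openin_subset[OF this] have "ultrafilter u"
        using u by (auto simp: topspace_stone)
      then have "inf a b \<in> u" using ab unfolding ultrafilter_def by metis
      moreover have "clopen (inf a b) \<subseteq> A \<inter> B" unfolding clopen_inf using ab by blast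
      ultimately show "\<exists>b\<in>u. clopen b \<subseteq> A \<inter> B" by blast
    qed
  next
    case (UN K)
    show ?case
    proof
      fix u assume "u \<in> \<Union>K"
      then obtain k where k: "k \<in> K" "u \<in> k" by (rule UnionE)
      then obtain b where "b \<in> u" "clopen b \<subseteq> k" using UN.IH by meson
      then show "\<exists>b\<in>u. clopen b \<subseteq> \<Union>K" using k(1) by (meson Union_upper subset_trans)
    qed
  next
    case (Basis s)
    then obtain b where b: "s = clopen b" by (rule rangeE)
    show ?case
    proof
      fix u assume "u \<in> s"
      then show "\<exists>b\<in>u. clopen b \<subseteq> s" unfolding b by (intro bexI[of _ b]) (simp_all add: clopen_def)
    qed
  qed
  then show ?R using openin_subset[OF \<open>?L\<close>] by (simp add: topspace_stone)
next
  assume R: ?R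
  have "S = \<Union>{clopen b | b. clopen b \<subseteq> S}"
  proof (intro equalityI subsetI)
    fix u assume u: "u \<in> S"
    then obtain b where b: "b \<in> u" "clopen b \<subseteq> S" using R by blast
    moreover have "u \<in> clopen b" using u R b(1) by (auto simp: clopen_def)
    ultimately show "u \<in> \<Union>{clopen b | b. clopen b \<subseteq> S}" by blast
  qed blast
  moreover have "openin stone_space (\<Union>{clopen b | b. clopen b \<subseteq> S})"
    using openin_clopen by (intro openin_Union) auto
  ultimately show ?L by simp
qed

lemma stone_openE:
  assumes "openin stone_space S" "u \<in> S"
  obtains b where "ultrafilter u" "b \<in> u" "b \<noteq> bot" "clopen b \<subseteq> S"
proof -
  have "S \<subseteq> {u. ultrafilter u}" "\<forall>u\<in>S. \<exists>b\<in>u. clopen b \<subseteq> S"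
    using assms(1) openin_stone by blast+
  then obtain b where "ultrafilter u" "b \<in> u" "clopen b \<subseteq> S" using assms(2) by blast
  moreover have "b \<noteq> bot" using calculation unfolding ultrafilter_def by metis
  ultimately show thesis using that by blast
qed

lemma ultrafilter_exists:
  fixes b :: "'b::boolean_algebra"
  assumes "b \<noteq> bot"
  shows "\<exists>u. ultrafilter u \<and> b \<in> u"
proof -
  define A where "A = {F::'b set. bot \<notin> F \<and> b \<in> F \<and> (\<forall>a\<in>F. \<forall>b\<in>F. inf a b \<in> F) \<and>
     (\<forall>a\<in>F. \<forall>b. a \<le> b \<longrightarrow> b \<in> F)}"
  have "{c. b \<le> c} \<in> A" using assms by (auto simp: A_def bot_unique)
  then have ne: "A \<noteq> {}" by blast
  have "\<exists>M\<in>A. \<forall>X\<in>A. M \<subseteq> X \<longrightarrow> X = M"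
  proof (rule subset_Zorn_nonempty[OF ne])
    fix C assume C: "C \<noteq> {}" "subset.chain A C"
    then have CA: "C \<subseteq> A" and ch: "\<And>X Y. X \<in> C \<Longrightarrow> Y \<in> C \<Longrightarrow> X \<subseteq> Y \<or> Y \<subseteq> X"
      by (auto simp: subset_chain_def)
    have "inf x y \<in> \<Union>C" if xy: "x \<in> \<Union>C" "y \<in> \<Union>C" for x y
    proof -
      obtain X Y where XY: "X \<in> C" "x \<in> X" "Y \<in> C" "y \<in> Y" using xy by blast
      then obtain Z where "Z \<in> C" "x \<in> Z" "y \<in> Z" using ch[of X Y] by blast
      then show ?thesis using CA by (auto simp: A_def)
    qed
    moreover have "bot \<notin> \<Union>C" using CA by (auto simp: A_def)
    moreover have "b \<in> \<Union>C" using CA C(1) by (auto simp: A_def)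
    moreover have "y \<in> \<Union>C" if xy: "x \<in> \<Union>C" "x \<le> y" for x y
    proof -
      obtain X where X: "X \<in> C" "x \<in> X" using xy(1) by blast
      then have "y \<in> X" using CA xy(2) by (auto simp: A_def)
      then show ?thesis using X by blast
    qed
    ultimately show "\<Union>C \<in> A"
      unfolding A_def mem_Collect_eq by (intro conjI ballI allI impI) assumption+
  qed
  then obtain M where M: "M \<in> A" and mx: "\<And>X. X \<in> A \<Longrightarrow> M \<subseteq> X \<Longrightarrow> X = M" by blast
  have M': "bot \<notin> M" "b \<in> M" "\<And>x y. x \<in> M \<Longrightarrow> y \<in> M \<Longrightarrow> inf x y \<in> M"
    "\<And>x y. x \<in> M \<Longrightarrow> x \<le> y \<Longrightarrow> y \<in> M" using M by (auto simp: A_def)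
  have "a \<in> M \<or> - a \<in> M" for a
  proof (rule ccontr)
    assume n: "\<not> (a \<in> M \<or> - a \<in> M)"
    define N where "N = {c. \<exists>f\<in>M. inf f a \<le> c}"
    have "bot \<notin> N"
    proof
      assume "bot \<in> N"
      then obtain f where f: "f \<in> M" "inf f a = bot" by (auto simp: N_def bot_unique)
      then have "f \<le> - a" by (simp add: inf_shunt)
      then show False using f M'(4) n by blast
    qed
    moreover have sub: "M \<subseteq> N" by (auto simp: N_def intro: le_infI1)
    moreover have "inf x y \<in> N" if xy: "x \<in> N" "y \<in> N" for x y
    proof -
      obtain f g where fg: "f \<in> M" "inf f a \<le> x" "g \<in> M" "inf g a \<le> y" using xy by (auto simp: N_def)
      have "inf (inf f g) a \<le> inf x y"
        using fg by (intro inf_greatest) (meson inf_le1 inf_le2 inf_mono order_refl order_trans)+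
      then show ?thesis using fg M'(3) by (auto simp: N_def)
    qed
    moreover have "y \<in> N" if "x \<in> N" "x \<le> y" for x y
      using that by (auto simp: N_def intro: order_trans)
    ultimately have "N \<in> A" using M'(2) by (auto simp: A_def)
    then have "N = M" using mx sub by blast
    moreover have "a \<in> N" using M'(2) by (auto simp: N_def)
    ultimately show False using n by blast
  qed
  moreover have "top \<in> M" using M'(2,4) top_greatest by blast
  ultimately have "ultrafilter M" using M' by (auto simp: ultrafilter_def)
  then show ?thesis using M'(2) by blast
qed

lemma clopen_eq_empty: "clopen b = {} \<longleftrightarrow> b = bot"
  using ultrafilter_exists[of b] clopen_bot by (auto simp: clopen_def)

lemma dense_open_iff:
  "dense_open U \<longleftrightarrow> openin stone_space U \<and> (\<forall>b. b \<noteq> bot \<longrightarrow> U \<inter> clopen b \<noteq> {})"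
proof -
  have "(stone_space closure_of U = topspace stone_space) \<longleftrightarrow> (\<forall>b. b \<noteq> bot \<longrightarrow> U \<inter> clopen b \<noteq> {})"
    unfolding dense_intersects_open
  proof safe
    fix b :: 'a
    assume *: "\<forall>T. openin stone_space T \<and> T \<noteq> {} \<longrightarrow> U \<inter> T \<noteq> {}" and b: "b \<noteq> bot" "U \<inter> clopen b = {}"
    then show False using openin_clopen clopen_eq_empty by metis
  next
    fix T :: "'a set set" and x
    assume *: "\<forall>b. b \<noteq> bot \<longrightarrow> U \<inter> clopen b \<noteq> {}" and T: "openin stone_space T" "U \<inter> T = {}" "x \<in> T"
    obtain b where "b \<noteq> bot" "clopen b \<subseteq> T" using T(1,3) by (rule stone_openE)
    then show "x \<in> {}" using * T(2) by blast
  qed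
  then show ?thesis by (simp add: dense_open_def)
qed

lemma dense_open_Int: "dense_open U \<Longrightarrow> dense_open V \<Longrightarrow> dense_open (U \<inter> V)"
proof -
  assume U: "dense_open U" and V: "dense_open V"
  have "U \<inter> V \<inter> clopen b \<noteq> {}" if "b \<noteq> bot" for b
  proof -
    have "U \<inter> clopen b \<noteq> {}" using U that dense_open_iff by blast
    then obtain u where u: "u \<in> U \<inter> clopen b" by blast
    have "openin stone_space (U \<inter> clopen b)" using U openin_clopen by (auto simp: dense_open_iff)
    then obtain c where c: "c \<noteq> bot" "clopen c \<subseteq> U \<inter> clopen b" using u by (rule stone_openE)
    then have "V \<inter> clopen c \<noteq> {}" using V dense_open_iff by blast
    then show ?thesis using c by blast
  qed
  then show ?thesis using U V by (auto simp: dense_open_iff)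
qed

lemma dense_open_topspace: "dense_open (topspace stone_space)"
  by (simp add: dense_open_def)

lemma clopen_Sup:
  fixes W :: "'b::complete_ba set set"
  assumes W: "openin stone_space W"
  shows "W \<subseteq> clopen (Sup {b. clopen b \<subseteq> W})"
    and "inf c (Sup {b. clopen b \<subseteq> W}) = bot \<longleftrightarrow> clopen c \<inter> W = {}"
proof -
  let ?s = "Sup {b. clopen b \<subseteq> W}"
  show sub: "W \<subseteq> clopen ?s"
  proof
    fix u assume "u \<in> W"
    with W obtain b where b: "ultrafilter u" "b \<in> u" "clopen b \<subseteq> W" by (rule stone_openE)
    then have "clopen b \<subseteq> clopen ?s" by (intro clopen_mono Sup_upper) simp
    moreover have "u \<in> clopen b" using b by (simp add: clopen_def)
    ultimately show "u \<in> clopen ?s" by blast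
  qed
  show "inf c ?s = bot \<longleftrightarrow> clopen c \<inter> W = {}"
  proof
    assume "inf c ?s = bot"
    then have "clopen c \<inter> clopen ?s = {}" using clopen_inf[of c ?s] by (simp add: clopen_bot)
    then show "clopen c \<inter> W = {}" using sub by blast
  next
    assume d: "clopen c \<inter> W = {}"
    have "b \<le> - c" if "clopen b \<subseteq> W" for b
    proof -
      have "clopen (inf b c) = {}" using that d by (auto simp: clopen_inf)
      then show ?thesis by (simp add: clopen_eq_empty inf_shunt)
    qed
    then have "?s \<le> - c" by (auto intro: Sup_least)
    then show "inf c ?s = bot" by (metis inf.commute inf_shunt)
  qed
qed

section \<open>The algebra of extended real-valued continuous functions\<close>

text \<open>Functions are normalised to be \<^term>\<open>undefined\<close> outside the Stone space.\<close>

definition C_infinity :: "('b::complete_ba set \<Rightarrow> ereal) set" where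
  "C_infinity = {x \<in> extensional (topspace stone_space). continuous_map stone_space euclidean x \<and>
     nowhere_dense {q \<in> topspace stone_space. \<bar>x q\<bar> = \<infinity>}}"

lemma C_infinity_iff:
  "x \<in> C_infinity \<longleftrightarrow> x \<in> extensional (topspace stone_space) \<and> continuous_map stone_space euclidean x \<and>
     dense_open {q \<in> topspace stone_space. \<bar>x q\<bar> \<noteq> \<infinity>}"
proof -
  have "nowhere_dense {q \<in> topspace stone_space. \<bar>x q\<bar> = \<infinity>} \<longleftrightarrow>
      dense_open {q \<in> topspace stone_space. \<bar>x q\<bar> \<noteq> \<infinity>}"
    if c: "continuous_map stone_space euclidean x"
  proof -
    let ?N = "{q \<in> topspace stone_space. \<bar>x q\<bar> = \<infinity>}"
    let ?F = "{q \<in> topspace stone_space. \<bar>x q\<bar> \<noteq> \<infinity>}"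
    have "?N = {q \<in> topspace stone_space. x q \<in> {\<infinity>, - \<infinity>}}" by auto
    then have cl: "closedin stone_space ?N"
      using closedin_continuous_map_preimage[OF c, of "{\<infinity>, - \<infinity>}"] by auto
    have F: "?F = topspace stone_space - ?N" by auto
    then have op: "openin stone_space ?F" using openin_diff[OF openin_topspace cl] by simp
    have "nowhere_dense ?N \<longleftrightarrow> stone_space interior_of ?N = {}"
      using cl by (simp add: nowhere_dense_def closure_of_closedin)
    also have "\<dots> \<longleftrightarrow> stone_space closure_of ?F = topspace stone_space"
      unfolding F closure_of_complement
      using interior_of_subset_topspace[of stone_space ?N] by blast
    finally show ?thesis using op by (simp add: dense_open_def)
  qed
  then show ?thesis by (auto simp: C_infinity_def)
qed

lemma const_C_infinity: "(\<lambda>q\<in>topspace stone_space. ereal r) \<in> (C_infinity :: ('b::complete_ba set \<Rightarrow> ereal) set)"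
proof -
  let ?c = "(\<lambda>q\<in>topspace stone_space. ereal r) :: 'b set \<Rightarrow> ereal"
  have fin: "{q \<in> topspace stone_space. \<bar>?c q\<bar> \<noteq> \<infinity>} = topspace stone_space"
    by auto
  have "continuous_map stone_space euclidean ?c"
    by (rule continuous_map_eq[of _ _ "\<lambda>q. ereal r"]) auto
  then show ?thesis unfolding C_infinity_iff fin by (simp add: dense_open_topspace)
qed

typedef (overloaded) 'b L0 = "C_infinity :: ('b::complete_ba set \<Rightarrow> ereal) set"
  morphisms apply_L0 Abs_L0
  using const_C_infinity by blast

setup_lifting type_definition_L0

definition generically :: "'b::boolean_algebra set filter" where
  "generically = Abs_filter (\<lambda>P. \<exists>U. dense_open U \<and> (\<forall>q\<in>U. P q))"

lemma eventually_generically: "eventually P generically \<longleftrightarrow> (\<exists>U. dense_open U \<and> (\<forall>q\<in>U. P q))"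
  unfolding generically_def
proof (rule eventually_Abs_filter, rule is_filter.intro)
  show "\<exists>U. dense_open U \<and> (\<forall>q\<in>U. True)" using dense_open_topspace by blast
next
  fix P Q :: "'a set \<Rightarrow> bool"
  assume "\<exists>U. dense_open U \<and> (\<forall>q\<in>U. P q)" "\<exists>U. dense_open U \<and> (\<forall>q\<in>U. Q q)"
  then obtain U V where "dense_open U" "\<forall>q\<in>U. P q" "dense_open V" "\<forall>q\<in>V. Q q" by blast
  then show "\<exists>U. dense_open U \<and> (\<forall>q\<in>U. P q \<and> Q q)"
    by (intro exI[of _ "U \<inter> V"]) (auto intro: dense_open_Int)
next
  fix P Q :: "'a set \<Rightarrow> bool"
  assume "\<forall>x. P x \<longrightarrow> Q x" "\<exists>U. dense_open U \<and> (\<forall>q\<in>U. P q)"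
  then show "\<exists>U. dense_open U \<and> (\<forall>q\<in>U. Q q)" by blast
qed

lemma generically_finite: "eventually (\<lambda>q. \<bar>apply_L0 x q\<bar> \<noteq> \<infinity>) generically"
proof -
  have "dense_open {q \<in> topspace stone_space. \<bar>apply_L0 x q\<bar> \<noteq> \<infinity>}"
    using apply_L0[of x] by (simp only: C_infinity_iff)
  then show ?thesis unfolding eventually_generically by (rule_tac exI, rule conjI) auto
qed

lemma generically_ultrafilter: "eventually ultrafilter generically"
  unfolding eventually_generically
  by (rule exI[of _ "topspace stone_space"]) (simp add: dense_open_topspace topspace_stone[symmetric], simp add: topspace_stone)

lemma dense_open_mono: "dense_open U \<Longrightarrow> openin stone_space V \<Longrightarrow> U \<subseteq> V \<Longrightarrow> dense_open V"
  unfolding dense_open_iff by blast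

lemma Hausdorff_ereal: "Hausdorff_space (euclidean :: ereal topology)"
  unfolding Hausdorff_space_def disjnt_def
proof safe
  fix x y :: ereal assume "x \<noteq> y"
  from hausdorff[OF this]
  show "\<exists>U V. openin euclidean U \<and> openin euclidean V \<and> x \<in> U \<and> y \<in> V \<and> U \<inter> V = {}"
    by (simp only: open_openin)
qed

lemma L0_eqI_generically:
  assumes "eventually (\<lambda>q. apply_L0 x q = apply_L0 y q) generically"
  shows "x = y"
proof -
  obtain U where U: "dense_open U" "\<And>q. q \<in> U \<Longrightarrow> apply_L0 x q = apply_L0 y q"
    using assms unfolding eventually_generically by blast
  have x: "apply_L0 x \<in> C_infinity" and y: "apply_L0 y \<in> C_infinity" by (rule apply_L0)+
  have "apply_L0 x q = apply_L0 y q" if "q \<in> topspace stone_space" for q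
  proof (rule forall_in_closure_of_eq[of q stone_space U euclidean])
    show "q \<in> stone_space closure_of U" using U(1) that by (simp add: dense_open_def)
    show "Hausdorff_space (euclidean :: ereal topology)" by (rule Hausdorff_ereal)
    show "continuous_map stone_space euclidean (apply_L0 x)" "continuous_map stone_space euclidean (apply_L0 y)"
      using x y by (simp_all add: C_infinity_iff)
    show "apply_L0 x p = apply_L0 y p" if "p \<in> U" for p using U(2) that .
  qed
  then have "apply_L0 x = apply_L0 y"
    using x y by (intro extensionalityI[of _ "topspace stone_space"]) (auto simp: C_infinity_iff)
  then show ?thesis by (simp add: apply_L0_inject)
qed

text \<open>
  Operations are performed pointwise where all arguments are finite and extended by continuity;
  \<open>L0_extend_ex\<close> below shows that the described element exists.
\<close>

definition L0_pointwise :: "(ereal \<Rightarrow> ereal \<Rightarrow> ereal) \<Rightarrow> 'b::complete_ba L0 \<Rightarrow> 'b L0 \<Rightarrow> 'b L0" where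
  "L0_pointwise h x y = (THE z. \<exists>U. dense_open U \<and>
     (\<forall>q\<in>U. \<bar>apply_L0 x q\<bar> \<noteq> \<infinity> \<and> \<bar>apply_L0 y q\<bar> \<noteq> \<infinity> \<and> apply_L0 z q = h (apply_L0 x q) (apply_L0 y q)))"

lemma L0_extend_ex:
  fixes f :: "'b::complete_ba set \<Rightarrow> real"
  assumes U: "dense_open U" and f: "continuous_map (subtopology stone_space U) euclidean f"
  shows "\<exists>z. \<forall>q\<in>U. apply_L0 z q = ereal (f q)"
proof -
  have opU: "openin stone_space U" and Uu: "U \<subseteq> {u. ultrafilter u}"
    using U openin_stone unfolding dense_open_def by blast+
  have f': "continuous_map (subtopology stone_space U) euclidean (\<lambda>q. ereal (f q))"
    using continuous_map_compose[OF f, of euclidean ereal] by (simp add: o_def continuous_on_ereal)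
  have pre: "openin stone_space {q \<in> U. ereal (f q) \<in> T}" if "open T" for T
    using openin_continuous_map_preimage[OF f', of T] that opU
    by (auto simp: openin_open_subtopology topspace_subtopology Collect_conj_eq
        openin_subset inf_absorb2 topspace_stone Uu Int_absorb1)
  define F where "F q = (INF b\<in>q. SUP u\<in>U \<inter> clopen b. ereal (f u))" for q
  have lt: "\<exists>b\<in>q. \<forall>p\<in>clopen b. F p < r" if q: "ultrafilter q" "F q < r" for q r
  proof -
    obtain s where s: "F q < s" "s < r" using q(2) dense by blast
    obtain b where b: "b \<in> q" "(SUP u\<in>U \<inter> clopen b. ereal (f u)) < s"
      using s(1) unfolding F_def INF_less_iff by blast
    have "F p < r" if "p \<in> clopen b" for p
    proof -
      have "F p \<le> (SUP u\<in>U \<inter> clopen b. ereal (f u))"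
        unfolding F_def using that by (intro INF_lower) (auto simp: clopen_def)
      then show ?thesis using b s by auto
    qed
    then show ?thesis using b by blast
  qed
  have gt: "\<exists>b\<in>q. \<forall>p\<in>clopen b. r < F p" if q: "ultrafilter q" "r < F q" for q r
  proof -
    obtain s where s: "r < s" "s < F q" using q(2) dense by blast
    define V where "V = {q \<in> U. ereal (f q) \<in> {s<..}}"
    have V: "openin stone_space V" unfolding V_def by (rule pre) simp
    define c where "c = Sup {b. clopen b \<subseteq> V}"
    have "c \<in> q"
    proof (rule ccontr)
      assume "c \<notin> q"
      then have cq: "- c \<in> q" using q ultrafilter_compl by blast
      have "clopen (- c) \<inter> V = {}" using clopen_Sup(2)[OF V, of "- c"] by (simp add: c_def)
      then have "(SUP u\<in>U \<inter> clopen (- c). ereal (f u)) \<le> s"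
        by (intro SUP_least) (auto simp: V_def not_less[symmetric])
      then have "F q \<le> s" unfolding F_def using cq by (meson INF_lower2)
      then show False using s by auto
    qed
    moreover have "r < F p" if p: "p \<in> clopen c" for p
    proof -
      have "s \<le> F p" unfolding F_def
      proof (rule INF_greatest)
        fix b assume "b \<in> p"
        then have "inf b c \<noteq> bot" using p unfolding clopen_def ultrafilter_def by (metis (lifting) mem_Collect_eq)
        then obtain u where "u \<in> clopen b" "u \<in> V" using clopen_Sup(2)[OF V, of b] by (auto simp: c_def)
        then show "s \<le> (SUP u\<in>U \<inter> clopen b. ereal (f u))"
          by (intro SUP_upper2[of u]) (auto simp: V_def)
      qed
      then show ?thesis using s by auto
    qed
    ultimately show ?thesis by blast
  qed
  have FU: "F q = ereal (f q)" if q: "q \<in> U" for q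
  proof (rule antisym)
    have uq: "ultrafilter q" using q Uu by blast
    show "ereal (f q) \<le> F q" unfolding F_def
      using q uq by (intro INF_greatest SUP_upper) (auto simp: clopen_def)
    show "F q \<le> ereal (f q)"
    proof (rule dense_ge)
      fix r assume r: "ereal (f q) < r"
      have "openin stone_space {q \<in> U. ereal (f q) \<in> {..<r}}" by (rule pre) simp
      moreover have "q \<in> {q \<in> U. ereal (f q) \<in> {..<r}}" using q r by simp
      ultimately obtain b where b: "b \<in> q" "clopen b \<subseteq> {q \<in> U. ereal (f q) \<in> {..<r}}"
        by (rule stone_openE)
      then have "(SUP u\<in>U \<inter> clopen b. ereal (f u)) \<le> r" by (intro SUP_least) auto
      then show "F q \<le> r" unfolding F_def using b by (meson INF_lower2)
    qed
  qed
  let ?F = "restrict F (topspace stone_space)"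
  have "continuous_map stone_space euclidean F"
    unfolding continuous_map_upper_lower_semicontinuous_lt
  proof safe
    fix r
    show "openin stone_space {x \<in> topspace stone_space. r < F x}"
      unfolding openin_stone topspace_stone
    proof safe
      fix u assume "ultrafilter u" "r < F u"
      then obtain b where "b \<in> u" "\<forall>p\<in>clopen b. r < F p" using gt by blast
      then show "\<exists>b\<in>u. clopen b \<subseteq> {x \<in> {u. ultrafilter u}. r < F x}"
        by (intro bexI[of _ b]) (auto simp: clopen_def)
    qed
    show "openin stone_space {x \<in> topspace stone_space. F x < r}"
      unfolding openin_stone topspace_stone
    proof safe
      fix u assume "ultrafilter u" "F u < r"
      then obtain b where "b \<in> u" "\<forall>p\<in>clopen b. F p < r" using lt by blast
      then show "\<exists>b\<in>u. clopen b \<subseteq> {x \<in> {u. ultrafilter u}. F x < r}"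
        by (intro bexI[of _ b]) (auto simp: clopen_def)
    qed
  qed
  then have c: "continuous_map stone_space euclidean ?F"
    by (rule continuous_map_eq) auto
  have fin: "?F q = ereal (f q)" if "q \<in> U" for q
    using that FU Uu by (auto simp: topspace_stone)
  have "openin stone_space {q \<in> topspace stone_space. ?F q \<in> - {\<infinity>, - \<infinity>}}"
    by (rule openin_continuous_map_preimage[OF c]) (simp add: open_openin[symmetric] open_Compl)
  moreover have "{q \<in> topspace stone_space. ?F q \<in> - {\<infinity>, - \<infinity>}} = {q \<in> topspace stone_space. \<bar>?F q\<bar> \<noteq> \<infinity>}"
    by auto
  moreover have "U \<subseteq> {q \<in> topspace stone_space. \<bar>?F q\<bar> \<noteq> \<infinity>}"
    using FU Uu by (auto simp: topspace_stone)
  ultimately have "dense_open {q \<in> topspace stone_space. \<bar>?F q\<bar> \<noteq> \<infinity>}"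
    by (metis (lifting) dense_open_mono[OF U])
  then have "?F \<in> C_infinity" unfolding C_infinity_iff using c by blast
  then have "apply_L0 (Abs_L0 ?F) = ?F" by (rule Abs_L0_inverse)
  then show ?thesis using fin by metis
qed

lemma L0_pointwise:
  fixes x y :: "'a::complete_ba L0"
  assumes h: "\<And>a b. h (ereal a) (ereal b) = ereal (g a b)"
    and g: "continuous_on UNIV (\<lambda>p. g (fst p) (snd p))"
  shows "eventually (\<lambda>q. apply_L0 (L0_pointwise h x y) q = h (apply_L0 x q) (apply_L0 y q)) generically"
proof -
  let ?P = "\<lambda>z q. \<bar>apply_L0 x q\<bar> \<noteq> \<infinity> \<and> \<bar>apply_L0 y q\<bar> \<noteq> \<infinity> \<and> apply_L0 z q = h (apply_L0 x q) (apply_L0 y q)"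
  define fin where "fin x = {q \<in> topspace stone_space. \<bar>apply_L0 x q\<bar> \<noteq> \<infinity>}" for x :: "'a L0"
  define U where "U = fin x \<inter> fin y"
  have "dense_open (fin w)" for w
    using apply_L0[of w] by (simp add: C_infinity_iff fin_def)
  then have U: "dense_open U" unfolding U_def by (intro dense_open_Int)
  have real: "continuous_map (subtopology stone_space U) euclidean (\<lambda>q. real_of_ereal (apply_L0 w q))"
    if w: "U \<subseteq> fin w" for w
  proof -
    have "continuous_map stone_space euclidean (apply_L0 w)"
      using apply_L0[of w] by (simp add: C_infinity_iff)
    then have "continuous_map (subtopology stone_space U) (top_of_set (UNIV - {\<infinity>, - \<infinity>})) (apply_L0 w)"
      unfolding continuous_map_in_subtopology using w
      by (auto simp: fin_def intro: continuous_map_from_subtopology)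
    moreover have "continuous_map (top_of_set (UNIV - {\<infinity>, - \<infinity>})) euclidean real_of_ereal"
      by (simp add: continuous_on_real)
    ultimately have "continuous_map (subtopology stone_space U) euclidean (real_of_ereal \<circ> apply_L0 w)"
      by (rule continuous_map_compose)
    then show ?thesis by (simp only: o_def)
  qed
  have "continuous_map (subtopology stone_space U) (prod_topology euclidean euclidean)
      (\<lambda>q. (real_of_ereal (apply_L0 x q), real_of_ereal (apply_L0 y q)))"
    by (intro continuous_map_pairedI real) (auto simp: U_def)
  moreover have "continuous_map (prod_topology euclidean euclidean) euclidean (\<lambda>p. g (fst p) (snd p))"
    using g by (simp add: euclidean_product_topology)
  ultimately have "continuous_map (subtopology stone_space U) euclidean
      ((\<lambda>p. g (fst p) (snd p)) \<circ> (\<lambda>q. (real_of_ereal (apply_L0 x q), real_of_ereal (apply_L0 y q))))"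
    by (rule continuous_map_compose)
  then have "continuous_map (subtopology stone_space U) euclidean
      (\<lambda>q. g (real_of_ereal (apply_L0 x q)) (real_of_ereal (apply_L0 y q)))"
    by (simp only: o_def fst_conv snd_conv)
  from L0_extend_ex[OF U this] obtain z
    where z: "\<forall>q\<in>U. apply_L0 z q = ereal (g (real_of_ereal (apply_L0 x q)) (real_of_ereal (apply_L0 y q)))"
    by (rule exE)
  have P: "?P z q" if q: "q \<in> U" for q
  proof -
    have "\<bar>apply_L0 x q\<bar> \<noteq> \<infinity>" "\<bar>apply_L0 y q\<bar> \<noteq> \<infinity>" using q by (auto simp: U_def fin_def)
    moreover have "apply_L0 z q = ereal (g (real_of_ereal (apply_L0 x q)) (real_of_ereal (apply_L0 y q)))"
      using z q by (rule bspec)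
    ultimately show ?thesis
      using h[of "real_of_ereal (apply_L0 x q)" "real_of_ereal (apply_L0 y q)"] by (simp add: ereal_real')
  qed
  have ex: "\<exists>U. dense_open U \<and> (\<forall>q\<in>U. ?P z q)"
    by (rule exI[of _ U], rule conjI[OF U], rule ballI, erule P)
  have "L0_pointwise h x y = z"
    unfolding L0_pointwise_def
  proof (rule the_equality[where P = "\<lambda>z. \<exists>U. dense_open U \<and> (\<forall>q\<in>U. ?P z q)", OF ex])
    fix w assume "\<exists>U. dense_open U \<and> (\<forall>q\<in>U. ?P w q)"
    then have "eventually (?P w) generically" "eventually (?P z) generically"
      using ex by (simp_all only: eventually_generically)
    then have "eventually (\<lambda>q. apply_L0 w q = apply_L0 z q) generically"
      by eventually_elim simp
    then show "w = z" by (rule L0_eqI_generically)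
  qed
  moreover have "eventually (?P z) generically" using ex by (simp only: eventually_generically)
  ultimately show ?thesis by (auto elim: eventually_mono)
qed

instantiation L0 :: (complete_ba) "{zero, one, plus, minus, uminus, times, scaleR, abs, ord}"
begin

lift_definition zero_L0 :: "'a L0" is "\<lambda>q\<in>topspace stone_space. 0"
  using const_C_infinity[of 0] by (simp add: zero_ereal_def)

lift_definition one_L0 :: "'a L0" is "\<lambda>q\<in>topspace stone_space. 1"
  using const_C_infinity[of 1] by (simp add: one_ereal_def)

definition plus_L0 :: "'a L0 \<Rightarrow> 'a L0 \<Rightarrow> 'a L0" where "plus_L0 = L0_pointwise (+)"

definition minus_L0 :: "'a L0 \<Rightarrow> 'a L0 \<Rightarrow> 'a L0" where "minus_L0 = L0_pointwise (-)"

definition uminus_L0 :: "'a L0 \<Rightarrow> 'a L0" where "uminus_L0 x = L0_pointwise (\<lambda>a _. - a) x x"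

definition times_L0 :: "'a L0 \<Rightarrow> 'a L0 \<Rightarrow> 'a L0" where "times_L0 = L0_pointwise (*)"

definition scaleR_L0 :: "real \<Rightarrow> 'a L0 \<Rightarrow> 'a L0" where
  "scaleR_L0 r x = L0_pointwise (\<lambda>a _. ereal r * a) x x"

definition abs_L0 :: "'a L0 \<Rightarrow> 'a L0" where "abs_L0 x = L0_pointwise (\<lambda>a _. \<bar>a\<bar>) x x"

definition less_eq_L0 :: "'a L0 \<Rightarrow> 'a L0 \<Rightarrow> bool" where
  "x \<le> y \<longleftrightarrow> (\<forall>q\<in>topspace stone_space. apply_L0 x q \<le> apply_L0 y q)"

definition less_L0 :: "'a L0 \<Rightarrow> 'a L0 \<Rightarrow> bool" where
  "less_L0 x y \<longleftrightarrow> x \<le> y \<and> \<not> y \<le> x"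

instance ..

end

abbreviation val :: "'b::complete_ba L0 \<Rightarrow> 'b set \<Rightarrow> real" where
  "val x q \<equiv> real_of_ereal (apply_L0 x q)"

lemma val_zero: "eventually (\<lambda>q. val 0 q = 0) generically"
  using generically_ultrafilter
  by eventually_elim (simp add: zero_L0.rep_eq topspace_stone)

lemma val_one: "eventually (\<lambda>q. val 1 q = 1) generically"
  using generically_ultrafilter
  by eventually_elim (simp add: one_L0.rep_eq topspace_stone)

lemma val_pointwise:
  assumes h: "\<And>a b. h (ereal a) (ereal b) = ereal (g a b)"
    and g: "continuous_on UNIV (\<lambda>p. g (fst p) (snd p))"
  shows "eventually (\<lambda>q. val (L0_pointwise h x y) q = g (val x q) (val y q)) generically"
  using L0_pointwise[OF h g, of x y] generically_finite[of x] generically_finite[of y]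
proof eventually_elim
  case (elim q)
  obtain a b where "apply_L0 x q = ereal a" "apply_L0 y q = ereal b"
    using elim(2,3) by (metis ereal_real')
  then show ?case using elim(1) h by simp
qed

lemma val_plus: "eventually (\<lambda>q. val (x + y) q = val x q + val y q) generically"
  unfolding plus_L0_def by (rule val_pointwise) (auto intro!: continuous_intros)

lemma val_minus: "eventually (\<lambda>q. val (x - y) q = val x q - val y q) generically"
  unfolding minus_L0_def by (rule val_pointwise) (auto intro!: continuous_intros)

lemma val_uminus: "eventually (\<lambda>q. val (- x) q = - val x q) generically"
  unfolding uminus_L0_def by (rule val_pointwise[where g = "\<lambda>a _. - a"]) (auto intro!: continuous_intros)

lemma val_times: "eventually (\<lambda>q. val (x * y) q = val x q * val y q) generically"
  unfolding times_L0_def by (rule val_pointwise) (auto intro!: continuous_intros)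

lemma val_scaleR: "eventually (\<lambda>q. val (r *\<^sub>R x) q = r * val x q) generically"
  unfolding scaleR_L0_def by (rule val_pointwise[where g = "\<lambda>a _. r * a"]) (auto intro!: continuous_intros)

lemma val_abs: "eventually (\<lambda>q. val \<bar>x\<bar> q = \<bar>val x q\<bar>) generically"
  unfolding abs_L0_def by (rule val_pointwise[where g = "\<lambda>a _. \<bar>a\<bar>"]) (auto intro!: continuous_intros)

lemma L0_eqI_val:
  assumes "eventually (\<lambda>q. val x q = val y q) generically"
  shows "x = y"
proof (rule L0_eqI_generically)
  show "eventually (\<lambda>q. apply_L0 x q = apply_L0 y q) generically"
    using assms generically_finite[of x] generically_finite[of y]
    by eventually_elim (metis ereal_real')
qed

instance L0 :: (complete_ba) comm_ring
proof
  fix a b c :: "'a L0"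
  show "a + b + c = a + (b + c)"
    by (rule L0_eqI_val)
      (use val_plus[of a b] val_plus[of "a + b" c] val_plus[of b c] val_plus[of a "b + c"] in
        \<open>eventually_elim, simp\<close>)
  show "a + b = b + a"
    by (rule L0_eqI_val) (use val_plus[of a b] val_plus[of b a] in \<open>eventually_elim, simp\<close>)
  show "0 + a = a"
    by (rule L0_eqI_val) (use val_plus[of 0 a] val_zero in \<open>eventually_elim, simp\<close>)
  show "- a + a = 0"
    by (rule L0_eqI_val)
      (use val_plus[of "- a" a] val_uminus[of a] val_zero in \<open>eventually_elim, simp\<close>)
  show "a - b = a + - b"
    by (rule L0_eqI_val)
      (use val_plus[of a "- b"] val_uminus[of b] val_minus[of a b] in \<open>eventually_elim, simp\<close>)
  show "a * b * c = a * (b * c)"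
    by (rule L0_eqI_val)
      (use val_times[of a b] val_times[of "a * b" c] val_times[of b c] val_times[of a "b * c"] in
        \<open>eventually_elim, simp\<close>)
  show "a * b = b * a"
    by (rule L0_eqI_val) (use val_times[of a b] val_times[of b a] in \<open>eventually_elim, simp\<close>)
  show "(a + b) * c = a * c + b * c"
    by (rule L0_eqI_val)
      (use val_times[of a c] val_times[of b c] val_times[of "a + b" c] val_plus[of a b]
          val_plus[of "a * c" "b * c"] in \<open>eventually_elim, simp add: algebra_simps\<close>)
qed

text \<open>
  The multiplicative unit is \<open>1\<close>; \<^class>\<open>comm_ring_1\<close> would additionally require \<open>0 \<noteq> 1\<close>, which
  fails for the degenerate algebra with \<open>bot = top\<close>.
\<close>

lemma L0_one_mult: "1 * (a :: 'b::complete_ba L0) = a"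
  by (rule L0_eqI_val) (use val_times[of 1 a] val_one in \<open>eventually_elim, simp\<close>)

instance L0 :: (complete_ba) real_algebra
proof
  fix a b :: real and x y :: "'a L0"
  show "a *\<^sub>R (x + y) = a *\<^sub>R x + a *\<^sub>R y"
    by (rule L0_eqI_val)
      (use val_plus[of x y] val_scaleR[of a "x + y"] val_scaleR[of a x] val_scaleR[of a y]
          val_plus[of "a *\<^sub>R x" "a *\<^sub>R y"] in \<open>eventually_elim, simp add: algebra_simps\<close>)
  show "(a + b) *\<^sub>R x = a *\<^sub>R x + b *\<^sub>R x"
    by (rule L0_eqI_val)
      (use val_scaleR[of "a + b" x] val_scaleR[of a x] val_scaleR[of b x]
          val_plus[of "a *\<^sub>R x" "b *\<^sub>R x"] in \<open>eventually_elim, simp add: algebra_simps\<close>)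
  show "a *\<^sub>R b *\<^sub>R x = (a * b) *\<^sub>R x"
    by (rule L0_eqI_val)
      (use val_scaleR[of a "b *\<^sub>R x"] val_scaleR[of b x] val_scaleR[of "a * b" x] in
        \<open>eventually_elim, simp\<close>)
  show "1 *\<^sub>R x = x"
    by (rule L0_eqI_val) (use val_scaleR[of 1 x] in \<open>eventually_elim, simp\<close>)
  show "a *\<^sub>R x * y = a *\<^sub>R (x * y)"
    by (rule L0_eqI_val)
      (use val_scaleR[of a x] val_scaleR[of a "x * y"] val_times[of x y] val_times[of "a *\<^sub>R x" y] in
        \<open>eventually_elim, simp\<close>)
  show "x * a *\<^sub>R y = a *\<^sub>R (x * y)"
    by (rule L0_eqI_val)
      (use val_scaleR[of a y] val_scaleR[of a "x * y"] val_times[of x y] val_times[of x "a *\<^sub>R y"] in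
        \<open>eventually_elim, simp\<close>)
qed

instance L0 :: (complete_ba) order
proof
  fix x y z :: "'a L0"
  show "x < y \<longleftrightarrow> x \<le> y \<and> \<not> y \<le> x" by (simp add: less_L0_def)
  show "x \<le> x" by (simp add: less_eq_L0_def)
  show "x \<le> z" if "x \<le> y" "y \<le> z" using that unfolding less_eq_L0_def by (blast intro: order_trans)
  show "x = y" if "x \<le> y" "y \<le> x"
  proof (rule L0_eqI_generically)
    show "eventually (\<lambda>q. apply_L0 x q = apply_L0 y q) generically"
      using that dense_open_topspace unfolding less_eq_L0_def eventually_generically by (blast intro: antisym)
  qed
qed

section \<open>Idempotents, supports, and distributivity\<close>

text \<open>The element of \<^typ>\<open>'b L0\<close> with which \<open>b\<close> is identified: the characteristic function of the
  clopen set of \<open>b\<close>.\<close>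

lift_definition ind :: "'b::complete_ba \<Rightarrow> 'b L0"
  is "\<lambda>b. \<lambda>q\<in>topspace stone_space. if b \<in> q then 1 else 0"
proof -
  fix b :: 'b
  let ?f = "\<lambda>q. if b \<in> q then 1 else (0::ereal)"
  have "openin stone_space {q \<in> topspace stone_space. ?f q \<in> T}" for T
  proof -
    have "{q \<in> topspace stone_space. ?f q \<in> T} =
        (if 1 \<in> T then clopen b else {}) \<union> (if 0 \<in> T then clopen (- b) else {})"
      by (auto simp: topspace_stone clopen_compl) (auto simp: clopen_def)
    then show ?thesis using openin_clopen by auto
  qed
  then have "continuous_map stone_space euclidean ?f" by (auto simp: continuous_map_def)
  then have "continuous_map stone_space euclidean (restrict ?f (topspace stone_space))"
    by (rule continuous_map_eq) auto
  moreover have fin: "{q \<in> topspace stone_space. \<bar>restrict ?f (topspace stone_space) q\<bar> \<noteq> \<infinity>} = topspace stone_space"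
    by auto
  ultimately show "restrict ?f (topspace stone_space) \<in> C_infinity"
    unfolding C_infinity_iff fin by (simp add: dense_open_topspace)
qed

lemma val_ind: "eventually (\<lambda>q. ultrafilter q \<and> val (ind b) q = (if b \<in> q then 1 else 0)) generically"
  using generically_ultrafilter by eventually_elim (auto simp: ind.rep_eq topspace_stone)

lemma ind_inf: "ind (inf p q) = ind p * ind q"
  by (rule L0_eqI_val)
    (use val_ind[of p] val_ind[of q] val_ind[of "inf p q"] val_times[of "ind p" "ind q"] in
      \<open>eventually_elim, auto simp: ultrafilter_def\<close>)

lemma inj_ind: "inj (ind :: 'b::complete_ba \<Rightarrow> 'b L0)"
proof
  fix a b :: 'b assume eq: "ind a = ind b"
  have *: "x \<le> y" if "ind x = ind y" for x y :: 'b
  proof (rule ccontr)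
    assume "\<not> x \<le> y"
    then have "inf x (- y) \<noteq> bot" by (simp add: inf_shunt)
    then obtain u where u: "ultrafilter u" "inf x (- y) \<in> u" using ultrafilter_exists by blast
    then have "u \<in> clopen x \<inter> clopen (- y)" by (metis (mono_tags) clopen_def clopen_inf mem_Collect_eq)
    then have "x \<in> u" "y \<notin> u" using u(1) ultrafilter_compl by (auto simp: clopen_def)
    then have "apply_L0 (ind x) u \<noteq> apply_L0 (ind y) u" using u by (simp add: ind.rep_eq topspace_stone)
    then show False using that by simp
  qed
  show "a = b" using *[OF eq] *[OF eq[symmetric]] by simp
qed

lemma idempotent_iff_ind: "x * x = x \<longleftrightarrow> x \<in> range (ind :: 'b::complete_ba \<Rightarrow> 'b L0)"
proof
  assume "x * x = x"
  then have id: "eventually (\<lambda>q. val x q = 0 \<or> val x q = 1) generically"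
    using val_times[of x x] by (auto elim: eventually_mono)
  have c: "continuous_map stone_space euclidean (apply_L0 x)"
    using apply_L0[of x] by (simp add: C_infinity_iff)
  have op: "openin stone_space {q \<in> topspace stone_space. apply_L0 x q \<in> T}" if "open T" for T
    using openin_continuous_map_preimage[OF c, of T] that by simp
  define W where "W = {q \<in> topspace stone_space. apply_L0 x q \<in> {ereal (1/2)<..}}"
  define W' where "W' = {q \<in> topspace stone_space. apply_L0 x q \<in> {..<ereal (1/2)}}"
  have W: "openin stone_space W" and W': "openin stone_space W'" unfolding W_def W'_def by (rule op, simp)+
  define c where "c = Sup {b. clopen b \<subseteq> W}"
  have "x = ind c"
  proof (rule L0_eqI_val)
    show "eventually (\<lambda>q. val x q = val (ind c) q) generically"
      using id val_ind[of c] generically_finite[of x]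
    proof eventually_elim
      case (elim q)
      then have fin: "apply_L0 x q = ereal (val x q)" by (simp add: ereal_real')
      show ?case
      proof (cases "val x q = 0")
        case True
        then have "q \<in> W'" using elim fin by (simp add: W'_def topspace_stone)
        with W' obtain b where b: "b \<in> q" "clopen b \<subseteq> W'" by (rule stone_openE)
        then have "clopen b \<inter> W = {}" by (auto simp: W_def W'_def)
        then have "inf b c = bot" using clopen_Sup(2)[OF W] by (simp add: c_def)
        then have "c \<notin> q" using elim b by (metis ultrafilter_def)
        then show ?thesis using True elim by simp
      next
        case False
        then have "q \<in> W" using elim fin by (simp add: W_def topspace_stone)
        then have "c \<in> q" using clopen_Sup(1)[OF W] by (auto simp: c_def clopen_def)
        then show ?thesis using False elim by simp
      qed
    qed
  qed
  then show "x \<in> range ind" by blast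
next
  assume "x \<in> range (ind :: 'b \<Rightarrow> 'b L0)"
  then show "x * x = x" using ind_inf by (metis imageE inf.idem)
qed

definition supp :: "'b::complete_ba L0 \<Rightarrow> 'b" where
  "supp x = top - Sup {e. ind e * x = 0}"

definition Supp :: "'b::complete_ba L0 set \<Rightarrow> 'b" where
  "Supp E = (SUP x\<in>E. supp x)"

text \<open>
  Used for \<open>A = {..e}\<close>: suprema and infima of non-empty families in \<open>{..e}\<close> are the same
  in \<open>{..e}\<close> as in the ambient algebra.
\<close>

definition sigma_distributive :: "'b::complete_ba set \<Rightarrow> bool" where
  "sigma_distributive A \<longleftrightarrow> (\<forall>a :: nat \<Rightarrow> nat \<Rightarrow> 'b. (\<forall>n m. a n m \<in> A) \<longrightarrow>
     (SUP n. INF m. a n m) = (INF \<phi> :: nat \<Rightarrow> nat. SUP n. a n (\<phi> n)))"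

section \<open>Ideals, solid spaces, and derivations\<close>

definition CQ :: "'b::complete_ba L0 set" where
  "CQ = {x. \<forall>q\<in>topspace stone_space. \<bar>apply_L0 x q\<bar> \<noteq> \<infinity>}"

definition ideal_CQ :: "'b::complete_ba L0 set \<Rightarrow> bool" where
  "ideal_CQ X \<longleftrightarrow> X \<subseteq> CQ \<and> subspace X \<and> (\<forall>x\<in>X. \<forall>y\<in>X. x * y \<in> X) \<and> (\<forall>x\<in>CQ. \<forall>a\<in>X. x * a \<in> X)"

definition solid_space :: "'b::complete_ba L0 set \<Rightarrow> bool" where
  "solid_space Y \<longleftrightarrow> subspace Y \<and> Y \<noteq> {0} \<and> (\<forall>x\<in>Y. \<forall>y. \<bar>y\<bar> \<le> \<bar>x\<bar> \<longrightarrow> y \<in> Y)"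

text \<open>Only the values of \<open>\<delta>\<close> on \<open>X\<close> matter.\<close>

definition derivation :: "'b::complete_ba L0 set \<Rightarrow> 'b L0 set \<Rightarrow> ('b L0 \<Rightarrow> 'b L0) \<Rightarrow> bool" where
  "derivation X Y \<delta> \<longleftrightarrow> \<delta> \<in> X \<rightarrow> Y \<and>
     (\<forall>x\<in>X. \<forall>y\<in>X. \<delta> (x + y) = \<delta> x + \<delta> y) \<and> (\<forall>r. \<forall>x\<in>X. \<delta> (r *\<^sub>R x) = r *\<^sub>R \<delta> x) \<and>
     (\<forall>x\<in>X. \<forall>y\<in>X. \<delta> (x * y) = \<delta> x * y + x * \<delta> y)"

definition band_preserving :: "'b::complete_ba L0 set \<Rightarrow> ('b L0 \<Rightarrow> 'b L0) \<Rightarrow> bool" where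
  "band_preserving X \<delta> \<longleftrightarrow> (\<forall>x\<in>X. supp (\<delta> x) \<le> supp x)"

end

theory Submission
  imports Defs
begin

text \<open>
  A band preserving derivation \<open>\<delta>\<close> commutes with multiplication by idempotents and hence kills every
  idempotent. On a piece where \<open>x\<close> is constant it therefore kills \<open>x\<close>, while \<open>\<sigma>\<close>-distributivity of the
  algebra below \<open>e\<close> makes every element constant on some piece of \<open>e\<close>. So \<open>\<delta> x \<noteq> 0\<close> excludes
  \<open>\<sigma>\<close>-distributivity below any nonzero \<open>e\<close> in the support of \<open>\<delta> x\<close> (\<open>derivation_not_sigma_distributive\<close>).
  Vanishing on constants also makes \<open>\<delta>\<close> as steep as one likes: where \<open>x\<close> differs from a constant \<open>r\<close>
  by at most \<open>1 / N\<close>, the element \<open>N (x - r)\<close> is bounded by \<open>1\<close> and is mapped to \<open>N \<delta> x\<close>. Gluing such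
  elements with \<open>N\<close> growing from piece to piece yields a bounded element of \<open>X\<close> whose image dominates
  an arbitrary \<open>y\<close> on \<open>e\<close>; solidity of \<open>Y\<close> then puts \<open>e y\<close> into \<open>Y\<close> (\<open>derivation_range_extended\<close>).

  Conversely, let the algebra below \<open>e\<close> fail to be \<open>\<sigma>\<close>-distributive. A double sequence that violates the law
  is coded, as a point of the Cantor set, by one function \<open>x\<close>, and \<open>x\<close> is constant on no piece of some
  \<open>f \<le> e\<close> (\<open>not_sigma_distributive_nowhere_constant\<close>). Such an \<open>x\<close> satisfies no polynomial equation with
  locally constant coefficients on any piece of \<open>f\<close>, because a nonzero real polynomial has only finitely
  many roots. So the zero derivation on the locally constant elements extends to \<open>x\<close> with value \<open>1\<close> on
  \<open>f\<close>, and from there to all of \<open>L\<^sup>0\<close> by Zorn's lemma (\<open>derivation_of_nowhere_constant\<close>).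

  The extension follows the classical pattern for fields of characteristic zero: a transcendental
  element gets an arbitrary value, the value at an algebraic one is forced by its minimal polynomial.
  As \<open>L\<^sup>0\<close> is only a ring, this dichotomy is applied locally, on a piece on which a polynomial relation
  of least degree has an invertible leading coefficient, and the local values are glued. A derivation is
  represented by its graph, which is a subalgebra of the dual numbers \<open>L\<^sup>0[\<epsilon>]\<close>; then the Leibniz rule is
  closure under multiplication, and extending a derivation is adjoining an element to a subalgebra.
\<close>

section \<open>Local behaviour of the elements of \<open>L\<^sup>0\<close>\<close>

text \<open>
  The default rewrite rule moves the absolute value of \<open>val x q\<close> under the coercion, out of reach of
  linear arithmetic.
\<close>

declare abs_real_of_ereal [simp del]

text \<open>
  Complements already give this much of the distributive law in every complete Boolean algebra.
\<close>

lemma inf_Sup_eq_bot_iff: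
  fixes c :: "'b::complete_ba"
  shows "inf c (Sup S) = bot \<longleftrightarrow> (\<forall>s\<in>S. inf c s = bot)"
proof -
  have "inf c (Sup S) = bot \<longleftrightarrow> Sup S \<le> - c" by (metis inf.commute inf_shunt)
  also have "\<dots> \<longleftrightarrow> (\<forall>s\<in>S. s \<le> - c)" by (rule Sup_le_iff)
  also have "\<dots> \<longleftrightarrow> (\<forall>s\<in>S. inf c s = bot)" by (metis inf.commute inf_shunt)
  finally show ?thesis .
qed

lemma mem_clopen_inf: "q \<in> clopen p \<Longrightarrow> b \<in> q \<Longrightarrow> q \<in> clopen (inf p b)"
  by (simp add: clopen_inf) (simp add: clopen_def)

lemma clopen_nonbot: "q \<in> clopen p \<Longrightarrow> p \<noteq> bot"
  using clopen_bot by auto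

lemma generic_point:
  assumes "eventually P generically" "p \<noteq> bot"
  obtains q where "q \<in> clopen p" "P q"
proof -
  obtain U where "dense_open U" "\<forall>q\<in>U. P q" using assms(1) eventually_generically by blast
  then show thesis using assms(2) that unfolding dense_open_iff by blast
qed

text \<open>
  Being generic is a local property: the union of the open sets on which \<open>P\<close> holds is dense as soon
  as it meets every nonempty clopen set.
\<close>

lemma eventually_generically_locally:
  assumes "\<And>p. p \<noteq> bot \<Longrightarrow> \<exists>p'\<le>p. p' \<noteq> bot \<and> eventually (\<lambda>q. p' \<in> q \<longrightarrow> P q) generically"
  shows "eventually P generically"
proof -
  define U where "U = \<Union>{W. openin stone_space W \<and> (\<forall>q\<in>W. P q)}"
  have op: "openin stone_space U" unfolding U_def by (intro openin_Union) auto
  have "U \<inter> clopen p \<noteq> {}" if p: "p \<noteq> bot" for p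
  proof -
    obtain p' where p': "p' \<le> p" "p' \<noteq> bot" "eventually (\<lambda>q. p' \<in> q \<longrightarrow> P q) generically"
      using assms[OF p] by blast
    then obtain V where V: "dense_open V" "\<forall>q\<in>V. p' \<in> q \<longrightarrow> P q"
      using eventually_generically by blast
    have "V \<inter> clopen p' \<subseteq> U"
      unfolding U_def using V openin_clopen
      by (intro Union_upper) (auto simp: dense_open_iff clopen_def)
    moreover have "V \<inter> clopen p' \<noteq> {}" using V p' dense_open_iff by blast
    ultimately show ?thesis using clopen_mono[OF p'(1)] by blast
  qed
  then have "dense_open U" using op by (simp add: dense_open_iff)
  then show ?thesis unfolding eventually_generically by (intro exI[of _ U]) (auto simp: U_def)
qed

lemma continuous_apply_L0: "continuous_map stone_space euclidean (apply_L0 x)"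
  using apply_L0[of x] by (simp add: C_infinity_iff)

lemma openin_apply_L0:
  "open T \<Longrightarrow> openin stone_space {q \<in> topspace stone_space. apply_L0 x q \<in> T}"
  using openin_continuous_map_preimage[OF continuous_apply_L0, of T] by simp

lemma L0_near:
  fixes x :: "'b::complete_ba L0"
  assumes "q \<in> clopen p" "\<bar>apply_L0 x q\<bar> \<noteq> \<infinity>" "\<epsilon> > 0"
  obtains p' where "p' \<le> p" "q \<in> clopen p'"
    "\<And>q'. q' \<in> clopen p' \<Longrightarrow> \<bar>apply_L0 x q'\<bar> \<noteq> \<infinity> \<and> \<bar>val x q' - val x q\<bar> < \<epsilon>"
proof -
  define T where "T = {ereal (val x q - \<epsilon>)<..<ereal (val x q + \<epsilon>)}"
  let ?W = "{q \<in> topspace stone_space. apply_L0 x q \<in> T}"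
  have fin: "apply_L0 x q = ereal (val x q)" using assms(2) by (simp add: ereal_real')
  have "apply_L0 x q \<in> T" unfolding T_def using assms(3) by (subst fin) simp
  then have "q \<in> ?W" using assms(1) by (simp add: topspace_stone clopen_def)
  moreover have "openin stone_space ?W" by (rule openin_apply_L0) (simp add: T_def)
  ultimately obtain b where b: "b \<in> q" "clopen b \<subseteq> ?W" using openin_stone by blast
  show thesis
  proof
    show "inf p b \<le> p" by simp
    show "q \<in> clopen (inf p b)" using assms(1) b(1) by (rule mem_clopen_inf)
    fix q' assume "q' \<in> clopen (inf p b)"
    then have *: "apply_L0 x q' \<in> T" using b(2) by (auto simp: clopen_inf)
    then obtain v where v: "apply_L0 x q' = ereal v" by (cases "apply_L0 x q'") (auto simp: T_def)
    with * show "\<bar>apply_L0 x q'\<bar> \<noteq> \<infinity> \<and> \<bar>val x q' - val x q\<bar> < \<epsilon>" by (auto simp: T_def abs_less_iff)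
  qed
qed

lemma L0_locally_bounded:
  fixes x :: "'b::complete_ba L0"
  assumes "p \<noteq> bot"
  obtains p' M where "p' \<le> p" "p' \<noteq> bot" "\<And>q. q \<in> clopen p' \<Longrightarrow> \<bar>apply_L0 x q\<bar> \<noteq> \<infinity> \<and> \<bar>val x q\<bar> \<le> M"
proof -
  obtain q where q: "q \<in> clopen p" "\<bar>apply_L0 x q\<bar> \<noteq> \<infinity>"
    using generic_point[OF generically_finite assms] .
  then obtain p' where "p' \<le> p" "q \<in> clopen p'"
    "\<And>q'. q' \<in> clopen p' \<Longrightarrow> \<bar>apply_L0 x q'\<bar> \<noteq> \<infinity> \<and> \<bar>val x q' - val x q\<bar> < 1"
    by (rule L0_near[where \<epsilon> = 1]) auto
  then show thesis by (intro that[of p' "\<bar>val x q\<bar> + 1"]) (auto dest: clopen_nonbot, fastforce)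
qed

lemma ind_mult_eq_iff:
  "ind p * x = ind p * y \<longleftrightarrow> eventually (\<lambda>q. p \<in> q \<longrightarrow> val x q = val y q) generically"
proof
  assume "ind p * x = ind p * y"
  then show "eventually (\<lambda>q. p \<in> q \<longrightarrow> val x q = val y q) generically"
    using val_times[of "ind p" x] val_times[of "ind p" y] val_ind[of p]
    by (auto elim!: eventually_rev_mp intro: always_eventually)
next
  assume *: "eventually (\<lambda>q. p \<in> q \<longrightarrow> val x q = val y q) generically"
  show "ind p * x = ind p * y"
    by (rule L0_eqI_val)
      (use * val_times[of "ind p" x] val_times[of "ind p" y] val_ind[of p] in \<open>eventually_elim, auto\<close>)
qed

lemma ind_mult_eq_0_iff: "ind p * x = 0 \<longleftrightarrow> eventually (\<lambda>q. p \<in> q \<longrightarrow> val x q = 0) generically"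
proof -
  have "ind p * x = 0 \<longleftrightarrow> ind p * x = ind p * 0" by simp
  also have "\<dots> \<longleftrightarrow> eventually (\<lambda>q. p \<in> q \<longrightarrow> val x q = 0) generically"
    unfolding ind_mult_eq_iff
    by (rule eventually_subst) (use val_zero in \<open>eventually_elim, simp\<close>)
  finally show ?thesis .
qed

lemma ind_top: "ind top = (1 :: 'b::complete_ba L0)"
  by (rule L0_eqI_val) (use val_ind[of top] val_one in \<open>eventually_elim, auto simp: ultrafilter_def\<close>)

lemma ind_bot: "ind bot = (0 :: 'b::complete_ba L0)"
  by (rule L0_eqI_val) (use val_ind[of bot] val_zero in \<open>eventually_elim, auto simp: ultrafilter_def\<close>)

lemma ind_eq_0_iff: "ind p = (0 :: 'b::complete_ba L0) \<longleftrightarrow> p = bot"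
  using inj_ind ind_bot by (metis injD)

lemma ind_mult_absorb: "p \<le> q \<Longrightarrow> ind p * (ind q * x) = ind p * (x :: 'b::complete_ba L0)"
  by (metis ind_inf inf.absorb1 mult.assoc)

lemma ind_mult_ind: "p \<le> q \<Longrightarrow> ind p * ind q = (ind p :: 'b::complete_ba L0)"
  by (metis ind_inf inf.absorb1)

lemma ind_mult_eq_mono:
  "p' \<le> p \<Longrightarrow> ind p * x = ind p * y \<Longrightarrow> ind p' * x = ind p' * (y :: 'b::complete_ba L0)"
  by (metis ind_mult_absorb)

lemma ind_mult_eq_0_mono: "p' \<le> p \<Longrightarrow> ind p * x = 0 \<Longrightarrow> ind p' * x = (0 :: 'b::complete_ba L0)"
  by (metis ind_mult_absorb mult_zero_right)

lemma ind_compl_add: "ind (- p) * x + ind p * x = (x :: 'b::complete_ba L0)"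
  by (rule L0_eqI_val)
    (use val_ind[of p] val_ind[of "- p"] val_times[of "ind p" x] val_times[of "ind (- p)" x]
        val_plus[of "ind (- p) * x" "ind p * x"] in \<open>eventually_elim, auto simp: ultrafilter_compl\<close>)

lemma L0_eqI_locally:
  fixes x y :: "'b::complete_ba L0"
  assumes "\<And>p. p \<noteq> bot \<Longrightarrow> \<exists>p'\<le>p. p' \<noteq> bot \<and> ind p' * x = ind p' * y"
  shows "x = y"
  using assms unfolding ind_mult_eq_iff by (intro L0_eqI_val eventually_generically_locally)

text \<open>
  Nonvanishing is witnessed robustly: continuity at one finite nonzero value keeps \<open>x\<close> away from zero
  on a whole clopen neighbourhood. This is the usual source of pieces on which \<open>x\<close> is invertible.
\<close>

lemma L0_bounded_below_on:
  fixes x :: "'b::complete_ba L0"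
  assumes "ind p * x \<noteq> 0"
  obtains p' c where "p' \<le> p" "p' \<noteq> bot" "c > 0"
    "\<And>q. q \<in> clopen p' \<Longrightarrow> \<bar>apply_L0 x q\<bar> \<noteq> \<infinity> \<and> c \<le> \<bar>val x q\<bar>"
proof -
  have "\<not> eventually (\<lambda>q. p \<in> q \<longrightarrow> val x q = 0) generically" using assms ind_mult_eq_0_iff by blast
  then have "frequently (\<lambda>q. p \<in> q \<and> val x q \<noteq> 0) generically" by (simp add: frequently_def)
  then have "frequently (\<lambda>q. q \<in> clopen p \<and> \<bar>apply_L0 x q\<bar> \<noteq> \<infinity> \<and> val x q \<noteq> 0) generically"
    by (rule frequently_rev_mp)
      (use generically_finite[of x] generically_ultrafilter in \<open>eventually_elim, simp add: clopen_def\<close>)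
  then obtain q where q: "q \<in> clopen p" "\<bar>apply_L0 x q\<bar> \<noteq> \<infinity>" "val x q \<noteq> 0"
    by (elim frequentlyE conjE)
  have pos: "\<bar>val x q\<bar> / 2 > 0" using q(3) by simp
  obtain p' where p': "p' \<le> p" "q \<in> clopen p'"
    "\<And>q'. q' \<in> clopen p' \<Longrightarrow> \<bar>apply_L0 x q'\<bar> \<noteq> \<infinity> \<and> \<bar>val x q' - val x q\<bar> < \<bar>val x q\<bar> / 2"
    using L0_near[OF q(1,2) pos] by metis
  have "\<bar>val x q\<bar> / 2 \<le> \<bar>val x q'\<bar>" if "q' \<in> clopen p'" for q'
    using p'(3)[OF that] by linarith
  then show thesis using p' pos by (intro that[of p' "\<bar>val x q\<bar> / 2"]) (auto dest: clopen_nonbot)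
qed

lemma le_supp_iff: "e \<le> supp x \<longleftrightarrow> (\<forall>p\<le>e. p \<noteq> bot \<longrightarrow> ind p * x \<noteq> 0)"
proof -
  have "e \<le> supp x \<longleftrightarrow> inf e (Sup {e. ind e * x = 0}) = bot"
    by (simp add: supp_def diff_eq inf_shunt)
  also have "\<dots> \<longleftrightarrow> (\<forall>s. ind s * x = 0 \<longrightarrow> inf e s = bot)" by (simp add: inf_Sup_eq_bot_iff)
  also have "\<dots> \<longleftrightarrow> (\<forall>p\<le>e. p \<noteq> bot \<longrightarrow> ind p * x \<noteq> 0)"
    by (metis inf.absorb2 inf.cobounded1 inf.cobounded2 ind_mult_eq_0_mono)
  finally show ?thesis .
qed

lemma le_supp_mono: "(\<And>e. ind e * x = 0 \<Longrightarrow> ind e * y = 0) \<Longrightarrow> supp y \<le> supp x"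
  unfolding supp_def diff_eq by (auto intro!: Sup_subset_mono)

lemma le_supp_if_bounded_below:
  assumes "\<And>q. q \<in> clopen e \<Longrightarrow> c \<le> \<bar>val x q\<bar>" "c > 0"
  shows "e \<le> supp x"
  unfolding le_supp_iff
proof (intro allI impI notI)
  fix p assume p: "p \<le> e" "p \<noteq> bot" "ind p * x = 0"
  obtain q where "q \<in> clopen p" "p \<in> q \<longrightarrow> val x q = 0"
    using generic_point[OF p(3)[unfolded ind_mult_eq_0_iff] p(2)] .
  then show False using assms clopen_mono[OF p(1)] by (force simp: clopen_def)
qed

text \<open>
  An element is cancellable on its support; this replaces the absence of zero divisors in a field.
\<close>

lemma supp_cancel:
  assumes "p \<le> supp a" "ind p * (a * h) = 0"
  shows "ind p * h = 0"
proof (rule ccontr)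
  assume "ind p * h \<noteq> 0"
  then obtain p' c where p': "p' \<le> p" "p' \<noteq> bot" "c > 0" "\<And>q. q \<in> clopen p' \<Longrightarrow> c \<le> \<bar>val h q\<bar>"
    using L0_bounded_below_on by metis
  have "eventually (\<lambda>q. p' \<in> q \<longrightarrow> val (a * h) q = 0) generically"
    using assms(2) ind_mult_eq_0_mono[OF p'(1)] ind_mult_eq_0_iff by blast
  then have "eventually (\<lambda>q. p' \<in> q \<longrightarrow> val a q = 0) generically"
    using val_times[of a h] generically_ultrafilter
    by eventually_elim (use p'(3,4) in \<open>force simp: clopen_def\<close>)
  then show False using assms(1) p' unfolding le_supp_iff ind_mult_eq_0_iff[symmetric] by (meson order_trans)
qed

text \<open>
  The set where \<open>y q < r < x q\<close> is open, so a single bad point would produce generic bad points.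
\<close>

lemma L0_leI:
  assumes "eventually (\<lambda>q. val x q \<le> val y q) generically"
  shows "x \<le> y"
  unfolding less_eq_L0_def
proof (intro ballI leI notI)
  fix q assume q: "q \<in> topspace stone_space" and "apply_L0 y q < apply_L0 x q"
  then obtain r where r: "apply_L0 y q < r" "r < apply_L0 x q" using dense by blast
  let ?W = "{q \<in> topspace stone_space. apply_L0 x q \<in> {r<..}} \<inter>
    {q \<in> topspace stone_space. apply_L0 y q \<in> {..<r}}"
  have "openin stone_space ?W" by (intro openin_Int openin_apply_L0) auto
  moreover have "q \<in> ?W" using q r by simp
  ultimately obtain b where b: "b \<noteq> bot" "clopen b \<subseteq> ?W" by (rule stone_openE)
  have ev: "eventually (\<lambda>q. apply_L0 x q \<le> apply_L0 y q) generically"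
    using assms generically_finite[of x] generically_finite[of y]
    by eventually_elim (metis ereal_less_eq(3) ereal_real')
  obtain q' where "q' \<in> clopen b" "apply_L0 x q' \<le> apply_L0 y q'"
    by (rule generic_point[OF ev b(1)])
  moreover from this have "apply_L0 y q' < r" "r < apply_L0 x q'" using b(2) by auto
  ultimately show False by simp
qed

text \<open>
  An infinite value forces values beyond any bound on a nonempty open set.
\<close>

lemma CQ_if_bounded:
  assumes "eventually (\<lambda>q. \<bar>val x q\<bar> \<le> C) generically"
  shows "x \<in> CQ"
  unfolding CQ_def
proof (intro CollectI ballI notI)
  fix q assume q: "q \<in> topspace stone_space" and inf: "\<bar>apply_L0 x q\<bar> = \<infinity>"
  let ?W = "{q \<in> topspace stone_space. apply_L0 x q \<in> {ereal C<..} \<union> {..<ereal (- C)}}"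
  have "openin stone_space ?W" by (intro openin_apply_L0) auto
  moreover have "q \<in> ?W" using q inf by auto
  ultimately obtain b where b: "b \<noteq> bot" "clopen b \<subseteq> ?W" by (rule stone_openE)
  have ev: "eventually (\<lambda>q. apply_L0 x q \<notin> {ereal C<..} \<union> {..<ereal (- C)}) generically"
    using assms generically_finite[of x]
  proof eventually_elim
    case (elim q)
    then show ?case by (cases "apply_L0 x q") (auto simp: abs_le_iff)
  qed
  obtain q' where "q' \<in> clopen b" "apply_L0 x q' \<notin> {ereal C<..} \<union> {..<ereal (- C)}"
    by (rule generic_point[OF ev b(1)])
  then show False using b(2) by auto
qed

section \<open>Gluing\<close>

lemma continuous_stone_realI:
  fixes f :: "'b::boolean_algebra set \<Rightarrow> real"
  assumes "U \<subseteq> topspace stone_space"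
    and "\<And>q \<epsilon>. q \<in> U \<Longrightarrow> \<epsilon> > 0 \<Longrightarrow> \<exists>b\<in>q. \<forall>q'\<in>clopen b. \<bar>f q' - f q\<bar> < \<epsilon>"
  shows "continuous_map (subtopology stone_space U) euclidean f"
  unfolding continuous_map_def
proof (intro conjI allI impI)
  show "f \<in> topspace (subtopology stone_space U) \<rightarrow> topspace euclidean" by simp
  fix T :: "real set" assume "openin euclidean T"
  then have T: "open T" by simp
  define V where "V = \<Union>{clopen b | b. f ` clopen b \<subseteq> T}"
  have "openin stone_space V" unfolding V_def using openin_clopen by (intro openin_Union) auto
  moreover have "{q \<in> topspace (subtopology stone_space U). f q \<in> T} = V \<inter> U"
  proof (intro equalityI subsetI)
    fix q assume q: "q \<in> {q \<in> topspace (subtopology stone_space U). f q \<in> T}"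
    then obtain \<epsilon> where \<epsilon>: "\<epsilon> > 0" "\<And>r. \<bar>r - f q\<bar> < \<epsilon> \<Longrightarrow> r \<in> T"
      using T by (auto simp: open_dist dist_real_def)
    have "q \<in> U" using q by simp
    then obtain b where b: "b \<in> q" "\<forall>q'\<in>clopen b. \<bar>f q' - f q\<bar> < \<epsilon>" using assms(2) \<epsilon>(1) by blast
    then have "f ` clopen b \<subseteq> T" using \<epsilon> by blast
    moreover have "q \<in> clopen b" using q b(1) by (simp add: topspace_stone clopen_def)
    ultimately show "q \<in> V \<inter> U" using \<open>q \<in> U\<close> unfolding V_def by blast
  qed (use assms(1) in \<open>auto simp: V_def\<close>)
  ultimately show "openin (subtopology stone_space U) {q \<in> topspace (subtopology stone_space U). f q \<in> T}"
    by (auto simp: openin_subtopology)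
qed

text \<open>
  The points around which \<open>f\<close> is continuous on a clopen neighbourhood form an open set, which is dense by
  hypothesis; from there \<open>f\<close> extends to the whole Stone space.
\<close>

lemma L0_of_locally_continuous:
  fixes f :: "'b::complete_ba set \<Rightarrow> real"
  assumes "\<And>p. p \<noteq> bot \<Longrightarrow> \<exists>p'\<le>p. p' \<noteq> bot \<and>
    (\<forall>q\<in>clopen p'. \<forall>\<epsilon>>0. \<exists>b\<in>q. \<forall>q'\<in>clopen b. \<bar>f q' - f q\<bar> < \<epsilon>)"
  obtains w where "eventually (\<lambda>q. val w q = f q) generically"
proof -
  let ?C = "\<lambda>q. \<forall>\<epsilon>>0. \<exists>b\<in>q. \<forall>q'\<in>clopen b. \<bar>f q' - f q\<bar> < \<epsilon>"
  define U where "U = \<Union>{clopen b | b. \<forall>q\<in>clopen b. ?C q}"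
  have op: "openin stone_space U" unfolding U_def using openin_clopen by (intro openin_Union) auto
  have "U \<inter> clopen p \<noteq> {}" if p: "p \<noteq> bot" for p
  proof -
    obtain p' where p': "p' \<le> p" "p' \<noteq> bot" "\<forall>q\<in>clopen p'. ?C q" using assms[OF p] by blast
    then have "clopen p' \<subseteq> U" unfolding U_def by blast
    then show ?thesis using p' clopen_eq_empty[of p'] clopen_mono[of p' p] by blast
  qed
  then have U: "dense_open U" using op by (simp add: dense_open_iff)
  have "continuous_map (subtopology stone_space U) euclidean f"
  proof (rule continuous_stone_realI)
    show "U \<subseteq> topspace stone_space" using op by (rule openin_subset)
    show "\<exists>b\<in>q. \<forall>q'\<in>clopen b. \<bar>f q' - f q\<bar> < \<epsilon>" if "q \<in> U" "\<epsilon> > 0" for q \<epsilon>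
      using that unfolding U_def by blast
  qed
  from L0_extend_ex[OF U this] obtain z where "\<forall>q\<in>U. apply_L0 z q = ereal (f q)" by blast
  then have "eventually (\<lambda>q. val z q = f q) generically"
    unfolding eventually_generically by (intro exI[of _ U] conjI U) simp
  then show thesis by (rule that)
qed

lemma CQ_of_continuous:
  fixes f :: "'b::complete_ba set \<Rightarrow> real"
  assumes "\<And>q \<epsilon>. ultrafilter q \<Longrightarrow> \<epsilon> > 0 \<Longrightarrow> \<exists>b\<in>q. \<forall>q'\<in>clopen b. \<bar>f q' - f q\<bar> < \<epsilon>"
  obtains z where "z \<in> CQ" "\<And>q. ultrafilter q \<Longrightarrow> apply_L0 z q = ereal (f q)"
proof -
  have "continuous_map (subtopology stone_space (topspace stone_space)) euclidean f"
    by (rule continuous_stone_realI) (auto simp: topspace_stone intro: assms)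
  from L0_extend_ex[OF dense_open_topspace this] obtain z
    where "\<forall>q\<in>topspace stone_space. apply_L0 z q = ereal (f q)" by blast
  then show thesis by (intro that[of z]) (auto simp: CQ_def topspace_stone)
qed

lemma inverse_near:
  fixes x :: "'b::complete_ba L0"
  assumes "q \<in> clopen p" "\<And>q. q \<in> clopen p \<Longrightarrow> \<bar>apply_L0 x q\<bar> \<noteq> \<infinity> \<and> c \<le> \<bar>val x q\<bar>" "c > 0" "\<epsilon> > 0"
  shows "\<exists>b\<in>q. b \<le> p \<and> (\<forall>q'\<in>clopen b. \<bar>inverse (val x q') - inverse (val x q)\<bar> < \<epsilon>)"
proof -
  have "\<epsilon> * (c * c) > 0" using assms by simp
  then obtain b where b: "b \<le> p" "q \<in> clopen b"
    "\<And>q'. q' \<in> clopen b \<Longrightarrow> \<bar>val x q' - val x q\<bar> < \<epsilon> * (c * c)"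
    using L0_near[of q p x "\<epsilon> * (c * c)"] assms by metis
  have "\<bar>inverse (val x q') - inverse (val x q)\<bar> < \<epsilon>" if q': "q' \<in> clopen b" for q'
  proof -
    have c: "c \<le> \<bar>val x q\<bar>" "c \<le> \<bar>val x q'\<bar>" using assms q' clopen_mono[OF b(1)] by blast+
    then have nz: "val x q \<noteq> 0" "val x q' \<noteq> 0" using assms(3) by auto
    have "\<bar>inverse (val x q') - inverse (val x q)\<bar> = \<bar>val x q' - val x q\<bar> / (\<bar>val x q'\<bar> * \<bar>val x q\<bar>)"
      using nz by (simp add: inverse_diff_inverse abs_mult divide_simps abs_minus_commute)
    also have "\<dots> \<le> \<bar>val x q' - val x q\<bar> / (c * c)"
      using c assms(3) by (intro divide_left_mono mult_mono) auto
    also have "\<dots> < \<epsilon>" using b(3)[OF q'] assms(3) by (simp add: divide_simps)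
    finally show ?thesis .
  qed
  then show ?thesis using b by (auto simp: clopen_def)
qed

text \<open>
  The pointwise inverse is continuous both where \<open>x\<close> is bounded away from zero and where it vanishes,
  and such pieces are dense.
\<close>

lemma L0_inverse_exists:
  fixes x :: "'b::complete_ba L0"
  obtains y where "eventually (\<lambda>q. val y q = inverse (val x q)) generically"
proof (rule L0_of_locally_continuous)
  let ?C = "\<lambda>p'. \<forall>q\<in>clopen p'. \<forall>\<epsilon>>0. \<exists>b\<in>q. \<forall>q'\<in>clopen b. \<bar>inverse (val x q') - inverse (val x q)\<bar> < \<epsilon>"
  fix p :: 'b assume p: "p \<noteq> bot"
  show "\<exists>p'\<le>p. p' \<noteq> bot \<and> ?C p'"
  proof (cases "ind p * x = 0")
    case True
    have zero: "val x q = 0" if q: "q \<in> clopen p" "\<bar>apply_L0 x q\<bar> \<noteq> \<infinity>" for q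
    proof (rule ccontr)
      assume "val x q \<noteq> 0"
      then have "\<bar>val x q\<bar> > 0" by simp
      then obtain p' where p': "p' \<le> p" "q \<in> clopen p'"
          "\<And>q'. q' \<in> clopen p' \<Longrightarrow> \<bar>val x q' - val x q\<bar> < \<bar>val x q\<bar>"
        using L0_near[OF q] by metis
      obtain q' where "q' \<in> clopen p'" "p \<in> q' \<longrightarrow> val x q' = 0"
        using generic_point[OF True[unfolded ind_mult_eq_0_iff] clopen_nonbot[OF p'(2)]] .
      then show False using p'(3)[of q'] clopen_mono[OF p'(1)] by (auto simp: clopen_def)
    qed
    have "val x q = 0" if "q \<in> clopen p" for q
      using zero[OF that] by (cases "\<bar>apply_L0 x q\<bar> = \<infinity>") auto
    then have "?C p" by (force simp: clopen_def)
    then show ?thesis using p by blast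
  next
    case False
    then obtain p' c where p': "p' \<le> p" "p' \<noteq> bot" "c > 0"
        "\<And>q. q \<in> clopen p' \<Longrightarrow> \<bar>apply_L0 x q\<bar> \<noteq> \<infinity> \<and> c \<le> \<bar>val x q\<bar>"
      using L0_bounded_below_on by metis
    have "?C p'" using inverse_near[of _ p' x c] p'(3,4) by meson
    then show ?thesis using p' by blast
  qed
qed

lemma L0_inverse_on_supp:
  fixes x :: "'b::complete_ba L0"
  assumes "p \<le> supp x"
  obtains y where "ind p * (y * x) = ind p"
proof -
  obtain y where y: "eventually (\<lambda>q. val y q = inverse (val x q)) generically"
    by (rule L0_inverse_exists)
  have inv: "a * (inverse a * a - 1) = 0" for a :: real by (cases "a = 0") auto
  have "x * (y * x - 1) = 0"
    by (rule L0_eqI_val)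
      (use y val_times[of y x] val_one val_minus[of "y * x" 1] val_times[of x "y * x - 1"] val_zero
        in \<open>eventually_elim, simp only: inv\<close>)
  then have "ind p * (y * x - 1) = 0" using supp_cancel[OF assms] by simp
  moreover have "ind p * 1 = ind p" by (metis L0_one_mult mult.commute)
  ultimately have "ind p * (y * x) = ind p" by (simp add: right_diff_distrib)
  then show thesis by (rule that)
qed

text \<open>
  The mixing principle: local solutions of a problem that is inherited by smaller pieces can be
  combined into one element. By Zorn's lemma there is a maximal antichain of pieces with a solution;
  by maximality it meets every nonzero piece, and by disjointness the chosen solutions do not
  conflict. The result is a global element that agrees with some local solution on a dense set of
  pieces.
\<close>

lemma L0_mixing:
  fixes R :: "'b::complete_ba \<Rightarrow> 'b L0 \<Rightarrow> bool"
  assumes down: "\<And>p p' v. R p v \<Longrightarrow> p' \<le> p \<Longrightarrow> R p' v"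
    and dense: "\<And>p. p \<noteq> bot \<Longrightarrow> \<exists>p'\<le>p. p' \<noteq> bot \<and> (\<exists>v. R p' v)"
  shows "\<exists>w. \<forall>p. p \<noteq> bot \<longrightarrow> (\<exists>p'\<le>p. p' \<noteq> bot \<and> (\<exists>v. R p' v \<and> ind p' * w = ind p' * v))"
proof -
  define D where "D = {p. p \<noteq> bot \<and> (\<exists>v. R p v)}"
  let ?A = "{P. P \<subseteq> D \<and> (\<forall>a\<in>P. \<forall>b\<in>P. a \<noteq> b \<longrightarrow> inf a b = bot)}"
  have "\<exists>M\<in>?A. \<forall>X\<in>?A. M \<subseteq> X \<longrightarrow> X = M"
  proof (rule subset_Zorn')
    fix C assume C: "subset.chain ?A C"
    have CA: "X \<subseteq> D" "a \<in> X \<Longrightarrow> b \<in> X \<Longrightarrow> a \<noteq> b \<Longrightarrow> inf a b = bot" if "X \<in> C" for X a b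
      using C that unfolding subset_chain_def by blast+
    have ch: "X \<subseteq> Y \<or> Y \<subseteq> X" if "X \<in> C" "Y \<in> C" for X Y
      using C that unfolding subset_chain_def by blast
    have "inf a b = bot" if ab: "a \<in> \<Union>C" "b \<in> \<Union>C" "a \<noteq> b" for a b
    proof -
      obtain X Y where XY: "X \<in> C" "a \<in> X" "Y \<in> C" "b \<in> Y" using ab by blast
      then consider "X \<subseteq> Y" | "Y \<subseteq> X" using ch by meson
      then show ?thesis using CA(2)[of Y a b] CA(2)[of X a b] XY ab(3) by cases auto
    qed
    then show "\<Union>C \<in> ?A" using CA(1) by blast
  qed
  then obtain P where P0: "P \<in> ?A" and max: "\<forall>X\<in>?A. P \<subseteq> X \<longrightarrow> X = P" by (rule bexE)
  have P: "P \<subseteq> D" "\<And>a b. a \<in> P \<Longrightarrow> b \<in> P \<Longrightarrow> a \<noteq> b \<Longrightarrow> inf a b = bot" using P0 by simp_all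
  have meets: "\<exists>a\<in>P. inf p a \<noteq> bot" if p: "p \<noteq> bot" for p
  proof (rule ccontr)
    assume none: "\<not> (\<exists>a\<in>P. inf p a \<noteq> bot)"
    obtain d v where dv: "d \<le> p" "d \<noteq> bot" "R d v" using dense[OF p] by (elim exE conjE)
    then have d: "d \<le> p" "d \<in> D" unfolding D_def by blast+
    have disj: "inf d a = bot" if "a \<in> P" for a
    proof -
      have "inf d a \<le> inf p a" using d(1) by (rule inf_mono) simp
      then show ?thesis using none that by (metis le_bot)
    qed
    then have ins: "insert d P \<in> ?A" using P0 d(2) by (simp add: inf.commute)
    have "insert d P = P" using bspec[OF max ins] subset_insertI by (rule mp)
    then have "d \<in> P" by blast
    then show False using disj[of d] dv(2) by simp
  qed
  define v where "v a = (SOME v. R a v)" for a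
  have v: "R a (v a)" if "a \<in> P" for a
  proof -
    have "\<exists>v. R a v" using subsetD[OF P(1) that] by (simp add: D_def)
    then show ?thesis unfolding v_def by (rule someI_ex)
  qed
  \<comment> \<open>An ultrafilter contains at most one member of the antichain.\<close>
  define f where "f q = val (v (THE a. a \<in> P \<and> a \<in> q)) q" for q
  have f: "f q = val (v a) q" if "a \<in> P" "q \<in> clopen a" for a q
  proof -
    have "(THE a. a \<in> P \<and> a \<in> q) = a"
    proof (rule the_equality)
      show "a \<in> P \<and> a \<in> q" using that by (simp add: clopen_def)
      fix b assume b: "b \<in> P \<and> b \<in> q"
      then have "q \<in> clopen (inf a b)" using that(2) mem_clopen_inf by blast
      then have "inf a b \<noteq> bot" by (rule clopen_nonbot)
      then show "b = a" using P(2)[OF that(1), of b] b by metis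
    qed
    then show ?thesis by (simp add: f_def)
  qed
  have "\<exists>p'\<le>p. p' \<noteq> bot \<and> (\<forall>q\<in>clopen p'. \<forall>\<epsilon>>0. \<exists>b\<in>q. \<forall>q'\<in>clopen b. \<bar>f q' - f q\<bar> < \<epsilon>)"
    if p: "p \<noteq> bot" for p
  proof -
    obtain a where a: "a \<in> P" "inf p a \<noteq> bot" using meets[OF p] by blast
    obtain p' M where p': "p' \<le> inf p a" "p' \<noteq> bot" "\<And>q. q \<in> clopen p' \<Longrightarrow> \<bar>apply_L0 (v a) q\<bar> \<noteq> \<infinity> \<and> \<bar>val (v a) q\<bar> \<le> M"
      using L0_locally_bounded[OF a(2)] by metis
    have "\<exists>b\<in>q. \<forall>q'\<in>clopen b. \<bar>f q' - f q\<bar> < \<epsilon>" if q: "q \<in> clopen p'" and \<epsilon>: "\<epsilon> > 0" for q \<epsilon>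
    proof -
      obtain b where b: "b \<le> p'" "q \<in> clopen b" "\<And>q'. q' \<in> clopen b \<Longrightarrow> \<bar>val (v a) q' - val (v a) q\<bar> < \<epsilon>"
        using L0_near[OF q _ \<epsilon>, of "v a"] p'(3)[OF q] by metis
      have "f q' = val (v a) q'" if "q' \<in> clopen b" for q'
        using f[OF a(1)] that clopen_mono[of b a] b(1) p'(1) by (meson inf.boundedE order_trans subsetD)
      moreover have "b \<in> q" using b(2) by (simp add: clopen_def)
      ultimately show ?thesis using b(2,3) by (intro bexI[of _ b] ballI) simp_all
    qed
    then show ?thesis using p' by (meson inf.boundedE)
  qed
  then obtain w where w: "eventually (\<lambda>q. val w q = f q) generically"
    by (rule L0_of_locally_continuous)
  have "\<exists>p'\<le>p. p' \<noteq> bot \<and> (\<exists>v. R p' v \<and> ind p' * w = ind p' * v)" if p: "p \<noteq> bot" for p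
  proof -
    obtain a where a: "a \<in> P" "inf p a \<noteq> bot" using meets[OF p] by blast
    have "eventually (\<lambda>q. a \<in> q \<longrightarrow> val w q = val (v a) q) generically"
      using w generically_ultrafilter by eventually_elim (use f[OF a(1)] in \<open>auto simp: clopen_def\<close>)
    then have "ind a * w = ind a * v a" by (simp only: ind_mult_eq_iff)
    then have "ind (inf p a) * w = ind (inf p a) * v a" by (rule ind_mult_eq_mono[rotated]) simp
    moreover have "R (inf p a) (v a)" by (rule down[OF v[OF a(1)]]) simp
    ultimately show ?thesis using a(2) by (intro exI[of _ "inf p a"] conjI exI[of _ "v a"]) simp_all
  qed
  then show ?thesis by blast
qed

section \<open>Derivations as subalgebras of the dual numbers\<close>

text \<open>
  The dual numbers \<open>a + b \<epsilon>\<close> with \<open>\<epsilon>\<^sup>2 = 0\<close>. A map \<open>D\<close> on a subring is a derivation if and only if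
  \<open>a \<mapsto> a + D a \<epsilon>\<close> is a ring homomorphism, that is, if its graph is closed under the dual number
  operations.
\<close>

datatype 'a dual = Dual (std: 'a) (eps: 'a)

instantiation dual :: (comm_ring) comm_ring
begin

definition "0 = Dual 0 0"
definition "x + y = Dual (std x + std y) (eps x + eps y)"
definition "- x = Dual (- std x) (- eps x)"
definition "x - y = Dual (std x - std y) (eps x - eps y)"
definition "x * y = Dual (std x * std y) (std x * eps y + eps x * std y)"

instance
  by standard
    (simp_all add: zero_dual_def plus_dual_def uminus_dual_def minus_dual_def times_dual_def algebra_simps)

end

lemma dual_simps [simp]:
  "std 0 = 0" "eps 0 = 0" "std (x + y) = std x + std y" "eps (x + y) = eps x + eps y"
  "std (- x) = - std x" "eps (- x) = - eps x" "std (x - y) = std x - std y" "eps (x - y) = eps x - eps y"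
  "std (x * y) = std x * std y" "eps (x * y) = std x * eps y + eps x * std y"
  for x y :: "'a::comm_ring dual"
  by (simp_all add: zero_dual_def plus_dual_def uminus_dual_def minus_dual_def times_dual_def)

definition poly_over :: "'a::zero set \<Rightarrow> 'a poly set" where
  "poly_over S = {F. \<forall>i. coeff F i \<in> S}"

text \<open>
  The standard part is a ring homomorphism, so the \<open>\<epsilon>\<close>-part of the argument does not affect it.
\<close>

lemma std_poly_eq: "std (poly F (Dual z w)) = std (poly F (Dual z 0))" for z w :: "'a::comm_ring"
  by (induction F) auto

text \<open>
  Taylor's formula \<open>F(z + w \<epsilon>) = F(z) + w F'(z) \<epsilon>\<close>. The formal derivative is produced only together
  with its two relevant properties: it has coefficients in \<open>S\<close>, and its leading coefficient is a nonzero
  multiple of that of \<open>F\<close>. Writing \<open>F = c + t H\<close>, it is \<open>H + t H'\<close>.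
\<close>

lemma taylor_dual:
  fixes S :: "'a::{comm_ring,real_algebra} dual set"
  assumes S: "0 \<in> S" "\<And>x y. x \<in> S \<Longrightarrow> y \<in> S \<Longrightarrow> x + y \<in> S"
    and F: "F \<in> poly_over S" "\<And>i. i > Suc n \<Longrightarrow> coeff F i = 0"
  shows "\<exists>F'\<in>poly_over S. (\<forall>i>n. coeff F' i = 0) \<and>
    std (coeff F' n) = real (Suc n) *\<^sub>R std (coeff F (Suc n)) \<and>
    (\<forall>z w. eps (poly F (Dual z w)) = eps (poly F (Dual z 0)) + w * std (poly F' (Dual z 0)))"
  using F
proof (induction n arbitrary: F)
  case 0
  obtain c H where F: "F = pCons c H" by (cases F)
  have H: "coeff H i = 0" if "i > 0" for i using 0(2)[of "Suc i"] that by (simp add: F)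
  then have H0: "H = [:coeff H 0:]" by (intro poly_eqI) (simp add: coeff_pCons split: nat.split)
  have "coeff H i \<in> S" for i using 0(1)[unfolded poly_over_def] unfolding F by (metis coeff_pCons_Suc mem_Collect_eq)
  moreover have "eps (poly F (Dual z w)) = eps (poly F (Dual z 0)) + w * std (poly H (Dual z 0))" for z w
    unfolding F by (subst (1 2 3) H0) (simp add: algebra_simps)
  ultimately show ?case using H by (intro bexI[of _ H]) (simp_all add: F poly_over_def)
next
  case (Suc n)
  obtain c H where F: "F = pCons c H" by (cases F)
  have cH: "coeff H i \<in> S" for i using Suc(2)[unfolded poly_over_def] unfolding F by (metis coeff_pCons_Suc mem_Collect_eq)
  have vH: "coeff H i = 0" if "i > Suc n" for i using Suc(3)[of "Suc i"] that by (simp add: F)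
  obtain H' where H': "H' \<in> poly_over S" "\<forall>i>n. coeff H' i = 0"
      "std (coeff H' n) = real (Suc n) *\<^sub>R std (coeff H (Suc n))"
      "\<And>z w. eps (poly H (Dual z w)) = eps (poly H (Dual z 0)) + w * std (poly H' (Dual z 0))"
    using Suc.IH[of H] cH vH unfolding poly_over_def by blast
  show ?case
  proof (intro bexI[of _ "H + pCons 0 H'"] conjI allI impI)
    show "H + pCons 0 H' \<in> poly_over S"
      using cH H'(1) S by (auto simp: poly_over_def coeff_pCons split: nat.split)
    show "coeff (H + pCons 0 H') i = 0" if "i > Suc n" for i
      using that vH H'(2) by (cases i) auto
    show "std (coeff (H + pCons 0 H') (Suc n)) = real (Suc (Suc n)) *\<^sub>R std (coeff F (Suc (Suc n)))"
      unfolding F using H'(3) by (simp add: scaleR_left_distrib scaleR_2)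
    show "eps (poly F (Dual z w)) = eps (poly F (Dual z 0)) + w * std (poly (H + pCons 0 H') (Dual z 0))" for z w
      unfolding F using H'(4)[of z w] by (simp add: algebra_simps std_poly_eq[of H z w])
  qed
qed

text \<open>
  The graph of an \<open>\<real>\<close>-linear derivation on a subalgebra that contains the idempotents and on them
  vanishes; the last condition is single-valuedness. Closure under multiplication by \<open>r \<cdot> 1\<close> makes
  linearity a consequence of closure under products.
\<close>

definition derivation_graph :: "'b::complete_ba L0 dual set \<Rightarrow> bool" where
  "derivation_graph \<Gamma> \<longleftrightarrow> (\<forall>p r. Dual (r *\<^sub>R ind p) 0 \<in> \<Gamma>) \<and>
     (\<forall>x\<in>\<Gamma>. \<forall>y\<in>\<Gamma>. x + y \<in> \<Gamma> \<and> x * y \<in> \<Gamma>) \<and> (\<forall>b. Dual 0 b \<in> \<Gamma> \<longrightarrow> b = 0)"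

definition ind_dual :: "'b::complete_ba \<Rightarrow> 'b L0 dual" where
  "ind_dual p = Dual (ind p) 0"

lemma ind_dual_simps [simp]: "std (ind_dual p) = ind p" "eps (ind_dual p) = 0"
  by (simp_all add: ind_dual_def)

lemma ind_dual_absorb: "p \<le> q \<Longrightarrow> ind_dual p * (ind_dual q * x) = ind_dual p * x"
  by (rule dual.expand) (simp add: ind_mult_absorb)

lemma ind_dual_compl_add: "ind_dual (- p) * x + ind_dual p * x = x"
  by (rule dual.expand) (simp add: ind_compl_add)

lemma derivation_graphD:
  assumes "derivation_graph \<Gamma>"
  shows "x \<in> \<Gamma> \<Longrightarrow> y \<in> \<Gamma> \<Longrightarrow> x + y \<in> \<Gamma>" "x \<in> \<Gamma> \<Longrightarrow> y \<in> \<Gamma> \<Longrightarrow> x * y \<in> \<Gamma>"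
    "Dual (r *\<^sub>R ind p) 0 \<in> \<Gamma>" "x \<in> \<Gamma> \<Longrightarrow> - x \<in> \<Gamma>" "0 \<in> \<Gamma>" "ind_dual p \<in> \<Gamma>"
    "x \<in> \<Gamma> \<Longrightarrow> std x = 0 \<Longrightarrow> x = 0"
proof -
  have *: "\<And>x y. x \<in> \<Gamma> \<Longrightarrow> y \<in> \<Gamma> \<Longrightarrow> x + y \<in> \<Gamma>" "\<And>x y. x \<in> \<Gamma> \<Longrightarrow> y \<in> \<Gamma> \<Longrightarrow> x * y \<in> \<Gamma>"
    "\<And>r p. Dual (r *\<^sub>R ind p) 0 \<in> \<Gamma>"
    using assms by (auto simp: derivation_graph_def)
  show "x \<in> \<Gamma> \<Longrightarrow> y \<in> \<Gamma> \<Longrightarrow> x + y \<in> \<Gamma>" by (rule *(1))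
  show "x \<in> \<Gamma> \<Longrightarrow> y \<in> \<Gamma> \<Longrightarrow> x * y \<in> \<Gamma>" by (rule *(2))
  show "Dual (r *\<^sub>R ind p) 0 \<in> \<Gamma>" by (rule *(3))
  have "- x = Dual ((-1) *\<^sub>R ind top) 0 * x"
    by (rule dual.expand) (simp add: ind_top L0_one_mult)
  then show "x \<in> \<Gamma> \<Longrightarrow> - x \<in> \<Gamma>" using *(2) *(3) by metis
  show "0 \<in> \<Gamma>" using *(3)[of 0 bot] by (simp add: zero_dual_def)
  show "ind_dual p \<in> \<Gamma>" using *(3)[of 1 p] by (simp add: ind_dual_def)
  show "x \<in> \<Gamma> \<Longrightarrow> std x = 0 \<Longrightarrow> x = 0"
    using assms by (cases x) (auto simp: derivation_graph_def zero_dual_def)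
qed

section \<open>Adjoining one element to the domain of a derivation\<close>

text \<open>
  On \<open>p\<close> the new graph consists of the values at \<open>u\<close> of polynomials over \<open>\<Gamma>\<close>, off \<open>p\<close> it is the old one.
  The hypothesis on \<open>u\<close> is exactly single-valuedness of the result on \<open>p\<close>.
\<close>

lemma derivation_graph_adjoin:
  assumes \<Gamma>: "derivation_graph \<Gamma>"
    and u: "\<And>F. F \<in> poly_over \<Gamma> \<Longrightarrow> ind p * std (poly F u) = 0 \<Longrightarrow> ind_dual p * poly F u = 0"
  shows "\<exists>\<Gamma>'. derivation_graph \<Gamma>' \<and> \<Gamma> \<subseteq> \<Gamma>' \<and> ind_dual p * u \<in> \<Gamma>'"
proof -
  note \<Gamma>D = derivation_graphD[OF \<Gamma>]
  define \<Gamma>' where "\<Gamma>' = {x. ind_dual (- p) * x \<in> \<Gamma> \<and> (\<exists>F\<in>poly_over \<Gamma>. ind_dual p * x = ind_dual p * poly F u)}"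
  have sub: "\<Gamma> \<subseteq> \<Gamma>'"
  proof
    fix x assume x: "x \<in> \<Gamma>"
    then have "[:x:] \<in> poly_over \<Gamma>" using \<Gamma>D(5) by (auto simp: poly_over_def coeff_pCons split: nat.split)
    then show "x \<in> \<Gamma>'" unfolding \<Gamma>'_def using x \<Gamma>D(2,6) by (intro CollectI conjI bexI[of _ "[:x:]"]) auto
  qed
  have "ind_dual p * u \<in> \<Gamma>'"
  proof -
    have "[:0, ind_dual top:] \<in> poly_over \<Gamma>"
      using \<Gamma>D(5,6) by (auto simp: poly_over_def coeff_pCons split: nat.split)
    moreover have "ind_dual p * (ind_dual p * u) = ind_dual p * poly [:0, ind_dual top:] u"
      by (rule dual.expand) (simp add: ind_mult_absorb ind_top L0_one_mult mult.commute[of _ 1])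
    moreover have "ind_dual (- p) * (ind_dual p * u) = 0"
      by (rule dual.expand) (simp add: mult.assoc[symmetric] ind_inf[symmetric] ind_bot)
    ultimately show ?thesis
      unfolding \<Gamma>'_def using \<Gamma>D(5) by (intro CollectI conjI bexI[of _ "[:0, ind_dual top:]"]) simp_all
  qed
  moreover have "derivation_graph \<Gamma>'"
    unfolding derivation_graph_def
  proof (intro conjI allI ballI impI)
    show "Dual (r *\<^sub>R ind p) 0 \<in> \<Gamma>'" for r p using sub \<Gamma>D(3) by blast
    fix x y assume "x \<in> \<Gamma>'" "y \<in> \<Gamma>'"
    then obtain F G where x: "ind_dual (- p) * x \<in> \<Gamma>" "F \<in> poly_over \<Gamma>" "ind_dual p * x = ind_dual p * poly F u"
      and y: "ind_dual (- p) * y \<in> \<Gamma>" "G \<in> poly_over \<Gamma>" "ind_dual p * y = ind_dual p * poly G u"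
      by (auto simp: \<Gamma>'_def)
    have "ind_dual (- p) * (x + y) \<in> \<Gamma>" using x y \<Gamma>D(1) by (simp add: distrib_left)
    moreover have "F + G \<in> poly_over \<Gamma>" using x y \<Gamma>D(1) by (simp add: poly_over_def)
    moreover have "ind_dual p * (x + y) = ind_dual p * poly (F + G) u" using x y by (simp add: distrib_left)
    ultimately show "x + y \<in> \<Gamma>'" unfolding \<Gamma>'_def by blast
    have mult: "ind_dual p * (a * b) = (ind_dual p * a) * (ind_dual p * b)" for p and a b :: "'a L0 dual"
      by (metis ind_dual_absorb mult.assoc mult.left_commute order_refl)
    have "ind_dual (- p) * (x * y) \<in> \<Gamma>" unfolding mult using x y \<Gamma>D(2) by blast
    moreover have "F * G \<in> poly_over \<Gamma>"
    proof -
      have "sum h A \<in> \<Gamma>" if "\<And>i. i \<in> A \<Longrightarrow> h i \<in> \<Gamma>" "finite A" for h and A :: "nat set"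
        using that(2,1) by (induction A) (auto intro: \<Gamma>D)
      then show ?thesis using x y \<Gamma>D(2) by (simp add: poly_over_def coeff_mult)
    qed
    moreover have "ind_dual p * (x * y) = ind_dual p * poly (F * G) u" using x y mult by simp
    ultimately show "x * y \<in> \<Gamma>'" unfolding \<Gamma>'_def by blast
  next
    fix b assume "Dual 0 b \<in> \<Gamma>'"
    then obtain F where F: "ind_dual (- p) * Dual 0 b \<in> \<Gamma>" "F \<in> poly_over \<Gamma>"
      "ind_dual p * Dual 0 b = ind_dual p * poly F u" by (auto simp: \<Gamma>'_def)
    have "ind p * std (poly F u) = 0" using arg_cong[OF F(3), of std] by simp
    then have "ind_dual p * Dual 0 b = 0" using u F by simp
    moreover have "ind_dual (- p) * Dual 0 b = 0" by (rule \<Gamma>D(7)[OF F(1)]) simp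
    ultimately have "Dual 0 b = 0" using ind_dual_compl_add[of p "Dual 0 b"] by simp
    then show "b = 0" by (simp add: zero_dual_def)
  qed
  ultimately show ?thesis using sub by blast
qed

text \<open>
  The leading coefficient is required to be nonzero on every part of \<open>p\<close>, so that it can be cancelled
  there. The coefficients carry their derivatives along as \<open>\<epsilon>\<close>-parts, but the relation concerns the
  standard parts only.
\<close>

definition algebraic_on :: "'b::complete_ba L0 dual set \<Rightarrow> 'b L0 \<Rightarrow> nat \<Rightarrow> 'b \<Rightarrow> bool" where
  "algebraic_on \<Gamma> z n p \<longleftrightarrow> p \<noteq> bot \<and> (\<exists>F\<in>poly_over \<Gamma>. (\<forall>i>n. coeff F i = 0) \<and>
     p \<le> supp (std (coeff F n)) \<and> ind p * std (poly F (Dual z 0)) = 0)"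

lemma mult_poly_monom_eq_0: "a * c = 0 \<Longrightarrow> a * poly (monom c n) u = 0" for a u :: "'a::comm_ring"
  by (induction n) (simp_all add: monom_0 monom_Suc mult.left_commute[of a u])

text \<open>
  Below the minimal degree of a relation a polynomial vanishing at \<open>z\<close> must have coefficients with
  vanishing standard part on \<open>p\<close>: otherwise its top coefficient would be invertible on a smaller
  piece and give a relation of lower degree. Single-valuedness of \<open>\<Gamma>\<close> then kills the \<open>\<epsilon>\<close>-parts as well.
  If there is no relation at all, this settles the transcendental case, for every value \<open>w\<close>.
\<close>

lemma poly_vanishing_below_minimal_degree:
  assumes \<Gamma>: "derivation_graph \<Gamma>"
    and min: "\<And>m p'. m < n \<Longrightarrow> p' \<le> p \<Longrightarrow> \<not> algebraic_on \<Gamma> z m p'"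
    and F: "F \<in> poly_over \<Gamma>" "\<And>i. i \<ge> n \<Longrightarrow> coeff F i = 0" "ind p * std (poly F (Dual z w)) = 0"
  shows "ind_dual p * poly F (Dual z w) = 0"
proof -
  note \<Gamma>D = derivation_graphD[OF \<Gamma>]
  have "ind_dual p * poly F (Dual z w) = 0"
    if "k \<le> n" "F \<in> poly_over \<Gamma>" "\<And>i. i \<ge> k \<Longrightarrow> coeff F i = 0" "ind p * std (poly F (Dual z w)) = 0" for k F
    using that
  proof (induction k arbitrary: F)
    case 0
    then have "F = 0" by (intro poly_eqI) simp
    then show ?case by simp
  next
    case (Suc k)
    let ?c = "coeff F k"
    have "ind p * std ?c = 0"
    proof (rule ccontr)
      assume "ind p * std ?c \<noteq> 0"
      then obtain p' c where p': "p' \<le> p" "p' \<noteq> bot" "c > 0" "\<And>q. q \<in> clopen p' \<Longrightarrow> c \<le> \<bar>val (std ?c) q\<bar>"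
        using L0_bounded_below_on by metis
      have "p' \<le> supp (std ?c)" using p'(3,4) le_supp_if_bounded_below by blast
      moreover have "ind p' * std (poly F (Dual z 0)) = 0"
        using Suc.prems(4) p'(1) ind_mult_eq_0_mono by (metis std_poly_eq)
      ultimately have "algebraic_on \<Gamma> z k p'"
        unfolding algebraic_on_def using p' Suc.prems by (auto intro!: bexI[of _ F])
      then show False using min Suc.prems(1) p'(1) by auto
    qed
    then have c: "ind_dual p * ?c = 0"
      using Suc.prems(2) \<Gamma>D(2,6,7) by (simp add: poly_over_def)
    define G where "G = F - monom ?c k"
    have cG: "coeff G i = (if i = k then 0 else coeff F i)" for i by (simp add: G_def)
    have eq: "ind_dual p * poly G (Dual z w) = ind_dual p * poly F (Dual z w)"
      using mult_poly_monom_eq_0[OF c] by (simp add: G_def right_diff_distrib)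
    have "ind_dual p * poly G (Dual z w) = 0"
    proof (rule Suc.IH)
      show "G \<in> poly_over \<Gamma>" using Suc.prems(2) \<Gamma>D(5) by (simp add: poly_over_def cG)
      show "ind p * std (poly G (Dual z w)) = 0" using arg_cong[OF eq, of std] Suc.prems(4) by simp
    qed (use Suc.prems in \<open>auto simp: cG\<close>)
    then show ?case using eq by simp
  qed
  from this[of n F] F show ?thesis by simp
qed

text \<open>
  The algebraic case: once the \<open>\<epsilon>\<close>-part of the minimal relation vanishes too, so does that of every other
  relation. This is division with remainder, done by cross multiplication with the leading coefficients
  since these are cancellable on \<open>p\<close> but need not be units of the subalgebra.
\<close>

lemma poly_vanishing_minimal_relation:
  assumes \<Gamma>: "derivation_graph \<Gamma>"
    and min: "\<And>m p'. m < n \<Longrightarrow> p' \<le> p \<Longrightarrow> \<not> algebraic_on \<Gamma> z m p'"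
    and F: "F \<in> poly_over \<Gamma>" "\<And>i. i > n \<Longrightarrow> coeff F i = 0" "p \<le> supp (std (coeff F n))"
      "ind_dual p * poly F (Dual z w) = 0"
    and G: "G \<in> poly_over \<Gamma>" "ind p * std (poly G (Dual z w)) = 0"
  shows "ind_dual p * poly G (Dual z w) = 0"
proof -
  note \<Gamma>D = derivation_graphD[OF \<Gamma>]
  let ?u = "Dual z w"
  have "ind_dual p * poly G ?u = 0"
    if "G \<in> poly_over \<Gamma>" "\<And>i. i \<ge> k \<Longrightarrow> coeff G i = 0" "ind p * std (poly G ?u) = 0" for k G
    using that
  proof (induction k arbitrary: G)
    case 0
    then have "G = 0" by (intro poly_eqI) simp
    then show ?case by simp
  next
    case (Suc k)
    show ?case
    proof (cases "k < n")
      case True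
      then show ?thesis
        using Suc.prems by (intro poly_vanishing_below_minimal_degree[OF \<Gamma> min]) auto
    next
      case False
      let ?a = "coeff F n" and ?b = "coeff G k"
      \<comment> \<open>The terms of degree \<open>k\<close> cancel.\<close>
      define H where "H = smult ?a G - monom ?b (k - n) * F"
      have cH: "coeff H i = ?a * coeff G i - (if i < k - n then 0 else ?b * coeff F (i - (k - n)))" for i
        by (simp add: H_def coeff_monom_mult)
      have eq: "ind_dual p * poly H ?u = ?a * (ind_dual p * poly G ?u)"
        using F(4) by (simp add: H_def right_diff_distrib mult.left_commute[of "ind_dual p"])
      have "ind_dual p * poly H ?u = 0"
      proof (rule Suc.IH)
        have "x - y \<in> \<Gamma>" if "x \<in> \<Gamma>" "y \<in> \<Gamma>" for x y using \<Gamma>D(1)[OF that(1) \<Gamma>D(4)[OF that(2)]] by simp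
        then show "H \<in> poly_over \<Gamma>" using F(1) Suc.prems(1) \<Gamma>D(2,5) by (simp add: poly_over_def cH)
        show "coeff H i = 0" if "i \<ge> k" for i
        proof (cases "i = k")
          case True
          moreover have "\<not> k < k - n" by simp
          ultimately show ?thesis using False by (simp add: cH mult.commute)
        next
          case False
          then have "i > k" using that by simp
          then show ?thesis using F(2)[of "i - (k - n)"] Suc.prems(2)[of i] \<open>\<not> k < n\<close> by (simp add: cH)
        qed
        show "ind p * std (poly H ?u) = 0"
          using arg_cong[OF eq, of std] Suc.prems(3) by (simp add: mult.left_commute[of "ind p" "std ?a"])
      qed
      then have "?a * (ind_dual p * poly G ?u) = 0" using eq by simp
      from arg_cong[OF this, of eps] have "std ?a * (ind p * eps (poly G ?u)) = 0"
        using Suc.prems(3) by simp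
      then have "ind p * eps (poly G ?u) = 0" using supp_cancel[OF F(3)] by (simp add: mult.left_commute)
      then show ?thesis using Suc.prems(3) by (intro dual.expand) simp
    qed
  qed
  from this[of G "Suc (degree G)"] G show ?thesis by (simp add: coeff_eq_0)
qed

text \<open>
  Without any relation for \<open>z\<close> on pieces of \<open>p\<close>, the value \<open>0\<close> will do. Otherwise choose a piece and a relation
  \<open>F\<close> of least degree. Then \<open>F'(z)\<close> cannot vanish on any part of the piece, as \<open>F'\<close> would be a relation of
  lower degree, so that \<open>F(z) + w F'(z) \<epsilon> = 0\<close> can be solved for \<open>w\<close>.
\<close>

lemma derivation_extends_locally:
  assumes \<Gamma>: "derivation_graph \<Gamma>" and p: "p \<noteq> bot"
  shows "\<exists>p'\<le>p. p' \<noteq> bot \<and>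
    (\<exists>w \<Gamma>'. derivation_graph \<Gamma>' \<and> \<Gamma> \<subseteq> \<Gamma>' \<and> Dual (ind p' * z) w \<in> \<Gamma>')"
proof (cases "\<exists>n. \<exists>p'\<le>p. algebraic_on \<Gamma> z n p'")
  case False
  have "\<exists>\<Gamma>'. derivation_graph \<Gamma>' \<and> \<Gamma> \<subseteq> \<Gamma>' \<and> ind_dual p * Dual z 0 \<in> \<Gamma>'"
  proof (rule derivation_graph_adjoin[OF \<Gamma>])
    fix F assume "F \<in> poly_over \<Gamma>" "ind p * std (poly F (Dual z 0)) = 0"
    then show "ind_dual p * poly F (Dual z 0) = 0"
      using False by (intro poly_vanishing_below_minimal_degree[OF \<Gamma>, where n = "Suc (degree F)"])
        (auto simp: coeff_eq_0)
  qed
  moreover have "ind_dual p * Dual z 0 = Dual (ind p * z) 0" by (rule dual.expand) simp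
  ultimately show ?thesis using p by (metis order_refl)
next
  case True
  define n where "n = (LEAST n. \<exists>p'\<le>p. algebraic_on \<Gamma> z n p')"
  obtain p' where p': "p' \<le> p" "algebraic_on \<Gamma> z n p'"
    using LeastI_ex[OF True] unfolding n_def by blast
  have min: "\<not> algebraic_on \<Gamma> z m p''" if "m < n" "p'' \<le> p'" for m p''
    using not_less_Least[of m] that p'(1) unfolding n_def by (metis order_trans)
  obtain F where F: "p' \<noteq> bot" "F \<in> poly_over \<Gamma>" "\<And>i. i > n \<Longrightarrow> coeff F i = 0"
      "p' \<le> supp (std (coeff F n))" "ind p' * std (poly F (Dual z 0)) = 0"
    using p'(2) unfolding algebraic_on_def by blast
  obtain m where m: "n = Suc m"
  proof (cases n)
    case 0
    then have "F = [:coeff F 0:]" using F(3) by (intro poly_eqI) (simp add: coeff_pCons split: nat.split)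
    from arg_cong[OF this, of "\<lambda>F. poly F (Dual z 0)"]
    have "poly F (Dual z 0) = coeff F 0" by simp
    with F(5) have "ind p' * std (coeff F 0) = 0" by (simp only:)
    moreover have "ind p' * std (coeff F 0) \<noteq> 0"
      using F(4)[unfolded le_supp_iff 0] F(1) by blast
    ultimately show thesis by simp
  qed (use that in blast)
  have "\<And>i. i > Suc m \<Longrightarrow> coeff F i = 0" using F(3) m by simp
  then have "\<exists>F'\<in>poly_over \<Gamma>. (\<forall>i>m. coeff F' i = 0) \<and>
      std (coeff F' m) = real (Suc m) *\<^sub>R std (coeff F (Suc m)) \<and>
      (\<forall>z w. eps (poly F (Dual z w)) = eps (poly F (Dual z 0)) + w * std (poly F' (Dual z 0)))"
    using derivation_graphD(1,5)[OF \<Gamma>] F(2) by (intro taylor_dual)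
  then obtain F' where F': "F' \<in> poly_over \<Gamma>" "\<forall>i>m. coeff F' i = 0"
      "std (coeff F' m) = real (Suc m) *\<^sub>R std (coeff F (Suc m))"
      "\<forall>z w. eps (poly F (Dual z w)) = eps (poly F (Dual z 0)) + w * std (poly F' (Dual z 0))"
    by (elim bexE conjE)
  let ?d = "std (poly F' (Dual z 0))"
  have lead: "supp (std (coeff F n)) \<le> supp (std (coeff F' m))"
    by (rule le_supp_mono) (simp add: F'(3) m)
  have d: "p' \<le> supp ?d"
    unfolding le_supp_iff
  proof (intro allI impI notI)
    fix p'' assume "p'' \<le> p'" "p'' \<noteq> bot" "ind p'' * ?d = 0"
    moreover from this have "p'' \<le> supp (std (coeff F' m))" using F(4) lead by (meson order_trans)
    ultimately have "algebraic_on \<Gamma> z m p''"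
      unfolding algebraic_on_def using F'(1,2) by (intro conjI bexI[of _ F'])
    then show False using min \<open>p'' \<le> p'\<close> m by blast
  qed
  obtain y where y: "ind p' * (y * ?d) = ind p'" using L0_inverse_on_supp[OF d] .
  define w where "w = - eps (poly F (Dual z 0)) * y"
  have root: "ind_dual p' * poly F (Dual z w) = 0"
  proof (rule dual.expand, rule conjI)
    show "std (ind_dual p' * poly F (Dual z w)) = std 0" using F(5) by (simp add: std_poly_eq[of F z w])
    have "ind p' * (w * ?d) = - eps (poly F (Dual z 0)) * (ind p' * (y * ?d))"
      by (simp add: w_def algebra_simps)
    also have "\<dots> = - (ind p' * eps (poly F (Dual z 0)))" by (simp only: y) (simp add: mult.commute)
    finally show "eps (ind_dual p' * poly F (Dual z w)) = eps 0"
      using F'(4)[rule_format, of z w] by (simp add: distrib_left)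
  qed
  have "\<exists>\<Gamma>'. derivation_graph \<Gamma>' \<and> \<Gamma> \<subseteq> \<Gamma>' \<and> ind_dual p' * Dual z w \<in> \<Gamma>'"
  proof (rule derivation_graph_adjoin[OF \<Gamma>])
    fix G assume "G \<in> poly_over \<Gamma>" "ind p' * std (poly G (Dual z w)) = 0"
    with \<Gamma> min F(2,3,4) root show "ind_dual p' * poly G (Dual z w) = 0"
      by (rule poly_vanishing_minimal_relation)
  qed
  moreover have "ind_dual p' * Dual z w = Dual (ind p' * z) (ind p' * w)" by (rule dual.expand) simp
  ultimately have "\<exists>\<Gamma>'. derivation_graph \<Gamma>' \<and> \<Gamma> \<subseteq> \<Gamma>' \<and> Dual (ind p' * z) (ind p' * w) \<in> \<Gamma>'" by simp
  then show ?thesis using p'(1) F(1) by blast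
qed

section \<open>Extending derivations to all of \<open>L\<^sup>0\<close>\<close>

lemma derivation_graph_maximal:
  assumes \<Gamma>0: "derivation_graph \<Gamma>0"
  obtains \<Gamma> where "derivation_graph \<Gamma>" "\<Gamma>0 \<subseteq> \<Gamma>"
    "\<And>\<Gamma>'. derivation_graph \<Gamma>' \<Longrightarrow> \<Gamma> \<subseteq> \<Gamma>' \<Longrightarrow> \<Gamma>' = \<Gamma>"
proof -
  let ?A = "{\<Gamma>. derivation_graph \<Gamma> \<and> \<Gamma>0 \<subseteq> \<Gamma>}"
  have "\<exists>M\<in>?A. \<forall>X\<in>?A. M \<subseteq> X \<longrightarrow> X = M"
  proof (rule subset_Zorn_nonempty)
    show "?A \<noteq> {}" using \<Gamma>0 by blast
    fix C assume C: "C \<noteq> {}" "subset.chain ?A C"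
    have CA: "derivation_graph X" "\<Gamma>0 \<subseteq> X" if "X \<in> C" for X
      using C(2) that unfolding subset_chain_def by blast+
    have ch: "X \<subseteq> Y \<or> Y \<subseteq> X" if "X \<in> C" "Y \<in> C" for X Y
      using C(2) that unfolding subset_chain_def by blast
    have "derivation_graph (\<Union>C)"
      unfolding derivation_graph_def
    proof (intro conjI allI ballI impI)
      show "Dual (r *\<^sub>R ind p) 0 \<in> \<Union>C" for r p
        using C(1) CA(1) derivation_graphD(3) by blast
      show "b = 0" if "Dual 0 b \<in> \<Union>C" for b
        using that CA(1) unfolding derivation_graph_def by blast
      fix x y assume "x \<in> \<Union>C" "y \<in> \<Union>C"
      then obtain X Y where XY: "X \<in> C" "x \<in> X" "Y \<in> C" "y \<in> Y" by (elim UnionE)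
      obtain Z where Z: "Z \<in> C" "x \<in> Z" "y \<in> Z"
        using ch[OF XY(1,3)] XY by (elim disjE) (metis subsetD)+
      show "x + y \<in> \<Union>C" using derivation_graphD(1)[OF CA(1)[OF Z(1)] Z(2,3)] Z(1) by blast
      show "x * y \<in> \<Union>C" using derivation_graphD(2)[OF CA(1)[OF Z(1)] Z(2,3)] Z(1) by blast
    qed
    moreover have "\<Gamma>0 \<subseteq> \<Union>C" using C(1) CA(2) by (metis Sup_upper2 all_not_in_conv)
    ultimately show "\<Union>C \<in> ?A" by simp
  qed
  then obtain M where "M \<in> ?A" "\<forall>X\<in>?A. M \<subseteq> X \<longrightarrow> X = M" by (rule bexE)
  then show thesis using that[of M] by (metis (mono_tags, lifting) mem_Collect_eq order_trans)
qed

text \<open>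
  Membership in a graph may be relaxed to membership on a dense set of pieces: products and sums are
  formed on common refinements, and an element vanishing on a dense set of pieces is zero. In particular a
  maximal graph is closed under gluing.
\<close>

lemma derivation_graph_local_closure:
  assumes \<Gamma>: "derivation_graph \<Gamma>"
  shows "derivation_graph {x. \<forall>p. p \<noteq> bot \<longrightarrow> (\<exists>p'\<le>p. p' \<noteq> bot \<and> ind_dual p' * x \<in> \<Gamma>)}"
    (is "derivation_graph ?\<Gamma>'")
  unfolding derivation_graph_def
proof (intro conjI allI ballI impI)
  note \<Gamma>D = derivation_graphD[OF \<Gamma>]
  have sub: "x \<in> ?\<Gamma>'" if "x \<in> \<Gamma>" for x using \<Gamma>D(2)[OF \<Gamma>D(6) that] by blast
  show "Dual (r *\<^sub>R ind p) 0 \<in> ?\<Gamma>'" for r p using sub \<Gamma>D(3) by blast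
  show "b = 0" if b: "Dual 0 b \<in> ?\<Gamma>'" for b
  proof (rule L0_eqI_locally)
    fix p :: 'a assume "p \<noteq> bot"
    then obtain p' where p': "p' \<le> p" "p' \<noteq> bot" "ind_dual p' * Dual 0 b \<in> \<Gamma>" using b by blast
    have "ind_dual p' * Dual 0 b = 0" by (rule \<Gamma>D(7)[OF p'(3)]) simp
    from arg_cong[OF this, of eps] have "ind p' * b = ind p' * 0" by simp
    then show "\<exists>p'\<le>p. p' \<noteq> bot \<and> ind p' * b = ind p' * 0" using p' by blast
  qed
  fix x y assume x: "x \<in> ?\<Gamma>'" and y: "y \<in> ?\<Gamma>'"
  have both: "\<exists>p''\<le>p. p'' \<noteq> bot \<and> ind_dual p'' * x \<in> \<Gamma> \<and> ind_dual p'' * y \<in> \<Gamma>" if "p \<noteq> bot" for p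
  proof -
    obtain p' where p': "p' \<le> p" "p' \<noteq> bot" "ind_dual p' * x \<in> \<Gamma>" using x \<open>p \<noteq> bot\<close> by blast
    obtain p'' where p'': "p'' \<le> p'" "p'' \<noteq> bot" "ind_dual p'' * y \<in> \<Gamma>" using y p'(2) by blast
    have "ind_dual p'' * (ind_dual p' * x) \<in> \<Gamma>" by (rule \<Gamma>D(2)[OF \<Gamma>D(6) p'(3)])
    then have "ind_dual p'' * x \<in> \<Gamma>" by (simp only: ind_dual_absorb[OF p''(1)])
    then show ?thesis using p' p'' by (meson order_trans)
  qed
  show "x + y \<in> ?\<Gamma>'"
  proof (intro CollectI allI impI)
    fix p :: 'a assume "p \<noteq> bot"
    from both[OF this] obtain p' where p': "p' \<le> p" "p' \<noteq> bot" "ind_dual p' * x \<in> \<Gamma>" "ind_dual p' * y \<in> \<Gamma>"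
      by (elim exE conjE)
    then have "ind_dual p' * (x + y) \<in> \<Gamma>" unfolding distrib_left by (intro \<Gamma>D(1))
    then show "\<exists>p'\<le>p. p' \<noteq> bot \<and> ind_dual p' * (x + y) \<in> \<Gamma>" using p' by blast
  qed
  show "x * y \<in> ?\<Gamma>'"
  proof (intro CollectI allI impI)
    fix p :: 'a assume "p \<noteq> bot"
    from both[OF this] obtain p' where p': "p' \<le> p" "p' \<noteq> bot" "ind_dual p' * x \<in> \<Gamma>" "ind_dual p' * y \<in> \<Gamma>"
      by (elim exE conjE)
    then have "(ind_dual p' * x) * (ind_dual p' * y) \<in> \<Gamma>" using \<Gamma>D(2) by blast
    moreover have "(ind_dual p' * x) * (ind_dual p' * y) = ind_dual p' * (ind_dual p' * (x * y))"
      by (simp only: ac_simps)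
    ultimately have "ind_dual p' * (x * y) \<in> \<Gamma>" by (simp only: ind_dual_absorb[OF order_refl])
    then show "\<exists>p'\<le>p. p' \<noteq> bot \<and> ind_dual p' * (x * y) \<in> \<Gamma>" using p' by blast
  qed
qed

text \<open>
  For a maximal graph the local extensions lie in the graph itself; mixing their values gives an element
  which lies in the graph locally, hence globally.
\<close>

lemma derivation_graph_total:
  assumes \<Gamma>0: "derivation_graph \<Gamma>0"
  obtains \<Gamma> where "derivation_graph \<Gamma>" "\<Gamma>0 \<subseteq> \<Gamma>" "\<And>z. \<exists>w. Dual z w \<in> \<Gamma>"
proof -
  obtain \<Gamma> where \<Gamma>: "derivation_graph \<Gamma>" "\<Gamma>0 \<subseteq> \<Gamma>"
    and max: "\<And>\<Gamma>'. derivation_graph \<Gamma>' \<Longrightarrow> \<Gamma> \<subseteq> \<Gamma>' \<Longrightarrow> \<Gamma>' = \<Gamma>"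
    using derivation_graph_maximal[OF \<Gamma>0] by metis
  note \<Gamma>D = derivation_graphD[OF \<Gamma>(1)]
  define \<Gamma>' where "\<Gamma>' = {x. \<forall>p. p \<noteq> bot \<longrightarrow> (\<exists>p'\<le>p. p' \<noteq> bot \<and> ind_dual p' * x \<in> \<Gamma>)}"
  have "\<Gamma> \<subseteq> \<Gamma>'" unfolding \<Gamma>'_def using \<Gamma>D(2)[OF \<Gamma>D(6)] by blast
  then have closed: "\<Gamma>' = \<Gamma>" using derivation_graph_local_closure[OF \<Gamma>(1)] max unfolding \<Gamma>'_def by blast
  have restrict: "ind_dual p * Dual z w = Dual (ind p * z) (ind p * w)" for p and z w :: "'a L0"
    by (rule dual.expand) simp
  have "\<exists>w. Dual z w \<in> \<Gamma>" for z
  proof -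
    let ?R = "\<lambda>p v. ind_dual p * Dual z v \<in> \<Gamma>"
    have "\<exists>w. \<forall>p. p \<noteq> bot \<longrightarrow> (\<exists>p'\<le>p. p' \<noteq> bot \<and> (\<exists>v. ?R p' v \<and> ind p' * w = ind p' * v))"
    proof (rule L0_mixing)
      show "?R p' v" if "?R p v" "p' \<le> p" for p p' v
        using \<Gamma>D(2)[OF \<Gamma>D(6) that(1), of p'] by (simp only: ind_dual_absorb[OF that(2)])
      fix p :: 'a assume "p \<noteq> bot"
      from derivation_extends_locally[OF \<Gamma>(1) this, of z]
      obtain p' w \<Gamma>'' where p': "p' \<le> p" "p' \<noteq> bot" "derivation_graph \<Gamma>''" "\<Gamma> \<subseteq> \<Gamma>''" "Dual (ind p' * z) w \<in> \<Gamma>''"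
        by (elim exE conjE)
      then have "Dual (ind p' * z) w \<in> \<Gamma>" using max by blast
      then have "ind_dual p' * Dual (ind p' * z) w \<in> \<Gamma>" by (intro \<Gamma>D(2) \<Gamma>D(6))
      then have "?R p' w" by (simp only: restrict ind_mult_absorb[OF order_refl])
      then show "\<exists>p'\<le>p. p' \<noteq> bot \<and> (\<exists>v. ?R p' v)" using p'(1,2) by blast
    qed
    then obtain w where w: "\<forall>p. p \<noteq> bot \<longrightarrow> (\<exists>p'\<le>p. p' \<noteq> bot \<and> (\<exists>v. ?R p' v \<and> ind p' * w = ind p' * v))" ..
    have "\<exists>p'\<le>p. p' \<noteq> bot \<and> ind_dual p' * Dual z w \<in> \<Gamma>" if "p \<noteq> bot" for p
    proof -
      obtain p' v where p': "p' \<le> p" "p' \<noteq> bot" "?R p' v" "ind p' * w = ind p' * v"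
        using w[rule_format, OF \<open>p \<noteq> bot\<close>] by (elim exE conjE)
      have "?R p' w" using p'(3) unfolding restrict p'(4) .
      then show ?thesis using p' by blast
    qed
    then have "Dual z w \<in> \<Gamma>'" unfolding \<Gamma>'_def by blast
    then show ?thesis unfolding closed by blast
  qed
  then show thesis using that \<Gamma> by blast
qed

section \<open>A derivation that does not vanish at a nowhere constant element\<close>

definition locally_constant :: "'b::complete_ba L0 \<Rightarrow> bool" where
  "locally_constant s \<longleftrightarrow> (\<forall>p. p \<noteq> bot \<longrightarrow> (\<exists>p'\<le>p. p' \<noteq> bot \<and> (\<exists>r. ind p' * s = r *\<^sub>R ind p')))"

definition nowhere_constant_on :: "'b::complete_ba \<Rightarrow> 'b L0 \<Rightarrow> bool" where
  "nowhere_constant_on f x \<longleftrightarrow> (\<forall>p\<le>f. p \<noteq> bot \<longrightarrow> (\<forall>r. ind p * x \<noteq> r *\<^sub>R ind p))"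

lemma ind_mult_eq_const_iff:
  "ind p * x = r *\<^sub>R ind p \<longleftrightarrow> eventually (\<lambda>q. p \<in> q \<longrightarrow> val x q = r) generically"
proof -
  have "r *\<^sub>R ind p = ind p * (r *\<^sub>R 1)" by (simp add: mult.commute[of _ 1] L0_one_mult)
  then have "ind p * x = r *\<^sub>R ind p \<longleftrightarrow> eventually (\<lambda>q. p \<in> q \<longrightarrow> val x q = val (r *\<^sub>R 1) q) generically"
    by (simp only: ind_mult_eq_iff)
  also have "\<dots> \<longleftrightarrow> eventually (\<lambda>q. p \<in> q \<longrightarrow> val x q = r) generically"
    by (rule eventually_subst) (use val_scaleR[of r 1] val_one in \<open>eventually_elim, simp\<close>)
  finally show ?thesis .
qed

lemma ind_mult_eq_const_mono:
  "p' \<le> p \<Longrightarrow> ind p * s = r *\<^sub>R ind p \<Longrightarrow> ind p' * s = r *\<^sub>R ind p'"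
  by (metis ind_mult_absorb ind_mult_ind mult_scaleR_right)

text \<open>
  The zero derivation on the locally constant elements, the starting point of the extension.
\<close>

lemma derivation_graph_locally_constant:
  "derivation_graph {Dual s 0 | s. locally_constant (s :: 'b::complete_ba L0)}"
  unfolding derivation_graph_def
proof (intro conjI allI ballI impI)
  have "locally_constant (r *\<^sub>R ind p)" for r and p :: 'b
    unfolding locally_constant_def
  proof (intro allI impI)
    fix p1 :: 'b assume p1: "p1 \<noteq> bot"
    show "\<exists>p'\<le>p1. p' \<noteq> bot \<and> (\<exists>s. ind p' * (r *\<^sub>R ind p) = s *\<^sub>R ind p')"
    proof (cases "inf p1 p = bot")
      case True
      then have "ind p1 * (r *\<^sub>R ind p) = 0 *\<^sub>R ind p1" by (simp add: ind_inf[symmetric] ind_bot)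
      then show ?thesis using p1 by blast
    next
      case False
      have "ind (inf p1 p) * (r *\<^sub>R ind p) = r *\<^sub>R ind (inf p1 p)" by (simp add: ind_mult_ind)
      then show ?thesis using False inf_le1 by blast
    qed
  qed
  then show "Dual (r *\<^sub>R ind p) 0 \<in> {Dual s 0 | s. locally_constant s}" for r and p :: 'b by blast
  show "b = 0" if "Dual 0 b \<in> {Dual s 0 | s. locally_constant s}" for b :: "'b L0" using that by simp
  fix x y :: "'b L0 dual" assume "x \<in> {Dual s 0 | s. locally_constant s}" "y \<in> {Dual s 0 | s. locally_constant s}"
  then obtain s t where st: "x = Dual s 0" "y = Dual t 0" "locally_constant s" "locally_constant t" by blast
  have both: "\<exists>p'\<le>p. p' \<noteq> bot \<and> (\<exists>a b. ind p' * s = a *\<^sub>R ind p' \<and> ind p' * t = b *\<^sub>R ind p')" if p: "p \<noteq> bot" for p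
  proof -
    obtain p1 a where p1: "p1 \<le> p" "p1 \<noteq> bot" "ind p1 * s = a *\<^sub>R ind p1"
      using st(3) p unfolding locally_constant_def by blast
    obtain p2 b where p2: "p2 \<le> p1" "p2 \<noteq> bot" "ind p2 * t = b *\<^sub>R ind p2"
      using st(4) p1(2) unfolding locally_constant_def by blast
    have "ind p2 * s = a *\<^sub>R ind p2" using p2(1) p1(3) by (rule ind_mult_eq_const_mono)
    then show ?thesis using p1(1) p2 by (meson order_trans)
  qed
  have "locally_constant (s + t)" unfolding locally_constant_def
  proof (intro allI impI)
    fix p :: 'b assume "p \<noteq> bot"
    from both[OF this] obtain p' a b where p': "p' \<le> p" "p' \<noteq> bot" "ind p' * s = a *\<^sub>R ind p'" "ind p' * t = b *\<^sub>R ind p'"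
      by (elim exE conjE)
    have "ind p' * (s + t) = (a + b) *\<^sub>R ind p'" by (simp add: distrib_left scaleR_left_distrib p'(3,4))
    then show "\<exists>p'\<le>p. p' \<noteq> bot \<and> (\<exists>r. ind p' * (s + t) = r *\<^sub>R ind p')" using p'(1,2) by blast
  qed
  then show "x + y \<in> {Dual s 0 | s. locally_constant s}" using st(1,2) by (simp add: plus_dual_def)
  have "locally_constant (s * t)" unfolding locally_constant_def
  proof (intro allI impI)
    fix p :: 'b assume "p \<noteq> bot"
    from both[OF this] obtain p' a b where p': "p' \<le> p" "p' \<noteq> bot" "ind p' * s = a *\<^sub>R ind p'" "ind p' * t = b *\<^sub>R ind p'"
      by (elim exE conjE)
    have "ind p' * (s * t) = (ind p' * s) * t" by (simp only: mult.assoc)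
    also have "\<dots> = a *\<^sub>R (ind p' * t)" by (simp add: p'(3))
    also have "\<dots> = (a * b) *\<^sub>R ind p'" by (simp add: p'(4))
    finally show "\<exists>p'\<le>p. p' \<noteq> bot \<and> (\<exists>r. ind p' * (s * t) = r *\<^sub>R ind p')" using p'(1,2) by blast
  qed
  then show "x * y \<in> {Dual s 0 | s. locally_constant s}" using st(1,2) by (simp add: times_dual_def)
qed

text \<open>
  On a small enough piece the finitely many coefficients are all constant, and evaluation becomes
  pointwise evaluation of one real polynomial.
\<close>

lemma poly_over_locally_constant:
  fixes x :: "'b::complete_ba L0"
  assumes "F \<in> poly_over {Dual s 0 | s. locally_constant s}" "p \<noteq> bot"
  shows "\<exists>p'\<le>p. p' \<noteq> bot \<and> (\<exists>g. (\<forall>i. ind p' * std (coeff F i) = coeff g i *\<^sub>R ind p') \<and>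
    eventually (\<lambda>q. p' \<in> q \<longrightarrow> val (std (poly F (Dual x 0))) q = poly g (val x q)) generically)"
  using assms(1)
proof (induction F)
  case 0
  have "eventually (\<lambda>q. p \<in> q \<longrightarrow> val (std (poly 0 (Dual x 0))) q = poly 0 (val x q)) generically"
    using val_zero by eventually_elim simp
  then show ?case using assms(2) by (intro exI[of _ p] conjI exI[of _ 0]) simp_all
next
  case (pCons c F)
  have cF: "coeff (pCons c F) i \<in> {Dual s 0 | s. locally_constant s}" for i
    using pCons.prems by (simp add: poly_over_def)
  have "F \<in> poly_over {Dual s 0 | s. locally_constant s}"
    unfolding poly_over_def using cF[of "Suc _"] by simp
  from pCons.IH[OF this]
  obtain p1 g where p1: "p1 \<le> p" "p1 \<noteq> bot" "\<forall>i. ind p1 * std (coeff F i) = coeff g i *\<^sub>R ind p1"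
    and ev: "eventually (\<lambda>q. p1 \<in> q \<longrightarrow> val (std (poly F (Dual x 0))) q = poly g (val x q)) generically"
    by (elim exE conjE)
  have "locally_constant (std c)" using cF[of 0] by auto
  then obtain p2 r where p2: "p2 \<le> p1" "p2 \<noteq> bot" "ind p2 * std c = r *\<^sub>R ind p2"
    using p1(2) unfolding locally_constant_def by blast
  have "ind p2 * std (coeff (pCons c F) i) = coeff (pCons r g) i *\<^sub>R ind p2" for i
    using p2(3) ind_mult_eq_const_mono[OF p2(1) p1(3)[rule_format]] by (cases i) simp_all
  moreover have "eventually (\<lambda>q. p2 \<in> q \<longrightarrow>
      val (std (poly (pCons c F) (Dual x 0))) q = poly (pCons r g) (val x q)) generically"
    using ev p2(3)[unfolded ind_mult_eq_const_iff] generically_ultrafilter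
      val_plus[of "std c" "x * std (poly F (Dual x 0))"] val_times[of x "std (poly F (Dual x 0))"]
  proof eventually_elim
    case (elim q)
    then have "p2 \<in> q \<longrightarrow> p1 \<in> q" using p2(1) by (auto simp: ultrafilter_def)
    then show ?case using elim by simp
  qed
  moreover have "p2 \<le> p" using p1(1) p2(1) by simp
  ultimately show ?case using p2(2) by (intro exI[of _ p2] conjI exI[of _ "pCons r g"]) simp_all
qed

text \<open>
  A relation would confine the values of \<open>x\<close> on some piece to the finite root set of a nonzero real
  polynomial; by continuity \<open>x\<close> would be constant near each point.
\<close>

lemma nowhere_constant_not_algebraic:
  assumes x: "nowhere_constant_on f x" and p: "p \<le> f"
  shows "\<not> algebraic_on {Dual s 0 | s. locally_constant s} x n p"
proof
  assume "algebraic_on {Dual s 0 | s. locally_constant s} x n p"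
  then obtain F where F: "p \<noteq> bot" "F \<in> poly_over {Dual s 0 | s. locally_constant s}"
    "p \<le> supp (std (coeff F n))" "ind p * std (poly F (Dual x 0)) = 0"
    unfolding algebraic_on_def by (elim conjE bexE)
  from poly_over_locally_constant[OF F(2,1), of x]
  obtain p' g where p': "p' \<le> p" "p' \<noteq> bot" "\<forall>i. ind p' * std (coeff F i) = coeff g i *\<^sub>R ind p'"
    and ev: "eventually (\<lambda>q. p' \<in> q \<longrightarrow> val (std (poly F (Dual x 0))) q = poly g (val x q)) generically"
    by (elim exE conjE)
  have "ind p' * std (coeff F n) \<noteq> 0" using F(3) p' le_supp_iff by (metis)
  then have "g \<noteq> 0" using p'(3) by (metis coeff_0 scaleR_zero_left)
  then have fin: "finite {r. poly g r = 0}" by (rule poly_roots_finite)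
  have "eventually (\<lambda>q. p \<in> q \<longrightarrow> val (std (poly F (Dual x 0))) q = 0) generically"
    using F(4) ind_mult_eq_0_iff by blast
  then have root: "eventually (\<lambda>q. \<bar>apply_L0 x q\<bar> \<noteq> \<infinity> \<and> (p' \<in> q \<longrightarrow> poly g (val x q) = 0)) generically"
    using ev generically_ultrafilter generically_finite[of x]
  proof eventually_elim
    case (elim q)
    then have "p' \<in> q \<longrightarrow> p \<in> q" using p'(1) by (auto simp: ultrafilter_def)
    then show ?case using elim by simp
  qed
  obtain q where q: "q \<in> clopen p'" "\<bar>apply_L0 x q\<bar> \<noteq> \<infinity> \<and> (p' \<in> q \<longrightarrow> poly g (val x q) = 0)"
    by (rule generic_point[OF root p'(2)])
  obtain \<epsilon> where \<epsilon>: "\<epsilon> > 0" "\<forall>r\<in>{r. poly g r = 0}. r \<noteq> val x q \<longrightarrow> \<epsilon> \<le> dist (val x q) r"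
    using finite_set_avoid[OF fin] by metis
  obtain p'' where p'': "p'' \<le> p'" "q \<in> clopen p''"
    "\<And>q'. q' \<in> clopen p'' \<Longrightarrow> \<bar>apply_L0 x q'\<bar> \<noteq> \<infinity> \<and> \<bar>val x q' - val x q\<bar> < \<epsilon>"
    using L0_near[OF q(1) conjunct1[OF q(2)] \<epsilon>(1)] by metis
  have "eventually (\<lambda>q'. p'' \<in> q' \<longrightarrow> val x q' = val x q) generically"
    using root generically_ultrafilter
  proof eventually_elim
    case (elim q')
    show ?case
    proof
      assume "p'' \<in> q'"
      then have q': "q' \<in> clopen p''" using elim by (simp add: clopen_def)
      then have "p' \<in> q'" using clopen_mono[OF p''(1)] by (auto simp: clopen_def)
      then have "poly g (val x q') = 0" using elim by simp
      then show "val x q' = val x q"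
        using \<epsilon>(2) p''(3)[OF q'] by (force simp: dist_real_def abs_minus_commute)
    qed
  qed
  then have "ind p'' * x = val x q *\<^sub>R ind p''" by (simp only: ind_mult_eq_const_iff)
  moreover have "p'' \<le> f" using p''(1) p'(1) p by simp
  ultimately show False
    using x clopen_nonbot[OF p''(2)] unfolding nowhere_constant_on_def by blast
qed

text \<open>
  Adjoin \<open>x + \<epsilon>\<close> on \<open>f\<close> to the graph of the zero derivation and extend. The resulting derivation preserves
  bands because the idempotents have derivative zero.
\<close>

lemma derivation_of_nowhere_constant:
  fixes x :: "'b::complete_ba L0"
  assumes x: "nowhere_constant_on f x"
  obtains D where "derivation UNIV UNIV D" "band_preserving UNIV D" "ind f * D x = ind f"
proof -
  let ?\<Gamma>0 = "{Dual s 0 | s. locally_constant (s :: 'b L0)}"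
  note \<Gamma>0 = derivation_graph_locally_constant[where 'b = 'b]
  have "\<exists>\<Gamma>1. derivation_graph \<Gamma>1 \<and> ?\<Gamma>0 \<subseteq> \<Gamma>1 \<and> ind_dual f * Dual x 1 \<in> \<Gamma>1"
  proof (rule derivation_graph_adjoin[OF \<Gamma>0])
    fix F assume F: "F \<in> poly_over ?\<Gamma>0" "ind f * std (poly F (Dual x 1)) = 0"
    have v: "\<And>i. i \<ge> Suc (degree F) \<Longrightarrow> coeff F i = 0" by (simp add: coeff_eq_0)
    show "ind_dual f * poly F (Dual x 1) = 0"
      by (rule poly_vanishing_below_minimal_degree[OF \<Gamma>0 nowhere_constant_not_algebraic[OF x] F(1) v F(2)])
  qed
  then obtain \<Gamma>1 where \<Gamma>1: "derivation_graph \<Gamma>1" "ind_dual f * Dual x 1 \<in> \<Gamma>1" by (elim exE conjE)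
  obtain \<Gamma> where \<Gamma>: "derivation_graph \<Gamma>" "\<Gamma>1 \<subseteq> \<Gamma>" and total: "\<And>z. \<exists>w. Dual z w \<in> \<Gamma>"
    using derivation_graph_total[OF \<Gamma>1(1)] by metis
  note \<Gamma>D = derivation_graphD[OF \<Gamma>(1)]
  define D where "D z = (SOME w. Dual z w \<in> \<Gamma>)" for z
  have D: "Dual z (D z) \<in> \<Gamma>" for z unfolding D_def using total by (rule someI_ex)
  have D_eq: "D z = w" if "Dual z w \<in> \<Gamma>" for z w
  proof -
    have "Dual z (D z) + - Dual z w \<in> \<Gamma>" by (intro \<Gamma>D(1) \<Gamma>D(4) D that)
    then have "Dual z (D z) + - Dual z w = 0" by (rule \<Gamma>D(7)) simp
    from arg_cong[OF this, of eps] show ?thesis by simp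
  qed
  have D_ind: "D (ind p * z) = ind p * D z" for p z
  proof (rule D_eq)
    have "Dual (ind p * z) (ind p * D z) = ind_dual p * Dual z (D z)" by (rule dual.expand) simp
    then show "Dual (ind p * z) (ind p * D z) \<in> \<Gamma>" using \<Gamma>D(2)[OF \<Gamma>D(6) D] by simp
  qed
  have "derivation UNIV UNIV D"
    unfolding derivation_def
  proof (intro conjI ballI allI)
    show "D \<in> UNIV \<rightarrow> UNIV" by simp
    fix y z :: "'b L0" and r :: real
    show "D (y + z) = D y + D z"
      using \<Gamma>D(1)[OF D D, of y z] by (intro D_eq) (simp add: plus_dual_def)
    show "D (y * z) = D y * z + y * D z"
      using \<Gamma>D(2)[OF D D, of y z] by (intro D_eq) (simp add: times_dual_def add.commute)
    have "Dual (r *\<^sub>R ind top) 0 * Dual z (D z) = Dual (r *\<^sub>R z) (r *\<^sub>R D z)"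
      by (rule dual.expand) (simp add: ind_top L0_one_mult)
    then show "D (r *\<^sub>R z) = r *\<^sub>R D z"
      using \<Gamma>D(2)[OF \<Gamma>D(3)[of r top] D[of z]] by (intro D_eq) simp
  qed
  moreover have "band_preserving UNIV D"
    unfolding band_preserving_def
  proof (intro ballI le_supp_mono)
    fix y :: "'b L0" and e assume "ind e * y = 0"
    moreover have "D 0 = 0" using \<Gamma>D(5) by (intro D_eq) (simp add: zero_dual_def)
    ultimately show "ind e * D y = 0" using D_ind[of e y] by simp
  qed
  moreover have "ind f * D x = ind f"
  proof -
    have "ind_dual f * Dual x 1 = Dual (ind f * x) (ind f)"
      by (rule dual.expand) (simp add: mult.commute[of _ 1] L0_one_mult)
    then have "Dual (ind f * x) (ind f) \<in> \<Gamma>" using \<Gamma>1(2) \<Gamma>(2) by auto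
    then show ?thesis using D_eq D_ind by metis
  qed
  ultimately show thesis by (rule that)
qed

section \<open>\<open>\<sigma>\<close>-distributivity and locally constant elements\<close>

text \<open>
  At each scale \<open>1 / (n + 1)\<close> the pieces on which \<open>x\<close> is that close to the \<open>m\<close>-th rational cover \<open>e\<close>. The
  distributive law, applied to the complements of these pieces, gives a choice \<open>\<phi>\<close> of rationals for which
  the pieces selected at all scales have a nonzero common part; on it \<open>x\<close> has oscillation zero.
\<close>

lemma sigma_distributive_locally_constant:
  fixes x :: "'b::complete_ba L0"
  assumes sd: "sigma_distributive {..e}" and e: "e \<noteq> bot"
  shows "\<exists>f\<le>e. f \<noteq> bot \<and> (\<exists>r. ind f * x = r *\<^sub>R ind f)"
proof -
  define r where "r m = real_of_rat (from_nat m)" for m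
  define W where "W n m = {q \<in> topspace stone_space.
    apply_L0 x q \<in> {ereal (r m - 1 / real (Suc n))<..<ereal (r m + 1 / real (Suc n))}}" for n m
  have W: "openin stone_space (W n m)" for n m unfolding W_def by (rule openin_apply_L0) simp
  define b where "b n m = Sup {c. clopen c \<subseteq> W n m}" for n m
  define a where "a n m = inf e (- b n m)" for n m
  have ae: "a n m \<le> e" for n m by (simp add: a_def)
  \<comment> \<open>At scale \<open>n\<close> the pieces cover \<open>e\<close>, by density of the rationals.\<close>
  have "(INF m. a n m) = bot" for n
  proof (rule ccontr)
    assume "(INF m. a n m) \<noteq> bot"
    then obtain q where q: "q \<in> clopen (INF m. a n m)" "\<bar>apply_L0 x q\<bar> \<noteq> \<infinity>"
      using generic_point[OF generically_finite] by metis
    obtain s :: rat where s: "val x q - 1 / real (Suc n) < of_rat s" "of_rat s < val x q + 1 / real (Suc n)"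
      using of_rat_dense[of "val x q - 1 / real (Suc n)" "val x q + 1 / real (Suc n)"] by auto
    obtain m where m: "r m = of_rat s" unfolding r_def by (metis from_nat_to_nat)
    have fin: "apply_L0 x q = ereal (val x q)" using q(2) by (simp add: ereal_real')
    have "apply_L0 x q \<in> {ereal (r m - 1 / real (Suc n))<..<ereal (r m + 1 / real (Suc n))}"
      by (subst fin) (use s in \<open>simp add: m\<close>)
    then have "q \<in> W n m" using q(1) unfolding W_def by (simp add: topspace_stone clopen_def)
    then have "q \<in> clopen (b n m)" using clopen_Sup(1)[OF W] unfolding b_def by blast
    moreover have "(INF m. a n m) \<le> - b n m" unfolding a_def by (meson INF_lower UNIV_I inf.boundedE)
    ultimately show False using q(1) clopen_mono[of "INF m. a n m" "- b n m"] unfolding clopen_compl by blast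
  qed
  then have "(SUP n. INF m. a n m) = bot" by simp
  moreover have "\<forall>n m. a n m \<in> {..e}" using ae by simp
  ultimately have inf_bot: "(INF \<phi> :: nat \<Rightarrow> nat. SUP n. a n (\<phi> n)) = bot"
    using sd unfolding sigma_distributive_def by metis
  have "\<exists>\<phi>. \<not> e \<le> (SUP n. a n (\<phi> n))"
  proof (rule ccontr)
    assume "\<nexists>\<phi>. \<not> e \<le> (SUP n. a n (\<phi> n))"
    then have "e \<le> (INF \<phi> :: nat \<Rightarrow> nat. SUP n. a n (\<phi> n))" by (intro INF_greatest) simp
    then show False using inf_bot e by (simp add: bot_unique)
  qed
  then obtain \<phi> where \<phi>: "\<not> e \<le> (SUP n. a n (\<phi> n))" ..
  define f where "f = inf e (- (SUP n. a n (\<phi> n)))"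
  have f: "f \<le> e" "f \<noteq> bot" using \<phi> by (simp_all add: f_def inf_shunt)
  \<comment> \<open>The piece \<open>b n m\<close> is the closure of \<open>W n m\<close>, hence the non-strict inequality.\<close>
  have near: "\<bar>val x q - r (\<phi> n)\<bar> \<le> 1 / real (Suc n)" if q: "q \<in> clopen f" "\<bar>apply_L0 x q\<bar> \<noteq> \<infinity>" for q n
  proof (rule ccontr)
    assume far: "\<not> \<bar>val x q - r (\<phi> n)\<bar> \<le> 1 / real (Suc n)"
    have fa: "f \<le> - a n (\<phi> n)"
      unfolding f_def by (rule le_infI2) (simp only: compl_le_compl_iff, rule SUP_upper, simp)
    have "f \<le> b n (\<phi> n)"
    proof -
      have "inf f (- b n (\<phi> n)) \<le> a n (\<phi> n)" using f(1) unfolding a_def by (simp add: le_infI1)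
      moreover have "inf f (- b n (\<phi> n)) \<le> - a n (\<phi> n)" using fa by (simp add: le_infI1)
      ultimately have "inf f (- b n (\<phi> n)) \<le> inf (a n (\<phi> n)) (- a n (\<phi> n))" by (rule inf_greatest)
      then have "inf f (- b n (\<phi> n)) = bot" by (simp add: bot_unique)
      then show ?thesis by (simp add: inf_shunt)
    qed
    then have qb: "b n (\<phi> n) \<in> q" using q(1) clopen_mono by (auto simp: clopen_def)
    define d where "d = \<bar>val x q - r (\<phi> n)\<bar> - 1 / real (Suc n)"
    have "d > 0" using far by (simp add: d_def)
    then obtain p where p: "q \<in> clopen p"
        "\<And>q'. q' \<in> clopen p \<Longrightarrow> \<bar>apply_L0 x q'\<bar> \<noteq> \<infinity> \<and> \<bar>val x q' - val x q\<bar> < d"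
      using L0_near[OF q] by metis
    have "clopen p \<inter> W n (\<phi> n) = {}"
    proof (rule ccontr)
      assume "clopen p \<inter> W n (\<phi> n) \<noteq> {}"
      then obtain q' where q': "q' \<in> clopen p" "q' \<in> W n (\<phi> n)" by blast
      have "apply_L0 x q' = ereal (val x q')" using p(2)[OF q'(1)] by (simp add: ereal_real')
      moreover have "apply_L0 x q' \<in> {ereal (r (\<phi> n) - 1 / real (Suc n))<..<ereal (r (\<phi> n) + 1 / real (Suc n))}"
        using q'(2) unfolding W_def by blast
      ultimately have "\<bar>val x q' - r (\<phi> n)\<bar> < 1 / real (Suc n)"
        by (metis abs_diff_less_iff ereal_less_eq(3) greaterThanLessThan_iff less_ereal.simps(1))
      then show False using p(2)[OF q'(1)] unfolding d_def by linarith
    qed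
    then have "inf p (b n (\<phi> n)) = bot" using clopen_Sup(2)[OF W] unfolding b_def by blast
    then show False using mem_clopen_inf[OF p(1) qb] clopen_nonbot by blast
  qed
  obtain q0 where q0: "q0 \<in> clopen f" "\<bar>apply_L0 x q0\<bar> \<noteq> \<infinity>"
    using generic_point[OF generically_finite f(2)] by metis
  have same: "val x q = val x q0" if q: "q \<in> clopen f" "\<bar>apply_L0 x q\<bar> \<noteq> \<infinity>" for q
  proof (rule ccontr)
    assume "val x q \<noteq> val x q0"
    then have "\<bar>val x q - val x q0\<bar> / 2 > 0" by simp
    then obtain n where "1 / real (Suc n) < \<bar>val x q - val x q0\<bar> / 2" using nat_approx_posE by blast
    moreover have "\<bar>a - b\<bar> / 2 \<le> t" if "\<bar>a - c\<bar> \<le> t" "\<bar>b - c\<bar> \<le> t" for a b c t :: real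
    proof -
      have "\<bar>a - b\<bar> \<le> t + t" using that unfolding abs_le_iff by linarith
      then show ?thesis by simp
    qed
    ultimately show False using near[OF q, of n] near[OF q0, of n] by (meson not_less)
  qed
  have "eventually (\<lambda>q. f \<in> q \<longrightarrow> val x q = val x q0) generically"
    using generically_finite[of x] generically_ultrafilter
  proof eventually_elim
    case (elim q)
    then show ?case using same[of q] by (simp add: clopen_def)
  qed
  then have "ind f * x = val x q0 *\<^sub>R ind f" by (simp only: ind_mult_eq_const_iff)
  then show ?thesis using f by blast
qed

text \<open>
  Base \<open>3\<close> with only two digits makes the code injective, which base \<open>2\<close> would not.
\<close>

definition cantor_code :: "(nat \<Rightarrow> bool) \<Rightarrow> real" where
  "cantor_code s = (\<Sum>i. (1 / 3) ^ i * of_bool (s i))"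

lemma cantor_code_summable: "summable (\<lambda>i. (1 / 3 :: real) ^ i * of_bool (s i))"
  by (rule summable_comparison_test'[of "\<lambda>i. (1 / 3) ^ i"]) auto

lemma cantor_code_tail:
  assumes "\<And>i. i < N \<Longrightarrow> s i = t i"
  shows "\<bar>cantor_code s - cantor_code t\<bar> \<le> 3 / 2 * (1 / 3) ^ N"
proof -
  define h where "h i = (1 / 3 :: real) ^ i * (of_bool (s i) - of_bool (t i))" for i
  have sum: "cantor_code s - cantor_code t = suminf h"
    unfolding cantor_code_def h_def right_diff_distrib
    by (rule suminf_diff) (rule cantor_code_summable)+
  have "summable h"
    unfolding h_def right_diff_distrib by (intro summable_diff cantor_code_summable)
  then have "suminf h = (\<Sum>i. h (i + N)) + sum h {..<N}" by (rule suminf_split_initial_segment)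
  also have "sum h {..<N} = 0" using assms by (intro sum.neutral) (simp add: h_def)
  finally have tail: "suminf h = (\<Sum>i. h (i + N))" by simp
  have bound: "norm (h (i + N)) \<le> (1 / 3) ^ N * (1 / 3) ^ i" for i
    by (simp add: h_def power_add abs_mult)
  have geom: "(\<lambda>i. (1 / 3) ^ N * (1 / 3 :: real) ^ i) sums ((1 / 3) ^ N * (1 / (1 - 1 / 3)))"
    by (intro sums_mult geometric_sums) simp
  have "norm (\<Sum>i. h (i + N)) \<le> (\<Sum>i. (1 / 3) ^ N * (1 / 3) ^ i)"
    by (rule norm_suminf_le[OF bound sums_summable[OF geom]])
  also have "\<dots> = 3 / 2 * (1 / 3) ^ N" using sums_unique[OF geom] by simp
  finally show ?thesis by (simp add: sum tail)
qed

lemma cantor_code_inject: "cantor_code s = cantor_code t \<longleftrightarrow> s = t"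
proof
  assume eq: "cantor_code s = cantor_code t"
  show "s = t"
  proof (rule ccontr)
    assume "s \<noteq> t"
    then have ex: "\<exists>i. s i \<noteq> t i" by blast
    define k where "k = (LEAST i. s i \<noteq> t i)"
    have k: "s k \<noteq> t k" unfolding k_def using ex by (rule LeastI_ex)
    have below: "s i = t i" if "i < k" for i using not_less_Least[of i] that unfolding k_def by blast
    define t' where "t' = t(k := s k)"
    have "\<bar>cantor_code s - cantor_code t'\<bar> \<le> 3 / 2 * (1 / 3) ^ Suc k"
      using below by (intro cantor_code_tail) (auto simp: t'_def less_Suc_eq)
    moreover have "cantor_code t' - cantor_code t = (1 / 3) ^ k * (of_bool (s k) - of_bool (t k))"
    proof -
      have "cantor_code t' - cantor_code t = (\<Sum>i. (1 / 3) ^ i * of_bool (t' i) - (1 / 3) ^ i * of_bool (t i))"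
        unfolding cantor_code_def by (rule suminf_diff) (rule cantor_code_summable)+
      also have "\<dots> = (\<Sum>i. if i = k then (1 / 3) ^ k * (of_bool (s k) - of_bool (t k)) else 0)"
        by (rule arg_cong[where f = suminf]) (auto simp: t'_def right_diff_distrib)
      also have "\<dots> = (1 / 3) ^ k * (of_bool (s k) - of_bool (t k))"
        by (rule sums_unique[OF sums_single, symmetric])
      finally show ?thesis .
    qed
    moreover have "\<bar>(1 / 3 :: real) ^ k * (of_bool (s k) - of_bool (t k))\<bar> = (1 / 3) ^ k"
      using k by (cases "s k"; cases "t k") (auto simp: abs_mult)
    moreover have "(1 / 3 :: real) ^ k > 0" by simp
    ultimately show False using eq by (simp only: power_Suc)
  qed
qed simp

text \<open>
  Let \<open>f\<close> be the nonzero difference of the two sides of the distributive law, and let \<open>x\<close> code which of the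
  countably many \<open>a n m\<close> a point belongs to. If \<open>x\<close> is constant on \<open>p \<le> f\<close>, then \<open>p\<close> decides every
  \<open>a n m\<close>, so for each \<open>n\<close> it is disjoint from some \<open>a n (\<phi> n)\<close>, as it is disjoint from the left-hand side; but
  the right-hand side puts \<open>p\<close> below the supremum of these.
\<close>

lemma not_sigma_distributive_nowhere_constant:
  fixes e :: "'b::complete_ba"
  assumes "\<not> sigma_distributive {..e}"
  obtains f x where "f \<le> e" "f \<noteq> bot" "nowhere_constant_on f x"
proof -
  obtain a :: "nat \<Rightarrow> nat \<Rightarrow> 'b" where a: "\<And>n m. a n m \<le> e"
    and ne: "(SUP n. INF m. a n m) \<noteq> (INF \<phi> :: nat \<Rightarrow> nat. SUP n. a n (\<phi> n))"
    using assms unfolding sigma_distributive_def by auto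
  define L where "L = (SUP n. INF m. a n m)"
  define R where "R = (INF \<phi> :: nat \<Rightarrow> nat. SUP n. a n (\<phi> n))"
  have LR: "L \<le> R"
    unfolding L_def R_def
  proof (intro SUP_least INF_greatest)
    fix n and \<phi> :: "nat \<Rightarrow> nat"
    have "(INF m. a n m) \<le> a n (\<phi> n)" by (rule INF_lower) simp
    also have "\<dots> \<le> (SUP n. a n (\<phi> n))" by (rule SUP_upper) simp
    finally show "(INF m. a n m) \<le> (SUP n. a n (\<phi> n))" .
  qed
  define f where "f = inf R (- L)"
  have "\<not> R \<le> L" using LR ne unfolding L_def R_def by (metis antisym)
  then have f0: "f \<noteq> bot" by (simp add: f_def inf_shunt)
  have "R \<le> (SUP n. a n 0)" unfolding R_def by (rule INF_lower) simp
  also have "\<dots> \<le> e" using a by (intro SUP_least)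
  finally have fe: "f \<le> e" unfolding f_def by (rule le_infI1)
  define c where "c i = case_prod a (prod_decode i)" for i
  define code where "code q = cantor_code (\<lambda>i. c i \<in> q)" for q
  have agree: "\<exists>b\<in>q. \<forall>q'\<in>clopen b. \<forall>i<N. c i \<in> q' \<longleftrightarrow> c i \<in> q" if q: "ultrafilter q" for q N
  proof (induction N)
    case 0
    then show ?case using q by (auto simp: ultrafilter_def)
  next
    case (Suc N)
    then obtain b where b: "b \<in> q" "\<forall>q'\<in>clopen b. \<forall>i<N. c i \<in> q' \<longleftrightarrow> c i \<in> q" by (rule bexE)
    define d where "d = (if c N \<in> q then c N else - c N)"
    have d: "d \<in> q" using ultrafilter_compl[OF q] by (simp add: d_def)
    have "c N \<in> q' \<longleftrightarrow> c N \<in> q" if "q' \<in> clopen d" for q'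
    proof -
      have "ultrafilter q'" "d \<in> q'" using that by (simp_all add: clopen_def)
      then show ?thesis using ultrafilter_compl[of q' "c N"] unfolding d_def by (auto split: if_splits)
    qed
    moreover have "inf b d \<in> q" using q b(1) d unfolding ultrafilter_def by blast
    ultimately show ?case using b(2)
      by (intro bexI[of _ "inf b d"]) (auto simp: clopen_inf less_Suc_eq)
  qed
  have "\<exists>b\<in>q. \<forall>q'\<in>clopen b. \<bar>code q' - code q\<bar> < \<epsilon>" if q: "ultrafilter q" and \<epsilon>: "\<epsilon> > 0" for q \<epsilon>
  proof -
    obtain N where N: "(1 / 3 :: real) ^ N < \<epsilon> * (2 / 3)"
      using real_arch_pow_inv[of "\<epsilon> * (2 / 3)" "1 / 3"] \<epsilon> by auto
    obtain b where b: "b \<in> q" "\<forall>q'\<in>clopen b. \<forall>i<N. c i \<in> q' \<longleftrightarrow> c i \<in> q"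
      using agree[OF q] by (rule bexE)
    have "\<bar>code q' - code q\<bar> < \<epsilon>" if q': "q' \<in> clopen b" for q'
    proof -
      have "\<bar>code q' - code q\<bar> \<le> 3 / 2 * (1 / 3) ^ N"
        unfolding code_def using b(2) q' by (intro cantor_code_tail) blast
      also have "\<dots> < \<epsilon>" using N by linarith
      finally show ?thesis .
    qed
    then show ?thesis using b(1) by blast
  qed
  then obtain x where x: "\<And>q. ultrafilter q \<Longrightarrow> apply_L0 x q = ereal (code q)"
    using CQ_of_continuous[of code] by metis
  have "nowhere_constant_on f x"
    unfolding nowhere_constant_on_def
  proof (intro allI impI notI)
    fix p r assume p: "p \<le> f" "p \<noteq> bot" and const: "ind p * x = r *\<^sub>R ind p"
    have ev: "eventually (\<lambda>q. p \<in> q \<longrightarrow> code q = r) generically"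
      using const[unfolded ind_mult_eq_const_iff] generically_ultrafilter
    proof eventually_elim
      case (elim q)
      then show ?case using x[of q] by simp
    qed
    have code_p: "\<exists>q\<in>clopen p'. code q = r" if p': "p' \<le> p" "p' \<noteq> bot" for p'
    proof -
      obtain q where "q \<in> clopen p'" "p \<in> q \<longrightarrow> code q = r" by (rule generic_point[OF ev p'(2)])
      then show ?thesis using clopen_mono[OF p'(1)] by (auto simp: clopen_def)
    qed
    have decides: "p \<le> c i \<or> p \<le> - c i" for i
    proof (rule ccontr)
      assume "\<not> (p \<le> c i \<or> p \<le> - c i)"
      then have "inf p (- c i) \<noteq> bot" "inf p (c i) \<noteq> bot" by (auto simp: inf_shunt)
      then obtain q1 q2 where q1: "q1 \<in> clopen (inf p (- c i))" "code q1 = r"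
        and q2: "q2 \<in> clopen (inf p (c i))" "code q2 = r"
        using code_p inf_le1 by metis
      then have "(\<lambda>i. c i \<in> q1) = (\<lambda>i. c i \<in> q2)"
        unfolding code_def by (simp flip: cantor_code_inject)
      then have "c i \<in> q1 \<longleftrightarrow> c i \<in> q2" by (rule fun_cong)
      then show False using q1(1) q2(1) unfolding clopen_inf clopen_compl by (auto simp: clopen_def)
    qed
    have "\<exists>m. p \<le> - a n m" for n
    proof (rule ccontr)
      assume none: "\<nexists>m. p \<le> - a n m"
      have "p \<le> a n m" for m using decides[of "prod_encode (n, m)"] none by (auto simp: c_def)
      then have "p \<le> (INF m. a n m)" by (intro INF_greatest)
      also have "\<dots> \<le> L" unfolding L_def by (rule SUP_upper) simp
      finally have "p \<le> L" .
      moreover have "p \<le> - L" using p(1) by (simp add: f_def)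
      ultimately have "p \<le> inf L (- L)" by (rule inf_greatest)
      then show False using p(2) by (simp only: inf_compl_bot bot_unique)
    qed
    then obtain \<phi> where \<phi>: "\<And>n. p \<le> - a n (\<phi> n)" by metis
    have "p \<le> R" using p(1) by (simp add: f_def)
    also have "R \<le> (SUP n. a n (\<phi> n))" unfolding R_def by (rule INF_lower) simp
    finally have "inf p (SUP n. a n (\<phi> n)) = p" by (simp add: inf.absorb1)
    moreover have "inf p (SUP n. a n (\<phi> n)) = bot"
      unfolding inf_Sup_eq_bot_iff using \<phi> by (auto simp: inf_shunt)
    ultimately show False using p(2) by simp
  qed
  then show thesis using that fe f0 by blast
qed

section \<open>Band preserving derivations on ideals\<close>

lemma ind_in_CQ: "ind p \<in> CQ"
  by (auto simp: CQ_def ind.rep_eq)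

lemma ind_mult_in_ideal: "ideal_CQ X \<Longrightarrow> x \<in> X \<Longrightarrow> ind p * x \<in> X"
  using ind_in_CQ[of p] unfolding ideal_CQ_def by blast

text \<open>
  Where \<open>x\<close> is bounded away from zero, its inverse cut off outside \<open>e\<close> is a bounded continuous function.
\<close>

lemma ind_in_ideal:
  fixes x :: "'b::complete_ba L0"
  assumes X: "ideal_CQ X" "x \<in> X"
    and c: "c > 0" "\<And>q. q \<in> clopen e \<Longrightarrow> \<bar>apply_L0 x q\<bar> \<noteq> \<infinity> \<and> c \<le> \<bar>val x q\<bar>"
  shows "ind e \<in> X"
proof -
  define f where "f q = (if e \<in> q then inverse (val x q) else 0)" for q
  have "\<exists>b\<in>q. \<forall>q'\<in>clopen b. \<bar>f q' - f q\<bar> < \<epsilon>" if q: "ultrafilter q" and \<epsilon>: "\<epsilon> > 0" for q \<epsilon>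
  proof (cases "e \<in> q")
    case True
    then have "q \<in> clopen e" using q by (simp add: clopen_def)
    from inverse_near[OF this c(2) c(1) \<epsilon>] obtain b where b: "b \<in> q" "b \<le> e"
      "\<forall>q'\<in>clopen b. \<bar>inverse (val x q') - inverse (val x q)\<bar> < \<epsilon>" by auto
    have "e \<in> q'" if "q' \<in> clopen b" for q' using clopen_mono[OF b(2)] that by (auto simp: clopen_def)
    then show ?thesis using b True unfolding f_def by auto
  next
    case False
    then have "- e \<in> q" using q ultrafilter_compl by blast
    moreover have "e \<notin> q'" if "q' \<in> clopen (- e)" for q' using that unfolding clopen_compl by (auto simp: clopen_def)
    ultimately show ?thesis using False \<epsilon> unfolding f_def by (intro bexI[of _ "- e"]) auto
  qed
  then obtain z where z: "z \<in> CQ" "\<And>q. ultrafilter q \<Longrightarrow> apply_L0 z q = ereal (f q)"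
    using CQ_of_continuous[of f] by metis
  have nz: "val x q \<noteq> 0" if "q \<in> clopen e" for q using conjunct2[OF c(2)[OF that]] c(1) by linarith
  have "z * x = ind e"
  proof (rule L0_eqI_val)
    show "eventually (\<lambda>q. val (z * x) q = val (ind e) q) generically"
      using val_times[of z x] val_ind[of e]
    proof eventually_elim
      case (elim q)
      then have "ultrafilter q" by simp
      from z(2)[OF this] nz[of q] show ?case using elim by (simp add: f_def clopen_def)
    qed
  qed
  moreover have "z * x \<in> X" using X z(1) unfolding ideal_CQ_def by blast
  ultimately show ?thesis by simp
qed

lemma ind_mult_eq_0_if_supp_le:
  assumes "supp y \<le> supp x" "ind e * x = 0"
  shows "ind e * y = 0"
proof (rule ccontr)
  assume "ind e * y \<noteq> 0"
  then obtain p c where p: "p \<le> e" "p \<noteq> bot" "c > 0"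
    "\<And>q. q \<in> clopen p \<Longrightarrow> \<bar>apply_L0 y q\<bar> \<noteq> \<infinity> \<and> c \<le> \<bar>val y q\<bar>"
    using L0_bounded_below_on by metis
  have "p \<le> supp y" using p(3,4) le_supp_if_bounded_below by blast
  then have "p \<le> supp x" using assms(1) by simp
  then have "ind p * x \<noteq> 0" using p(2) le_supp_iff by blast
  then show False using ind_mult_eq_0_mono[OF p(1) assms(2)] by simp
qed

text \<open>
  The parts of \<open>x\<close> on \<open>p\<close> and on its complement are mapped to elements with supports in \<open>p\<close> and in its
  complement.
\<close>

lemma derivation_ind_mult:
  assumes mem: "\<And>p. ind p * x \<in> X" and \<delta>: "derivation X Y \<delta>" "band_preserving X \<delta>"
  shows "\<delta> (ind p * x) = ind p * \<delta> x"
proof -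
  have vanish: "ind p * \<delta> (ind p' * x) = 0" if "inf p p' = bot" for p p'
  proof (rule ind_mult_eq_0_if_supp_le)
    show "supp (\<delta> (ind p' * x)) \<le> supp (ind p' * x)" using \<delta>(2) mem unfolding band_preserving_def by blast
    show "ind p * (ind p' * x) = 0" using that by (simp add: mult.assoc[symmetric] ind_inf[symmetric] ind_bot)
  qed
  have "\<delta> x = \<delta> (ind (- p) * x + ind p * x)" by (simp only: ind_compl_add)
  also have "\<dots> = \<delta> (ind (- p) * x) + \<delta> (ind p * x)" using \<delta>(1) mem unfolding derivation_def by blast
  finally have "ind p * \<delta> x = ind p * \<delta> (ind p * x)" by (simp add: distrib_left vanish)
  also have "\<dots> = \<delta> (ind p * x)"
    using ind_compl_add[of p "\<delta> (ind p * x)"] vanish[of "- p" p] by simp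
  finally show ?thesis ..
qed

lemma derivation_ind_eq_0:
  assumes X: "ideal_CQ X" and \<delta>: "derivation X Y \<delta>" "band_preserving X \<delta>" and p: "ind p \<in> X"
  shows "\<delta> (ind p) = 0"
proof -
  have idem: "ind p * ind p = ind p" by (simp add: ind_mult_ind)
  have d: "ind p * \<delta> (ind p) = \<delta> (ind p)" using derivation_ind_mult[OF ind_mult_in_ideal[OF X p] \<delta>, of p] by (simp add: idem)
  have "\<delta> (ind p * ind p) = \<delta> (ind p) * ind p + ind p * \<delta> (ind p)"
    using \<delta>(1) p unfolding derivation_def by blast
  then have "\<delta> (ind p) = \<delta> (ind p) + \<delta> (ind p)" by (simp add: idem d mult.commute)
  then show ?thesis by simp
qed

text \<open>
  Constants on a piece are invisible to the derivation, whereas factors are not; this lets small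
  oscillations of \<open>x\<close> be magnified.
\<close>

lemma derivation_affine:
  assumes X: "ideal_CQ X" and \<delta>: "derivation X Y \<delta>" "band_preserving X \<delta>" and x: "x \<in> X" and p: "ind p \<in> X"
  shows "\<delta> (N *\<^sub>R (ind p * x - r *\<^sub>R ind p)) = N *\<^sub>R (ind p * \<delta> x)"
proof -
  have sub: "subspace X" using X by (simp add: ideal_CQ_def)
  have lin: "\<delta> (a + b) = \<delta> a + \<delta> b" "\<delta> (s *\<^sub>R a) = s *\<^sub>R \<delta> a" if "a \<in> X" "b \<in> X" for a b s
    using \<delta>(1) that unfolding derivation_def by blast+
  have mem: "ind p * x \<in> X" "(- r) *\<^sub>R ind p \<in> X"
    using ind_mult_in_ideal[OF X x] p sub by (simp_all add: subspace_scale del: scaleR_minus_left)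
  have "\<delta> (N *\<^sub>R (ind p * x + (- r) *\<^sub>R ind p)) = N *\<^sub>R (\<delta> (ind p * x) + (- r) *\<^sub>R \<delta> (ind p))"
    by (simp only: lin(2)[OF subspace_add[OF sub mem] p] lin(1)[OF mem] lin(2)[OF p p])
  then show ?thesis by (simp add: derivation_ind_eq_0[OF X \<delta> p] derivation_ind_mult[OF ind_mult_in_ideal[OF X x] \<delta>])
qed

lemma eventually_mem_mono:
  assumes "p' \<le> p" "eventually (\<lambda>q. p \<in> q \<longrightarrow> P q) generically"
  shows "eventually (\<lambda>q. p' \<in> q \<longrightarrow> P q) generically"
proof -
  have up: "p \<in> q" if "ultrafilter q" "p' \<in> q" for q
    using that assms(1) unfolding ultrafilter_def by blast
  show ?thesis using assms(2) generically_ultrafilter by eventually_elim (intro impI, erule mp, erule up)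
qed

text \<open>
  A dense set of pieces \<open>p \<le> e\<close> carries \<open>N\<close> and \<open>r\<close> with \<open>\<bar>x - r\<bar> \<le> 1 / N\<close> and \<open>\<bar>y\<bar> \<le> N \<bar>\<delta> x\<bar>\<close>: bound \<open>y\<close>
  first, then choose \<open>N\<close>, then shrink the piece. Mixing the elements \<open>N (x - r)\<close> gives \<open>w\<close> with \<open>\<bar>w\<bar> \<le> 1\<close>. Thus
  \<open>w\<close> lies in \<open>C(Q)\<close>, its part on \<open>e\<close> lies in \<open>X\<close>, and the image of this part dominates \<open>y\<close> on \<open>e\<close>.
\<close>

lemma derivation_range_extended:
  fixes X Y :: "'b::complete_ba L0 set"
  assumes X: "ideal_CQ X" and Y: "solid_space Y"
    and \<delta>: "derivation X Y \<delta>" "band_preserving X \<delta>" and x: "x \<in> X" and e: "ind e \<in> X"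
    and c: "c > 0" "\<And>q. q \<in> clopen e \<Longrightarrow> c \<le> \<bar>val (\<delta> x) q\<bar>"
  shows "ind e * y \<in> Y"
proof -
  define steep where "steep p v \<longleftrightarrow> (\<exists>N r. v = N *\<^sub>R (x - r *\<^sub>R ind e) \<and> N \<ge> 0 \<and>
      eventually (\<lambda>q. p \<in> q \<longrightarrow> \<bar>val v q\<bar> \<le> 1) generically \<and>
      eventually (\<lambda>q. p \<in> q \<longrightarrow> \<bar>val y q\<bar> \<le> N * \<bar>val (\<delta> x) q\<bar>) generically)" for p v
  define R where "R p v \<longleftrightarrow> inf p e = bot \<and> v = 0 \<or> p \<le> e \<and> steep p v" for p v
  have "\<exists>w. \<forall>p. p \<noteq> bot \<longrightarrow> (\<exists>p'\<le>p. p' \<noteq> bot \<and> (\<exists>v. R p' v \<and> ind p' * w = ind p' * v))"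
  proof (rule L0_mixing)
    show "R p' v" if Rp: "R p v" and le: "p' \<le> p" for p p' v
    proof -
      have "inf p' e = bot" if "inf p e = bot"
        using inf_mono[OF le order_refl, of e] that by (simp add: bot_unique)
      moreover have "steep p' v" if steep: "steep p v"
      proof -
        obtain N r where *: "v = N *\<^sub>R (x - r *\<^sub>R ind e)" "N \<ge> 0"
          "eventually (\<lambda>q. p \<in> q \<longrightarrow> \<bar>val v q\<bar> \<le> 1) generically"
          "eventually (\<lambda>q. p \<in> q \<longrightarrow> \<bar>val y q\<bar> \<le> N * \<bar>val (\<delta> x) q\<bar>) generically"
          using steep unfolding steep_def by (elim exE conjE)
        show ?thesis
          unfolding steep_def
          by (intro exI conjI) (rule * eventually_mem_mono[OF le *(3)] eventually_mem_mono[OF le *(4)])+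
      qed
      ultimately show ?thesis using Rp le unfolding R_def by (meson order_trans)
    qed
    fix p :: 'b assume p: "p \<noteq> bot"
    show "\<exists>p'\<le>p. p' \<noteq> bot \<and> (\<exists>v. R p' v)"
    proof (cases "inf p e = bot")
      case True
      then show ?thesis using p unfolding R_def by blast
    next
      case False
      obtain p1 M where p1: "p1 \<le> inf p e" "p1 \<noteq> bot"
          and M: "\<And>q. q \<in> clopen p1 \<Longrightarrow> \<bar>apply_L0 y q\<bar> \<noteq> \<infinity> \<and> \<bar>val y q\<bar> \<le> M"
        using L0_locally_bounded[OF False, of y] by metis
      define N where "N = max 1 (M / c)"
      have N: "N > 0" "M \<le> N * c" using c(1) by (simp_all add: N_def flip: pos_divide_le_eq)
      obtain q0 where q0: "q0 \<in> clopen p1" "\<bar>apply_L0 x q0\<bar> \<noteq> \<infinity>"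
        using generic_point[OF generically_finite p1(2)] by metis
      have "1 / N > 0" using N by simp
      then obtain p2 where p2: "p2 \<le> p1" "q0 \<in> clopen p2"
          and near: "\<And>q. q \<in> clopen p2 \<Longrightarrow> \<bar>apply_L0 x q\<bar> \<noteq> \<infinity> \<and> \<bar>val x q - val x q0\<bar> < 1 / N"
        using L0_near[OF q0] by metis
      define v where "v = N *\<^sub>R (x - val x q0 *\<^sub>R ind e)"
      have p2e: "p2 \<le> e" "p2 \<le> p" using p1(1) p2(1) by (auto intro: order_trans)
      have "eventually (\<lambda>q. p2 \<in> q \<longrightarrow> \<bar>val v q\<bar> \<le> 1) generically"
        using val_ind[of e] val_scaleR[of N "x - val x q0 *\<^sub>R ind e"] val_scaleR[of "val x q0" "ind e"]
          val_minus[of x "val x q0 *\<^sub>R ind e"]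
      proof eventually_elim
        case (elim q)
        show ?case
        proof
          assume "p2 \<in> q"
          then have q: "q \<in> clopen p2" using elim by (simp add: clopen_def)
          then have "e \<in> q" using clopen_mono[OF p2e(1)] by (auto simp: clopen_def)
          then have "val v q = N * (val x q - val x q0)" unfolding v_def using elim by simp
          then have "\<bar>val v q\<bar> = N * \<bar>val x q - val x q0\<bar>" using N(1) by (simp add: abs_mult)
          also have "\<dots> \<le> N * (1 / N)" using near[OF q] N(1) by (intro mult_left_mono) simp_all
          finally show "\<bar>val v q\<bar> \<le> 1" using N(1) by simp
        qed
      qed
      moreover have "eventually (\<lambda>q. p2 \<in> q \<longrightarrow> \<bar>val y q\<bar> \<le> N * \<bar>val (\<delta> x) q\<bar>) generically"
        using generically_ultrafilter
      proof eventually_elim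
        case (elim q)
        show ?case
        proof
          assume "p2 \<in> q"
          then have q: "q \<in> clopen p2" using elim by (simp add: clopen_def)
          have "\<bar>val y q\<bar> \<le> N * c"
            using M[of q] q clopen_mono[OF p2(1)] N(2) by (meson order_trans subsetD)
          also have "\<dots> \<le> N * \<bar>val (\<delta> x) q\<bar>"
            using c(2)[of q] q clopen_mono[OF p2e(1)] N(1) by (intro mult_left_mono) auto
          finally show "\<bar>val y q\<bar> \<le> N * \<bar>val (\<delta> x) q\<bar>" .
        qed
      qed
      ultimately have "steep p2 v" unfolding steep_def v_def using N(1) less_imp_le by blast
      then show ?thesis using p2e clopen_nonbot[OF p2(2)] unfolding R_def by blast
    qed
  qed
  then obtain w where w: "\<forall>p. p \<noteq> bot \<longrightarrow> (\<exists>p'\<le>p. p' \<noteq> bot \<and> (\<exists>v. R p' v \<and> ind p' * w = ind p' * v))" ..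
  have "eventually (\<lambda>q. \<bar>val w q\<bar> \<le> 1) generically"
  proof (rule eventually_generically_locally)
    fix p :: 'b assume "p \<noteq> bot"
    from w[rule_format, OF this]
    obtain p' v where p': "p' \<le> p" "p' \<noteq> bot" "R p' v" "ind p' * w = ind p' * v" by (elim exE conjE)
    have "eventually (\<lambda>q. p' \<in> q \<longrightarrow> \<bar>val v q\<bar> \<le> 1) generically"
    proof (cases "v = 0")
      case True
      show ?thesis unfolding True using val_zero by eventually_elim simp
    next
      case False
      then show ?thesis using p'(3) unfolding R_def steep_def by blast
    qed
    then have "eventually (\<lambda>q. p' \<in> q \<longrightarrow> \<bar>val w q\<bar> \<le> 1) generically"
      using p'(4)[unfolded ind_mult_eq_iff] by eventually_elim simp
    then show "\<exists>p'\<le>p. p' \<noteq> bot \<and> eventually (\<lambda>q. p' \<in> q \<longrightarrow> \<bar>val w q\<bar> \<le> 1) generically"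
      using p'(1,2) by blast
  qed
  then have "w \<in> CQ" by (rule CQ_if_bounded)
  then have we: "w * ind e \<in> X" using X e unfolding ideal_CQ_def by blast
  have "\<bar>ind e * y\<bar> \<le> \<bar>\<delta> (w * ind e)\<bar>"
  proof (rule L0_leI, rule eventually_generically_locally)
    fix p :: 'b assume "p \<noteq> bot"
    from w[rule_format, OF this]
    obtain p' v where p': "p' \<le> p" "p' \<noteq> bot" "R p' v" "ind p' * w = ind p' * v" by (elim exE conjE)
    have "eventually (\<lambda>q. p' \<in> q \<longrightarrow> val \<bar>ind e * y\<bar> q \<le> val \<bar>\<delta> (w * ind e)\<bar> q) generically"
    proof (cases "inf p' e = bot")
      case True
      have "eventually (\<lambda>q. p' \<in> q \<longrightarrow> e \<notin> q) generically"
        using generically_ultrafilter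
        by eventually_elim (metis True ultrafilter_def)
      then show ?thesis
        using val_abs[of "ind e * y"] val_abs[of "\<delta> (w * ind e)"] val_times[of "ind e" y] val_ind[of e]
        by eventually_elim simp
    next
      case False
      then have p'e: "p' \<le> e" and "steep p' v" using p'(3) by (auto simp: R_def)
      then obtain N r where v: "v = N *\<^sub>R (x - r *\<^sub>R ind e)" "N \<ge> 0"
        and y: "eventually (\<lambda>q. p' \<in> q \<longrightarrow> \<bar>val y q\<bar> \<le> N * \<bar>val (\<delta> x) q\<bar>) generically"
        unfolding steep_def by blast
      have ind_p': "ind p' \<in> X" using ind_mult_in_ideal[OF X e, of p'] by (simp add: ind_mult_ind[OF p'e])
      have "ind p' * \<delta> (w * ind e) = \<delta> (ind p' * (w * ind e))"
        by (rule derivation_ind_mult[OF ind_mult_in_ideal[OF X we] \<delta>, symmetric])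
      also have "ind p' * (w * ind e) = (ind p' * ind e) * w" by (simp only: ac_simps)
      also have "\<dots> = ind p' * v" by (simp add: ind_mult_ind[OF p'e] p'(4))
      also have "\<dots> = N *\<^sub>R (ind p' * x - r *\<^sub>R ind p')"
        by (simp add: v right_diff_distrib ind_mult_ind[OF p'e])
      also have "\<delta> \<dots> = N *\<^sub>R (ind p' * \<delta> x)" by (rule derivation_affine[OF X \<delta> x ind_p'])
      also have "\<dots> = ind p' * (N *\<^sub>R \<delta> x)" by simp
      finally have "eventually (\<lambda>q. p' \<in> q \<longrightarrow> val (\<delta> (w * ind e)) q = val (N *\<^sub>R \<delta> x) q) generically"
        by (simp only: ind_mult_eq_iff)
      then show ?thesis
        using y val_scaleR[of N "\<delta> x"] val_abs[of "ind e * y"] val_abs[of "\<delta> (w * ind e)"]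
          val_times[of "ind e" y] val_ind[of e]
      proof eventually_elim
        case (elim q)
        have "\<bar>N * val (\<delta> x) q\<bar> = N * \<bar>val (\<delta> x) q\<bar>" using v(2) by (simp add: abs_mult)
        then show ?case using elim p'e by (auto simp: ultrafilter_def)
      qed
    qed
    then show "\<exists>p'\<le>p. p' \<noteq> bot \<and>
        eventually (\<lambda>q. p' \<in> q \<longrightarrow> val \<bar>ind e * y\<bar> q \<le> val \<bar>\<delta> (w * ind e)\<bar> q) generically"
      using p'(1,2) by blast
  qed
  moreover have "\<delta> (w * ind e) \<in> Y" using \<delta>(1) we unfolding derivation_def by blast
  ultimately show ?thesis using Y unfolding solid_space_def by blast
qed

text \<open>
  Otherwise \<open>x\<close> would be constant on a piece \<open>f\<close> of \<open>e\<close>, so that \<open>\<delta> x\<close> would vanish on \<open>f\<close>.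
\<close>

lemma derivation_not_sigma_distributive:
  assumes X: "ideal_CQ X" and \<delta>: "derivation X Y \<delta>" "band_preserving X \<delta>" and x: "x \<in> X"
    and e: "e \<noteq> bot" "e \<le> supp x" "e \<le> supp (\<delta> x)" "ind e \<in> X"
  shows "\<not> sigma_distributive {..e}"
proof
  assume "sigma_distributive {..e}"
  then obtain f r where f: "f \<le> e" "f \<noteq> bot" "ind f * x = r *\<^sub>R ind f"
    using sigma_distributive_locally_constant e(1) by blast
  have ind_f: "ind f \<in> X" using ind_mult_in_ideal[OF X e(4), of f] by (simp add: ind_mult_ind[OF f(1)])
  have "ind f * \<delta> x = 1 *\<^sub>R (ind f * \<delta> x)" by simp
  also have "\<dots> = \<delta> (1 *\<^sub>R (ind f * x - r *\<^sub>R ind f))" by (rule derivation_affine[OF X \<delta> x ind_f, symmetric])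
  also have "\<dots> = \<delta> (ind bot * x)" by (simp add: f(3) ind_bot)
  also have "\<dots> = ind bot * \<delta> x" by (rule derivation_ind_mult[OF ind_mult_in_ideal[OF X x] \<delta>])
  also have "\<dots> = 0" by (simp add: ind_bot)
  finally show False using f(1,2) e(3) unfolding le_supp_iff by blast
qed

section \<open>The equivalence\<close>

lemma nonzero_derivation_imp_extended:
  fixes X Y :: "'b::complete_ba L0 set"
  assumes X: "ideal_CQ X" and Y: "solid_space Y"
    and \<delta>: "derivation X Y \<delta>" "band_preserving X \<delta>" and x: "x \<in> X" "\<delta> x \<noteq> 0"
  shows "\<exists>e. e \<noteq> bot \<and> e \<le> inf (Supp X) (Supp Y) \<and>
       (\<lambda>y. ind e * y) ` Y = (\<lambda>y. ind e * y) ` UNIV \<and> \<not> sigma_distributive {..e}"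
proof -
  have "ind top * \<delta> x \<noteq> 0" using x(2) by (simp add: ind_top L0_one_mult)
  then obtain e1 c1 where e1: "e1 \<noteq> bot" "c1 > 0"
    "\<And>q. q \<in> clopen e1 \<Longrightarrow> \<bar>apply_L0 (\<delta> x) q\<bar> \<noteq> \<infinity> \<and> c1 \<le> \<bar>val (\<delta> x) q\<bar>"
    using L0_bounded_below_on by metis
  have "e1 \<le> supp (\<delta> x)" using e1(2,3) le_supp_if_bounded_below by blast
  also have "supp (\<delta> x) \<le> supp x" using \<delta>(2) x(1) unfolding band_preserving_def by blast
  finally have "ind e1 * x \<noteq> 0" using e1(1) le_supp_iff by (metis order_refl)
  then obtain e c where e: "e \<le> e1" "e \<noteq> bot" "c > 0"
    "\<And>q. q \<in> clopen e \<Longrightarrow> \<bar>apply_L0 x q\<bar> \<noteq> \<infinity> \<and> c \<le> \<bar>val x q\<bar>"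
    using L0_bounded_below_on by metis
  have ind_e: "ind e \<in> X" by (rule ind_in_ideal[OF X x(1) e(3,4)])
  have supp_x: "e \<le> supp x" using e(3,4) le_supp_if_bounded_below by blast
  have supp_d: "e \<le> supp (\<delta> x)" using e(1) \<open>e1 \<le> supp (\<delta> x)\<close> by (rule order_trans)
  have \<delta>x: "\<delta> x \<in> Y" using \<delta>(1) x(1) unfolding derivation_def by blast
  have bound: "c1 \<le> \<bar>val (\<delta> x) q\<bar>" if "q \<in> clopen e" for q
    using e1(3) clopen_mono[OF e(1)] that by blast
  have ext: "ind e * y \<in> Y" for y
    by (rule derivation_range_extended[OF X Y \<delta> x(1) ind_e e1(2) bound])
  have "e \<le> Supp X" unfolding Supp_def using supp_x x(1) by (rule SUP_upper2[rotated])
  moreover have "e \<le> Supp Y" unfolding Supp_def using supp_d \<delta>x by (rule SUP_upper2[rotated])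
  moreover have "(\<lambda>y. ind e * y) ` Y = (\<lambda>y. ind e * y) ` UNIV"
  proof (rule equalityI)
    show "(\<lambda>y. ind e * y) ` UNIV \<subseteq> (\<lambda>y. ind e * y) ` Y"
    proof (rule image_subsetI)
      fix y
      have "ind e * y = ind e * (ind e * y)" by (simp add: ind_mult_absorb)
      then show "ind e * y \<in> (\<lambda>y. ind e * y) ` Y" using ext by (rule image_eqI)
    qed
  qed (rule image_mono, rule subset_UNIV)
  moreover have "\<not> sigma_distributive {..e}"
    by (rule derivation_not_sigma_distributive[OF X \<delta> x(1) e(2) supp_x supp_d ind_e])
  ultimately show ?thesis using e(2) by (intro exI[of _ e] conjI le_infI)
qed

text \<open>
  Cut a derivation \<open>D\<close> of \<open>L\<^sup>0\<close> with \<open>D z = 1\<close> on \<open>f \<le> e\<close> down to \<open>e\<close>; its range then lies in \<open>Y\<close>. It does not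
  vanish on \<open>X\<close>, because on some piece \<open>p'\<close> of \<open>f\<close> some element of \<open>X\<close> is invertible and \<open>z\<close> is bounded, which
  puts the part of \<open>z\<close> on \<open>p'\<close> into \<open>X\<close>.
\<close>

lemma extended_imp_nonzero_derivation:
  fixes X Y :: "'b::complete_ba L0 set"
  assumes X: "ideal_CQ X" and Y: "solid_space Y"
    and e: "e \<le> Supp X" "(\<lambda>y. ind e * y) ` Y = (\<lambda>y. ind e * y) ` UNIV"
      "\<not> sigma_distributive {..e}"
  shows "\<exists>\<delta>. derivation X Y \<delta> \<and> band_preserving X \<delta> \<and> (\<exists>x\<in>X. \<delta> x \<noteq> 0)"
proof -
  obtain f z where f: "f \<le> e" "f \<noteq> bot" "nowhere_constant_on f z"
    using not_sigma_distributive_nowhere_constant[OF e(3)] .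
  obtain D where D: "derivation UNIV UNIV D" "band_preserving UNIV D" "ind f * D z = ind f"
    using derivation_of_nowhere_constant[OF f(3)] .
  define \<delta> where "\<delta> x = ind e * D x" for x
  have D_simps: "D (x + y) = D x + D y" "D (r *\<^sub>R x) = r *\<^sub>R D x" "D (x * y) = D x * y + x * D y" for x y r
    using D(1) unfolding derivation_def by simp_all
  have "ind e * y \<in> Y" for y
  proof -
    have "ind e * y \<in> (\<lambda>y. ind e * y) ` Y" unfolding e(2) by blast
    then obtain y0 where y0: "y0 \<in> Y" "ind e * y = ind e * y0" by blast
    have "\<bar>ind e * y0\<bar> \<le> \<bar>y0\<bar>"
      by (rule L0_leI)
        (use val_abs[of "ind e * y0"] val_abs[of y0] val_times[of "ind e" y0] val_ind[of e] in
          \<open>eventually_elim, simp\<close>)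
    then show ?thesis using Y y0 unfolding solid_space_def by metis
  qed
  then have "derivation X Y \<delta>"
    unfolding derivation_def \<delta>_def by (simp add: D_simps distrib_left ac_simps)
  moreover have "band_preserving X \<delta>"
    unfolding band_preserving_def
  proof
    fix x
    have "supp (\<delta> x) \<le> supp (D x)"
      unfolding \<delta>_def by (rule le_supp_mono) (simp add: mult.left_commute[of _ "ind e"])
    also have "\<dots> \<le> supp x" using D(2) unfolding band_preserving_def by blast
    finally show "supp (\<delta> x) \<le> supp x" .
  qed
  moreover have "\<exists>x\<in>X. \<delta> x \<noteq> 0"
  proof -
    have "inf f (Supp X) = f" using f(1) e(1) by (simp add: inf.absorb1)
    then have "inf f (Sup (supp ` X)) \<noteq> bot" using f(2) by (simp add: Supp_def)
    then obtain x where x: "x \<in> X" "inf f (supp x) \<noteq> bot" unfolding inf_Sup_eq_bot_iff by blast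
    have "ind (inf f (supp x)) * x \<noteq> 0" using iffD1[OF le_supp_iff inf_le2, of f x] x(2) by blast
    then obtain p c where p: "p \<le> inf f (supp x)" "p \<noteq> bot" "c > 0"
      "\<And>q. q \<in> clopen p \<Longrightarrow> \<bar>apply_L0 x q\<bar> \<noteq> \<infinity> \<and> c \<le> \<bar>val x q\<bar>"
      using L0_bounded_below_on by metis
    obtain p' M where p': "p' \<le> p" "p' \<noteq> bot"
      "\<And>q. q \<in> clopen p' \<Longrightarrow> \<bar>apply_L0 z q\<bar> \<noteq> \<infinity> \<and> \<bar>val z q\<bar> \<le> M"
      using L0_locally_bounded[OF p(2), of z] by metis
    have "ind p \<in> X" by (rule ind_in_ideal[OF X x(1) p(3,4)])
    from ind_mult_in_ideal[OF X this, of p'] have ind_p': "ind p' \<in> X" by (simp add: ind_mult_ind[OF p'(1)])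
    have "eventually (\<lambda>q. \<bar>val (ind p' * z) q\<bar> \<le> max M 0) generically"
      using val_times[of "ind p'" z] val_ind[of p']
    proof eventually_elim
      case (elim q)
      then show ?case using p'(3)[of q] by (cases "p' \<in> q") (simp_all add: clopen_def le_max_iff_disj)
    qed
    then have "ind p' * z \<in> CQ" by (rule CQ_if_bounded)
    then have mem: "(ind p' * z) * ind p' \<in> X" using X ind_p' unfolding ideal_CQ_def by blast
    have eq: "(ind p' * z) * ind p' = ind p' * z" by (metis ind_mult_absorb mult.commute order_refl)
    have p'f: "p' \<le> f" using order_trans[OF p'(1) p(1)] by simp
    have "D (ind p' * z) = ind p' * D z"
      by (rule derivation_ind_mult[OF _ D(1,2)]) simp
    then have "ind p' * \<delta> (ind p' * z) = ind p' * (ind f * D z)"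
      unfolding \<delta>_def by (simp add: ind_mult_absorb p'f order_trans[OF p'f f(1)])
    also have "\<dots> = ind p'" by (simp add: D(3) ind_mult_ind[OF p'f])
    finally have "\<delta> (ind p' * z) \<noteq> 0" using p'(2) by (metis ind_eq_0_iff mult_zero_right)
    then show ?thesis using mem unfolding eq by blast
  qed
  ultimately show ?thesis by blast
qed

theorem theorem5p1:
  fixes X Y :: "'b::complete_ba L0 set"
  assumes "ideal_CQ X" and "solid_space Y"
  shows "(\<exists>\<delta>. derivation X Y \<delta> \<and> band_preserving X \<delta> \<and> (\<exists>x\<in>X. \<delta> x \<noteq> 0)) \<longleftrightarrow>
    (\<exists>e. e \<noteq> bot \<and> e \<le> inf (Supp X) (Supp Y) \<and>
       (\<lambda>y. ind e * y) ` Y = (\<lambda>y. ind e * y) ` UNIV \<and> \<not> sigma_distributive {..e})"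
  using nonzero_derivation_imp_extended[OF assms] extended_imp_nonzero_derivation[OF assms]
  by (metis le_inf_iff)

end
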